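(* There exists a sequence $\Lambda_0\subseteq\mathbb{D}^2$ that is simply interpolating for $H^p(\mathbb{D}^2)$ for every $1\le p\le 2$, but that is not a Carleson sequence for $H^r(\mathbb{D}^2)$ for any $1\le r<\infty$.
   Context: $\mathbb{D}$ is the open unit disc, $\mathbb{T}$ the unit circle, $m$ the normalized Haar (probability) measure on $\mathbb{T}^2$. For $1\le p<\infty$, $H^p(\mathbb{D}^2)$ is the space of holomorphic functions $f$ on $\mathbb{D}^2$ with $\|f\|_p^p:=\sup_{0<r<1}\int_{\mathbb{T}^2}|f(rz)|^p\,dm(z)<\infty$. For a sequence $\Lambda=(\lambda_n)_n\subseteq\mathbb{D}^2$, $\lambda_n=(\lambda_n^1,\lambda_n^2)$, and $f\in H^p(\mathbb{D}^2)$, set $$T^p_\Lambda(f)=\Big(f(\lambda_n)\prod_{i=1}^2(1-|\lambda_n^i|^2)^{1/p}\Big)_n .$$ $\Lambda$ is simply interpolating for $H^p(\mathbb{D}^2)$ if $T^p_\Lambda(H^p(\mathbb{D}^2))\supseteq\ell^p$ (every element of $\ell^p$ equals $T^p_\Lambda(f)$ for some $f\in H^p(\mathbb{D}^2)$), and it is a Carleson sequence for $H^p(\mathbb{D}^2)$ if $T^p_\Lambda(H^p(\mathbb{D}^2))\subseteq\ell^p$. *)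

theory Defs
  imports "HOL-Analysis.Analysis"
begin

definition bidisc :: "(complex \<times> complex) set" where
  "bidisc = ball 0 1 \<times> ball 0 1"

text \<open>Holomorphy in two variables is complex Frechet differentiability: the derivative at
  each point is a complex-linear map \<open>h \<mapsto> a h\<^sub>1 + b h\<^sub>2\<close>. Functions are total in HOL;
  only their values on \<open>S\<close> are constrained.\<close>

definition holomorphic2_on :: "(complex \<times> complex \<Rightarrow> complex) \<Rightarrow> (complex \<times> complex) set \<Rightarrow> bool"
    (infixl "holomorphic2'_on" 50) where
  "f holomorphic2_on S \<longleftrightarrow>
     (\<forall>z\<in>S. \<exists>a b. (f has_derivative (\<lambda>h. a * fst h + b * snd h)) (at z within S))"

text \<open>Normalized Haar measure on the unit circle, as the image of the uniform distribution on
  \<open>[0,1]\<close> under \<open>t \<mapsto> exp (2 \<pi> i t)\<close>; the Haar measure on the two-torus is its square.\<close>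

definition circle_haar :: "complex measure" where
  "circle_haar = distr (uniform_measure lborel {0..1::real}) (restrict_space borel (sphere 0 1))
                   (\<lambda>t. cis (2 * pi * t))"

definition torus_haar :: "(complex \<times> complex) measure" where
  "torus_haar = circle_haar \<Otimes>\<^sub>M circle_haar"

definition Hardy :: "real \<Rightarrow> (complex \<times> complex \<Rightarrow> complex) set" where
  "Hardy p = {f. f holomorphic2_on bidisc \<and>
     (SUP r\<in>{0<..<1::real}. \<integral>\<^sup>+ z. ennreal (norm (f (r *\<^sub>R z)) powr p) \<partial>torus_haar) < \<infinity>}"

definition ell :: "real \<Rightarrow> (nat \<Rightarrow> complex) set" where
  "ell p = {a. summable (\<lambda>n. norm (a n) powr p)}"

definition T_op :: "real \<Rightarrow> (nat \<Rightarrow> complex \<times> complex) \<Rightarrow> (complex \<times> complex \<Rightarrow> complex) \<Rightarrow> nat \<Rightarrow> complex" where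
  "T_op p \<Lambda> f = (\<lambda>n. f (\<Lambda> n) *
     complex_of_real ((1 - (norm (fst (\<Lambda> n)))\<^sup>2) powr (1 / p) *
                      (1 - (norm (snd (\<Lambda> n)))\<^sup>2) powr (1 / p)))"

definition simply_interpolating :: "real \<Rightarrow> (nat \<Rightarrow> complex \<times> complex) \<Rightarrow> bool" where
  "simply_interpolating p \<Lambda> \<longleftrightarrow> ell p \<subseteq> T_op p \<Lambda> ` Hardy p"

definition carleson_sequence :: "real \<Rightarrow> (nat \<Rightarrow> complex \<times> complex) \<Rightarrow> bool" where
  "carleson_sequence p \<Lambda> \<longleftrightarrow> T_op p \<Lambda> ` Hardy p \<subseteq> ell p"

end

(* The points are arranged in blocks of total weight about 1, where the weight of a point is
   w = (1 - |z|^2)(1 - |w|^2). Then the weights have infinite sum, and the constant function 1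
   shows that the sequence is not Carleson for any exponent.

   Block N is a union of d shapes; shape i is a part of a grid of B^(i+1)-th roots of unity times
   B^(d-i)-th roots of unity, on circles whose distance to the torus is the mesh size. To a point
   one attaches the function E(z, w) = e(z) * (1 - z^d) / (1 - z_n^d) * e'(w), where e and e' are
   squares of discrete Fourier (Dirichlet type) kernels. E is 1 at its point and 0 at the other
   points of its shape. It is tiny at the other shapes of the block and at earlier blocks, because
   one of the kernels has only frequencies far above the scale of those points. It is tiny at
   later blocks, because these lie in a thin sector around z = 1, where 1 - z^d is small.
   The distinct shapes use disjoint frequencies in z, so the map (g_n) -> sum g_n E_n is bounded
   from weighted l^2 to H^2; it is bounded from weighted l^1 to H^1 because each E_n has integral
   at most a multiple of its weight. Real interpolation gives all p between 1 and 2, and since the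
   matrix E_n(lambda_k) is a small perturbation of the identity, every admissible sequence of
   values is attained. *)

theory Submission
  imports Defs "HOL-Complex_Analysis.Cauchy_Integral_Formula"
begin

section \<open>Integration on the circle and the torus\<close>

text \<open>In one variable a simply interpolating sequence is forced to be Carleson, so the two
  coordinates have to be played against each other. Two grids of equal area and different
  proportions do this: the one that is finer in z is coarser in w, so each kernel of the pair has
  high frequency in one variable relative to the other grid. Hence the exponents
  \<open>i + 1\<close> and \<open>d - i\<close>, whose sum is constant. Different blocks cannot be
  balanced in this way: a later block is finer in both variables, and only the factor 1 - z^d makes
  the earlier functions small there. For this the points of a block must lie within O(1/d) of z = 1,
  in a sector holding a fraction 1/(2 d) of each grid; taking d shapes restores the lost mass. The
  kernels are squared because the integral of |e|^2 is of order 1/L, whereas that of |e| carries an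
  additional logarithm. The squares also allow Cauchy-Schwarz with a pointwise bounded sum, which
  replaces orthogonality inside a shape.\<close>

lemma cis_measurable: "(\<lambda>t::real. cis (2 * pi * t)) \<in> measurable (uniform_measure lborel {0..1}) (restrict_space borel (sphere 0 1))"
proof (rule measurable_restrict_space2)
  have "(\<lambda>t::real. cis (2 * pi * t)) \<in> borel_measurable borel"
    by (auto intro!: borel_measurable_continuous_onI continuous_intros)
  then show "(\<lambda>t::real. cis (2 * pi * t)) \<in> borel_measurable (uniform_measure lborel {0..1})"
    by (simp cong: measurable_cong_sets)
qed auto

lemma nn_integral_circle:
  assumes [measurable]: "f \<in> borel_measurable borel"
  shows "(\<integral>\<^sup>+ z. f z \<partial>circle_haar) = (\<integral>\<^sup>+ t. f (cis (2 * pi * t)) * indicator {0..1::real} t \<partial>lborel)"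
proof -
  have m[measurable]: "(\<lambda>t::real. cis (2 * pi * t)) \<in> borel_measurable borel"
    by (auto intro!: borel_measurable_continuous_onI continuous_intros)
  have "(\<integral>\<^sup>+ z. f z \<partial>circle_haar) = (\<integral>\<^sup>+ t. f (cis (2 * pi * t)) \<partial>uniform_measure lborel {0..1::real})"
    unfolding circle_haar_def
    by (subst nn_integral_distr[OF cis_measurable]) (auto simp: measurable_restrict_space1)
  also have "\<dots> = (\<integral>\<^sup>+ t. f (cis (2 * pi * t)) * indicator {0..1::real} t \<partial>lborel)"
    by (subst nn_integral_uniform_measure) (auto simp: divide_ennreal_def)
  finally show ?thesis .
qed

lemma sets_circle: "sets circle_haar = sets (restrict_space borel (sphere 0 1))"
  and space_circle: "space circle_haar = sphere 0 1"
  by (auto simp: circle_haar_def space_restrict_space)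

lemma emeasure_circle: "emeasure circle_haar (space circle_haar) = 1"
  using nn_integral_circle[of "\<lambda>_. 1"] by simp

lemma finite_circle: "finite_measure circle_haar"
  by (rule finite_measureI) (simp add: emeasure_circle)

lemma measurable_circle: "f \<in> borel_measurable borel \<Longrightarrow> f \<in> borel_measurable circle_haar"
  by (simp add: measurable_cong_sets[OF sets_circle refl] measurable_restrict_space1)

lemma fst_torus: "fst \<in> borel_measurable torus_haar" and snd_torus: "snd \<in> borel_measurable torus_haar"
  unfolding torus_haar_def
  by (rule measurable_compose[OF measurable_fst measurable_circle[of "\<lambda>x. x"]], simp)
     (rule measurable_compose[OF measurable_snd measurable_circle[of "\<lambda>x. x"]], simp)

lemma measurable_torus:
  assumes "f \<in> borel_measurable borel"
  shows "f \<in> borel_measurable torus_haar"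
proof -
  have "(\<lambda>x. (fst x, snd x)) \<in> borel_measurable torus_haar"
    using fst_torus snd_torus by (rule borel_measurable_Pair)
  then show ?thesis
    using measurable_compose[OF _ assms] by simp
qed

lemma space_torus: "space torus_haar = sphere 0 1 \<times> sphere 0 1"
  by (simp add: torus_haar_def space_pair_measure space_circle)

text \<open>The first coordinate is the inner variable, so that one-variable orthogonality in z can
  be applied for each fixed w.\<close>

lemma nn_integral_torus:
  assumes "f \<in> borel_measurable borel"
  shows "(\<integral>\<^sup>+ x. f x \<partial>torus_haar) = (\<integral>\<^sup>+ w. \<integral>\<^sup>+ z. f (z, w) \<partial>circle_haar \<partial>circle_haar)"
proof -
  interpret finite_measure circle_haar by (rule finite_circle)
  interpret pair_sigma_finite circle_haar circle_haar by unfold_locales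
  have "f \<in> borel_measurable (circle_haar \<Otimes>\<^sub>M circle_haar)"
    using measurable_torus[OF assms] by (simp add: torus_haar_def)
  then show ?thesis
    unfolding torus_haar_def by (subst nn_integral_snd[symmetric]) auto
qed

text \<open>Orthonormality of the characters. For different exponents the antiderivative
  \<open>cis (k * t) / (\<i> * k)\<close> takes the same value at 0 and 1, since k is an integer
  multiple of 2 pi.\<close>

lemma cis_has_integral:
  fixes a b :: nat
  shows "has_bochner_integral lborel (\<lambda>t. indicator {0..1::real} t *\<^sub>R cis (2 * pi * (real a - real b) * t))
           (if a = b then 1 else 0)"
proof (cases "a = b")
  case True
  have "has_bochner_integral lborel (indicator {0..1::real}) (1::real)"
    using has_bochner_integral_real_indicator[of "{0..1::real}" lborel] by simp
  then have "has_bochner_integral lborel (\<lambda>x. indicator {0..1::real} x *\<^sub>R (1::complex)) ((1::real) *\<^sub>R 1)"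
    by (rule has_bochner_integral_scaleR_left)
  then show ?thesis using True by simp
next
  case False
  define k where "k = 2 * pi * (real a - real b)"
  have k: "k \<noteq> 0" using False by (simp add: k_def)
  have "cis k = 1"
    using cis_multiple_2pi[of "real a - real b"] by (simp add: k_def mult.commute)
  moreover have "has_bochner_integral lborel (\<lambda>t. indicator {0..1::real} t *\<^sub>R cis (k * t))
     ((cis (k * 1)) / (\<i> * k) - cis (k * 0) / (\<i> * k))"
  proof (rule has_bochner_integral_FTC_Icc)
    fix x :: real
    show "((\<lambda>t. cis (k * t) / (\<i> * k)) has_vector_derivative cis (k * x)) (at x within {0..1})"
    proof -
      have "((\<lambda>z. exp (\<i> * (k * z)) / (\<i> * k)) has_field_derivative exp (\<i> * (k * of_real x))) (at (of_real x))"
      proof -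
        have "((\<lambda>z. exp (\<i> * (k * z))) has_field_derivative exp (\<i> * (k * of_real x)) * (\<i> * k)) (at (of_real x))"
          by (auto intro!: derivative_eq_intros)
        from DERIV_cdivide[OF this, of "\<i> * k"] show ?thesis
          using k by simp
      qed
      from has_vector_derivative_real_field[OF this, of "{0..1}"] show ?thesis
        by (simp add: cis_conv_exp)
    qed
  qed (auto intro!: continuous_intros)
  ultimately show ?thesis using False by (simp add: k_def)
qed

lemma circle_parseval:
  fixes c :: "nat \<Rightarrow> complex"
  assumes "finite S"
  shows "(\<integral>\<^sup>+ z. ennreal ((norm (\<Sum>a\<in>S. c a * z ^ a))\<^sup>2) \<partial>circle_haar) = ennreal (\<Sum>a\<in>S. (norm (c a))\<^sup>2)"
proof -
  let ?P = "\<lambda>z. \<Sum>a\<in>S. c a * z ^ a"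
  have "has_bochner_integral lborel
      (\<lambda>t. \<Sum>a\<in>S. \<Sum>b\<in>S. (c a * cnj (c b)) * (indicator {0..1::real} t *\<^sub>R cis (2 * pi * (real a - real b) * t)))
      (\<Sum>a\<in>S. \<Sum>b\<in>S. (c a * cnj (c b)) * (if a = b then 1 else 0))"
    by (intro has_bochner_integral_sum has_bochner_integral_mult_right cis_has_integral)
  also have "(\<Sum>a\<in>S. \<Sum>b\<in>S. (c a * cnj (c b)) * (if a = b then 1 else 0)) = of_real (\<Sum>a\<in>S. (norm (c a))\<^sup>2)"
    using assms by (simp add: if_distrib complex_norm_square del: of_real_power cong: if_cong)
  also have "(\<lambda>t. \<Sum>a\<in>S. \<Sum>b\<in>S. (c a * cnj (c b)) * (indicator {0..1::real} t *\<^sub>R cis (2 * pi * (real a - real b) * t)))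
    = (\<lambda>t. of_real ((norm (?P (cis (2 * pi * t))))\<^sup>2 * indicator {0..1} t))"
  proof
    fix t :: real
    have "cis (2 * pi * (real a - real b) * t) = cis (2 * pi * t) ^ a * cnj (cis (2 * pi * t) ^ b)" for a b
      unfolding complex_cnj_power cis_cnj Complex.DeMoivre cis_mult by (rule arg_cong[of _ _ cis]) (simp add: algebra_simps)
    then show "(\<Sum>a\<in>S. \<Sum>b\<in>S. (c a * cnj (c b)) * (indicator {0..1::real} t *\<^sub>R cis (2 * pi * (real a - real b) * t)))
      = of_real ((norm (?P (cis (2 * pi * t))))\<^sup>2 * indicator {0..1} t)"
      unfolding of_real_mult complex_norm_square cnj_sum sum_product
      by (simp add: mult_ac scaleR_conv_of_real sum_distrib_left)
  qed
  finally have "has_bochner_integral lborel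
     (\<lambda>t. complex_of_real ((norm (?P (cis (2 * pi * t))))\<^sup>2 * indicator {0..1} t)) (of_real (\<Sum>a\<in>S. (norm (c a))\<^sup>2))" .
  from has_bochner_integral_Re[OF this] have hb: "has_bochner_integral lborel
     (\<lambda>t. (norm (?P (cis (2 * pi * t))))\<^sup>2 * indicator {0..1} t) (\<Sum>a\<in>S. (norm (c a))\<^sup>2)"
    by simp
  have "(\<integral>\<^sup>+ z. ennreal ((norm (?P z))\<^sup>2) \<partial>circle_haar)
     = (\<integral>\<^sup>+ t. ennreal ((norm (?P (cis (2 * pi * t))))\<^sup>2) * indicator {0..1::real} t \<partial>lborel)"
    by (rule nn_integral_circle) measurable
  also have "\<dots> = (\<integral>\<^sup>+ t. ennreal ((norm (?P (cis (2 * pi * t))))\<^sup>2 * indicator {0..1} t) \<partial>lborel)"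
    by (intro nn_integral_cong) (auto simp: indicator_def)
  also have "\<dots> = ennreal (\<Sum>a\<in>S. (norm (c a))\<^sup>2)"
    by (subst nn_integral_eq_integral) (use hb in \<open>auto simp: has_bochner_integral_iff\<close>)
  finally show ?thesis .
qed

lemma poly_scaled_sum:
  fixes p :: "complex poly"
  assumes "degree p \<le> N"
  shows "poly p (r * z) = (\<Sum>a\<le>N. (coeff p a * r ^ a) * z ^ a)"
proof -
  have "poly p (r * z) = (\<Sum>a\<le>N. coeff p a * (r * z) ^ a)"
    unfolding poly_altdef
    by (rule sum.mono_neutral_left) (use assms in \<open>auto simp: not_le coeff_eq_0\<close>)
  then show ?thesis by (simp add: power_mult_distrib mult.assoc)
qed

text \<open>At each frequency at most one summand has a nonzero coefficient, so no cross terms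
  survive in Parseval's identity. The dilation by r only rescales coefficients and does not enlarge
  the spectra.\<close>

lemma circle_orthogonal:
  fixes P :: "'s \<Rightarrow> complex poly"
  assumes "finite S"
    and disj: "\<And>s t a. s \<in> S \<Longrightarrow> t \<in> S \<Longrightarrow> s \<noteq> t \<Longrightarrow> coeff (P s) a \<noteq> 0 \<Longrightarrow> coeff (P t) a = 0"
  shows "(\<integral>\<^sup>+ z. ennreal ((norm (\<Sum>s\<in>S. poly (P s) (r * z)))\<^sup>2) \<partial>circle_haar)
       = (\<Sum>s\<in>S. \<integral>\<^sup>+ z. ennreal ((norm (poly (P s) (r * z)))\<^sup>2) \<partial>circle_haar)"
proof -
  define N where "N = Max (insert 0 ((\<lambda>s. degree (P s)) ` S))"
  have N: "degree (P s) \<le> N" if "s \<in> S" for s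
    unfolding N_def using that assms(1) by (intro Max_ge) auto
  define c where "c s a = coeff (P s) a * r ^ a" for s a
  have one: "(norm (\<Sum>s\<in>S. c s a))\<^sup>2 = (\<Sum>s\<in>S. (norm (c s a))\<^sup>2)" for a
  proof (cases "\<exists>s\<in>S. c s a \<noteq> 0")
    case True
    then obtain s where s: "s \<in> S" "c s a \<noteq> 0" by blast
    then have z: "c t a = 0" if "t \<in> S" "t \<noteq> s" for t
      using disj[of s t a] that by (auto simp: c_def)
    have "(\<Sum>t\<in>S. c t a) = (\<Sum>t\<in>{s}. c t a)"
      by (rule sum.mono_neutral_right) (use assms(1) s z in auto)
    moreover have "(\<Sum>t\<in>S. (norm (c t a))\<^sup>2) = (\<Sum>t\<in>{s}. (norm (c t a))\<^sup>2)"
      by (rule sum.mono_neutral_right) (use assms(1) s z in auto)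
    ultimately show ?thesis by simp
  qed simp
  have eq: "poly (P s) (r * z) = (\<Sum>a\<le>N. c s a * z ^ a)" if "s \<in> S" for s z
    using poly_scaled_sum[OF N[OF that]] by (simp add: c_def)
  have "(\<Sum>s\<in>S. poly (P s) (r * z)) = (\<Sum>a\<le>N. (\<Sum>s\<in>S. c s a) * z ^ a)" for z
    by (simp add: eq sum_distrib_right sum.swap[of _ _ "{..N}"])
  then have "(\<integral>\<^sup>+ z. ennreal ((norm (\<Sum>s\<in>S. poly (P s) (r * z)))\<^sup>2) \<partial>circle_haar)
    = ennreal (\<Sum>a\<le>N. \<Sum>s\<in>S. (norm (c s a))\<^sup>2)"
    by (simp add: circle_parseval one)
  also have "\<dots> = ennreal (\<Sum>s\<in>S. \<Sum>a\<le>N. (norm (c s a))\<^sup>2)"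
    by (subst sum.swap) simp
  also have "\<dots> = (\<Sum>s\<in>S. ennreal (\<Sum>a\<le>N. (norm (c s a))\<^sup>2))"
    by (simp add: sum_nonneg)
  also have "\<dots> = (\<Sum>s\<in>S. \<integral>\<^sup>+ z. ennreal ((norm (poly (P s) (r * z)))\<^sup>2) \<partial>circle_haar)"
    by (intro sum.cong refl) (simp add: eq circle_parseval)
  finally show ?thesis .
qed

lemma int_dvd_diff_iff:
  assumes "j < L" "k < L"
  shows "int L dvd int k - int j \<longleftrightarrow> j = k"
proof
  assume d: "int L dvd int k - int j"
  have "\<bar>int k - int j\<bar> < int L" using assms by auto
  with dvd_imp_le_int[OF _ d] show "j = k" by (cases "int k - int j = 0") auto
qed simp

section \<open>Localized kernels\<close>

text \<open>Discrete orthogonality, from a geometric sum. It serves twice: summing over frequencies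
  it evaluates a kernel at the nodes, and summing over nodes it gives a finite Parseval
  identity.\<close>

lemma sum_cis_root:
  fixes m :: int
  assumes "L > 0"
  shows "(\<Sum>l<L. cis (2 * pi * m / L) ^ l) = (if int L dvd m then of_nat L else 0)"
proof (cases "int L dvd m")
  case True
  then obtain q where "m = int L * q" by auto
  then have "2 * pi * m / L = 2 * pi * q" using assms by simp
  then have "cis (2 * pi * m / L) = 1" by (simp add: cis_multiple_2pi)
  then show ?thesis using True by simp
next
  case False
  have "cis (2 * pi * m / L) \<noteq> 1"
  proof
    assume "cis (2 * pi * m / L) = 1"
    then have "sin (2 * pi * m / L) = 0" "cos (2 * pi * m / L) = 1"
      by (auto simp: complex_eq_iff)
    then obtain n :: int where "2 * pi * m / L = of_int n * 2 * pi"
      by (auto simp: cos_one_2pi_int)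
    then have "real_of_int m = of_int (n * int L)"
      using assms by (simp add: field_simps)
    then have "m = n * int L" by (simp only: of_int_eq_iff)
    with False show False by simp
  qed
  moreover have "cis (2 * pi * m / L) ^ L = 1"
    using assms by (simp add: Complex.DeMoivre cis_multiple_2pi)
  ultimately show ?thesis
    using False by (simp add: geometric_sum)
qed

definition rad :: "nat \<Rightarrow> real" where "rad L = 1 - 1 / L"

definition node :: "nat \<Rightarrow> nat \<Rightarrow> complex" where "node L j = rad L * cis (2 * pi * j / L)"

text \<open>A Dirichlet kernel of frequencies \<open>L, \<dots>, 2 L - 1\<close>, rotated and dilated so that it takes the
  value \<open>1\<close> at \<open>node L j\<close>.\<close>

definition peak :: "nat \<Rightarrow> nat \<Rightarrow> complex poly" where
  "peak L j = (\<Sum>l<L. monom (cis (- (2 * pi * j / L)) ^ (L + l) / (L * rad L ^ (L + l))) (L + l))"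

lemma poly_peak:
  "poly (peak L j) z = (\<Sum>l<L. (z / rad L) ^ (L + l) / L * cis (- (2 * pi * j / L)) ^ (L + l))"
  by (simp add: peak_def poly_sum poly_monom power_divide mult_ac)

lemma rad_pos: "L \<ge> 2 \<Longrightarrow> rad L > 0" and rad_less_1: "L \<ge> 2 \<Longrightarrow> rad L < 1"
  by (auto simp: rad_def)

lemma peak_node:
  assumes "L \<ge> 2" "j < L" "k < L"
  shows "poly (peak L j) (node L k) = (if j = k then 1 else 0)"
proof -
  let ?w = "cis (2 * pi * real_of_int (int k - int j) / L)"
  have "node L k / rad L * cis (- (2 * pi * j / L)) = cis (2 * pi * k / L) * cis (- (2 * pi * j / L))"
    using rad_pos[OF assms(1)] by (simp add: node_def)
  also have "\<dots> = ?w"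
    unfolding cis_mult by (rule arg_cong[of _ _ cis]) (use assms in \<open>simp add: field_simps\<close>)
  finally have w: "node L k / rad L * cis (- (2 * pi * j / L)) = ?w" .
  \<comment> \<open>Moving the frequency band up by L does not change the values at the nodes,
    because the L-th power is 1.\<close>
  have wL: "?w ^ L = 1"
    using assms by (simp add: Complex.DeMoivre cis_multiple_2pi[of "real_of_int (int k - int j)", simplified])
  have "poly (peak L j) (node L k) = (\<Sum>l<L. ?w ^ (L + l)) / L"
    unfolding poly_peak w[symmetric] power_mult_distrib sum_divide_distrib by (simp add: mult_ac)
  also have "\<dots> = (\<Sum>l<L. ?w ^ l) / L"
    by (simp only: power_add wL mult_1_left)
  also have "\<dots> = (if int L dvd int k - int j then 1 else 0)"
    using assms by (subst sum_cis_root) auto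
  also have "int L dvd int k - int j \<longleftrightarrow> j = k"
    using assms by (intro int_dvd_diff_iff)
  finally show ?thesis .
qed

text \<open>The circle of radius \<open>rad L\<close> is so close to the unit circle that undoing
  the dilation in \<open>peak\<close> costs a bounded factor. Bernoulli at exponent L would only
  give the trivial bound 0, so it is applied at L / 2, where it gives 1 / 2. The eighth power
  reaches the exponent 4 L, which exceeds 2 (L + l), and 256 = 2^8.\<close>

lemma rad_power:
  assumes "even L" "L \<ge> 2" "l < L"
  shows "1 / (rad L ^ (L + l))\<^sup>2 \<le> 256"
proof -
  obtain M where M: "L = 2 * M" using assms by auto
  have "1 - real M * (1 / L) \<le> (1 + - (1 / L)) ^ M"
    using Bernoulli_inequality[of "- (1 / real L)" M] assms by simp
  then have "1 / 2 \<le> rad L ^ M" using assms by (simp add: rad_def M)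
  then have "(1 / 2) ^ 8 \<le> (rad L ^ M) ^ 8" by (intro power_mono) auto
  also have "\<dots> = rad L ^ (4 * L)" unfolding power_mult[symmetric] by (rule arg_cong[of _ _ "(^) (rad L)"]) (simp add: M)
  also have "\<dots> \<le> rad L ^ (2 * (L + l))"
    using rad_pos[OF assms(2)] rad_less_1[OF assms(2)] assms by (intro power_decreasing) auto
  finally have *: "1 / 256 \<le> (rad L ^ (L + l))\<^sup>2" by (simp add: power_mult[symmetric] mult.commute power_one_over)
  then have "(rad L ^ (L + l))\<^sup>2 > 0" by linarith
  with * show ?thesis by (simp add: field_simps)
qed

text \<open>As a function of j, the value at z is a discrete Fourier transform of the L terms
  \<open>c l\<close>, so summing squares over j leaves only the diagonal. Each of the L
  contributions is at most 256 / L times |z|^(2 L), where the power comes from the lowest frequency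
  L. This power makes a kernel small at points far inside the disc.\<close>

lemma peak_square_sum:
  assumes L: "even L" "L \<ge> 2" and z: "norm z \<le> 1"
  shows "(\<Sum>j<L. (norm (poly (peak L j) z))\<^sup>2) \<le> 256 * norm z ^ (2 * L)"
proof -
  define c where "c l = (z / rad L) ^ (L + l) / L" for l
  have e: "int L dvd int l' - int l \<longleftrightarrow> l = l'" if "l < L" "l' < L" for l l'
    using that by (rule int_dvd_diff_iff)
  have "complex_of_real (\<Sum>j<L. (norm (poly (peak L j) z))\<^sup>2)
     = (\<Sum>j<L. \<Sum>l<L. \<Sum>l'<L. (c l * cnj (c l')) * cis (2 * pi * real_of_int (int l' - int l) / L) ^ j)"
  proof -
    have "cis (- (2 * pi * j / L)) ^ (L + l) * cnj (cis (- (2 * pi * j / L)) ^ (L + l'))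
        = cis (2 * pi * real_of_int (int l' - int l) / L) ^ j" for j l l'
      unfolding complex_cnj_power cis_cnj Complex.DeMoivre cis_mult
      by (rule arg_cong[of _ _ cis]) (use L in \<open>simp add: field_simps\<close>)
    then have "(norm (poly (peak L j) z))\<^sup>2
       = (\<Sum>l<L. \<Sum>l'<L. (c l * cnj (c l')) * cis (2 * pi * real_of_int (int l' - int l) / L) ^ j)" for j
      unfolding complex_norm_square poly_peak c_def[symmetric] cnj_sum sum_product complex_cnj_mult
      by (intro sum.cong refl) (metis (no_types, lifting) mult.assoc mult.left_commute)
    then show ?thesis by simp
  qed
  also have "\<dots> = (\<Sum>l<L. \<Sum>l'<L. (c l * cnj (c l')) * (\<Sum>j<L. cis (2 * pi * real_of_int (int l' - int l) / L) ^ j))"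
    unfolding sum_distrib_left by (rule trans[OF sum.swap], rule sum.cong[OF refl], rule sum.swap)
  also have "\<dots> = (\<Sum>l<L. \<Sum>l'<L. (c l * cnj (c l')) * (if l = l' then of_nat L else 0))"
    using L e by (intro sum.cong refl) (subst sum_cis_root, auto)
  also have "\<dots> = (\<Sum>l<L. complex_of_real ((norm (c l))\<^sup>2 * L))"
    unfolding of_real_mult complex_norm_square by (simp add: if_distrib cong: if_cong)
  finally have "(\<Sum>j<L. (norm (poly (peak L j) z))\<^sup>2) = (\<Sum>l<L. (norm (c l))\<^sup>2 * L)"
    unfolding of_real_sum[symmetric] of_real_eq_iff .
  also have "\<dots> \<le> (\<Sum>l<L. 256 * norm z ^ (2 * L) / L)"
  proof (rule sum_mono)
    fix l assume "l \<in> {..<L}"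
    then have l: "l < L" by simp
    have "(norm (c l))\<^sup>2 * L = (1 / (rad L ^ (L + l))\<^sup>2) * norm z ^ (2 * (L + l)) / L"
      using rad_pos[OF L(2)] L(2)
      by (simp add: c_def norm_divide norm_power norm_mult power_divide power_mult_distrib power_mult[symmetric] field_simps power2_eq_square power_add power_mult)
    also have "\<dots> \<le> 256 * norm z ^ (2 * L) / L"
      using z by (intro divide_right_mono mult_mono rad_power L l power_decreasing) auto
    finally show "(norm (c l))\<^sup>2 * L \<le> 256 * norm z ^ (2 * L) / L" .
  qed
  also have "\<dots> = 256 * norm z ^ (2 * L)" using L by simp
  finally show ?thesis .
qed

text \<open>Parseval with L coefficients of modulus at most 16 / L, uniformly in r. As the attached
  functions contain the squares of the kernels, this acts later as an L^1 bound.\<close>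

lemma peak_integral:
  assumes L: "even L" "L \<ge> 2" and r: "0 \<le> r" "r \<le> 1"
  shows "(\<integral>\<^sup>+ z. ennreal ((norm (poly (peak L j) (of_real r * z)))\<^sup>2) \<partial>circle_haar) \<le> ennreal (256 / L)"
proof -
  define c where "c a = cis (- (2 * pi * j / L)) ^ a * (r / rad L) ^ a / L" for a
  have "poly (peak L j) (of_real r * z) = (\<Sum>a\<in>{L..<L + L}. c a * z ^ a)" for z
  proof -
    have "{L..<L + L} = (+) L ` {..<L}"
      by (simp add: lessThan_atLeast0)
    then show ?thesis
      by (simp add: poly_peak c_def sum.reindex power_mult_distrib power_divide mult_ac)
  qed
  then have "(\<integral>\<^sup>+ z. ennreal ((norm (poly (peak L j) (of_real r * z)))\<^sup>2) \<partial>circle_haar)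
     = ennreal (\<Sum>a\<in>{L..<L + L}. (norm (c a))\<^sup>2)"
    by (simp add: circle_parseval)
  also have "\<dots> \<le> ennreal (\<Sum>a\<in>{L..<L + L}. 256 / L / L)"
  proof (intro ennreal_leI sum_mono)
    fix a assume "a \<in> {L..<L + L}"
    then have l: "a - L < L" "L + (a - L) = a" by auto
    have "(norm (c a))\<^sup>2 = (1 / (rad L ^ a)\<^sup>2) * (r ^ a)\<^sup>2 / L / L"
      using r rad_pos[OF L(2)]
      by (simp add: c_def norm_divide norm_power norm_mult power_divide power_mult_distrib power2_eq_square)
    also have "\<dots> \<le> 256 * 1 / L / L"
      using rad_power[OF L l(1)] r unfolding l(2) 
      by (intro divide_right_mono mult_mono) (auto simp: power_le_one)
    finally show "(norm (c a))\<^sup>2 \<le> 256 / L / L" by simp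
  qed
  also have "(\<Sum>a\<in>{L..<L + L}. 256 / real L / L) = 256 / L" using L by simp
  finally show ?thesis .
qed

section \<open>The functions attached to the points and their norms\<close>

definition zfun :: "nat \<Rightarrow> nat \<Rightarrow> nat \<Rightarrow> complex poly" where
  "zfun d L j = smult (1 / (1 - node L j ^ d)) ((peak L j)\<^sup>2 * (1 - monom 1 d))"

definition wfun :: "nat \<Rightarrow> nat \<Rightarrow> complex poly" where
  "wfun M k = (peak M k)\<^sup>2"

text \<open>Pulling \<open>monom 1 L\<close> out of \<open>peak\<close> exposes the gap below L: the
  square starts at 2 L and has degree at most 4 L - 2, and the factor 1 - z^d spreads it upwards by
  at most d. Disjointness of these bands is what separates different shapes.\<close>

lemma coeff_zfun:
  assumes "coeff (zfun d L j) a \<noteq> 0" "L > 0"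
  shows "2 * L \<le> a \<and> a < 4 * L + d"
proof -
  define Q where "Q = (\<Sum>l<L. monom (cis (- (2 * pi * j / L)) ^ (L + l) / (L * rad L ^ (L + l))) l)"
  have peak: "peak L j = monom 1 L * Q"
    by (simp add: peak_def Q_def sum_distrib_left mult_monom)
  have dQ: "degree Q \<le> L - 1"
    unfolding Q_def by (rule degree_sum_le) (auto intro: order.trans[OF degree_monom_le])
  define R where "R = Q\<^sup>2 * (1 - monom 1 d)"
  have eq: "(peak L j)\<^sup>2 * (1 - monom 1 d) = monom 1 (2 * L) * R"
    by (simp add: peak R_def power_mult_distrib monom_power mult.assoc mult.commute)
  have "degree (1 - monom (1::complex) d) \<le> d"
    by (rule order.trans[OF degree_diff_le_max]) (simp add: degree_monom_le)
  moreover have "degree (Q\<^sup>2) \<le> 2 * (L - 1)"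
    using degree_mult_le[of Q Q] dQ by (simp add: power2_eq_square)
  ultimately have dR: "degree R \<le> 2 * (L - 1) + d"
    unfolding R_def using degree_mult_le[of "Q\<^sup>2" "1 - monom 1 d"] by linarith
  from assms(1) have "coeff (monom 1 (2 * L) * R) a \<noteq> 0"
    by (auto simp: zfun_def eq)
  then have "2 * L \<le> a" "coeff R (a - 2 * L) \<noteq> 0"
    by (auto simp: coeff_monom_mult split: if_splits)
  moreover then have "a - 2 * L \<le> 2 * (L - 1) + d"
    using le_degree dR by (meson order.trans)
  ultimately show ?thesis using assms(2) by auto
qed

lemma norm_zfun_le:
  assumes "norm (1 - node L j ^ d) \<ge> 1" "norm z \<le> 1"
  shows "norm (poly (zfun d L j) z) \<le> norm (1 - z ^ d) * (norm (poly (peak L j) z))\<^sup>2"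
proof -
  have "norm (poly (zfun d L j) z)
      = norm (1 - z ^ d) * (norm (poly (peak L j) z))\<^sup>2 / norm (1 - node L j ^ d)"
    by (simp add: zfun_def poly_monom norm_divide norm_mult norm_power mult_ac)
  also have "\<dots> \<le> norm (1 - z ^ d) * (norm (poly (peak L j) z))\<^sup>2 / 1"
    using assms by (intro divide_left_mono) auto
  finally show ?thesis by simp
qed

lemma norm_one_minus_power_le: "norm z \<le> 1 \<Longrightarrow> norm (1 - z ^ d :: complex) \<le> 2"
  using norm_triangle_ineq4[of 1 "z ^ d"] power_le_one[of "norm z" d] by (simp add: norm_power)

lemma norm_peak_square_le:
  assumes "even L" "L \<ge> 2" "norm z \<le> 1" "j < L"
  shows "(norm (poly (peak L j) z))\<^sup>2 \<le> 256 * norm z ^ (2 * L)"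
proof -
  have "(norm (poly (peak L j) z))\<^sup>2 \<le> (\<Sum>j<L. (norm (poly (peak L j) z))\<^sup>2)"
    using assms by (intro member_le_sum) auto
  also have "\<dots> \<le> 256 * norm z ^ (2 * L)" using assms by (intro peak_square_sum)
  finally show ?thesis .
qed

text \<open>Inside one shape all functions share the same frequency band, so orthogonality is
  replaced by Cauchy-Schwarz at each point. Each function is at most 2 u^2; one factor u stays with
  the coefficients, and the sum of u^2 over the grid is bounded by 256^2. The constant is 2^18 = 4 *
  256^2.\<close>

lemma shape_pointwise:
  assumes L: "even L" "L \<ge> 2" and M: "even M" "M \<ge> 2" and z: "norm z \<le> 1" and w: "norm w \<le> 1"
    and F: "finite F" "F \<subseteq> {..<L} \<times> {..<M}"
    and d: "\<And>j k. (j, k) \<in> F \<Longrightarrow> norm (1 - node L j ^ d) \<ge> 1"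
  shows "(norm (\<Sum>(j, k)\<in>F. g (j, k) * poly (zfun d L j) z * poly (wfun M k) w))\<^sup>2
    \<le> (\<Sum>(j, k)\<in>F. 2 ^ 18 * (norm (g (j, k)))\<^sup>2 * ((norm (poly (peak L j) z))\<^sup>2 * (norm (poly (peak M k) w))\<^sup>2))"
proof -
  define u where "u jk = norm (poly (peak L (fst jk)) z) * norm (poly (peak M (snd jk)) w)" for jk
  have "norm (\<Sum>(j, k)\<in>F. g (j, k) * poly (zfun d L j) z * poly (wfun M k) w)
     \<le> (\<Sum>n\<in>F. (2 * norm (g n) * u n) * u n)"
  proof (rule sum_norm_le, safe)
    fix j k assume jk: "(j, k) \<in> F"
    have "norm (poly (zfun d L j) z) \<le> 2 * (norm (poly (peak L j) z))\<^sup>2"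
      using norm_zfun_le[OF d[OF jk] z] norm_one_minus_power_le[OF z, of d]
      by (meson mult_right_mono order.trans zero_le_power2)
    then have "norm (g (j, k)) * norm (poly (zfun d L j) z) * (norm (poly (peak M k) w))\<^sup>2
       \<le> norm (g (j, k)) * (2 * (norm (poly (peak L j) z))\<^sup>2) * (norm (poly (peak M k) w))\<^sup>2"
      by (intro mult_right_mono mult_left_mono) auto
    then show "norm (g (j, k) * poly (zfun d L j) z * poly (wfun M k) w) \<le> (2 * norm (g (j, k)) * u (j, k)) * u (j, k)"
      by (simp add: u_def norm_mult wfun_def norm_power power2_eq_square mult_ac)
  qed
  then have "(norm (\<Sum>(j, k)\<in>F. g (j, k) * poly (zfun d L j) z * poly (wfun M k) w))\<^sup>2
     \<le> (\<Sum>n\<in>F. (2 * norm (g n) * u n) * u n)\<^sup>2"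
    by (rule power_mono) auto
  also have "\<dots> \<le> (\<Sum>n\<in>F. (2 * norm (g n) * u n)\<^sup>2) * (\<Sum>n\<in>F. (u n)\<^sup>2)"
    by (rule Cauchy_Schwarz_ineq_sum)
  also have "\<dots> \<le> (\<Sum>n\<in>F. (2 * norm (g n) * u n)\<^sup>2) * 256\<^sup>2"
  proof (rule mult_left_mono)
    \<comment> \<open>Enlarging F to the full grid turns the sum into a product of two one-variable
      sums.\<close>
    have "(\<Sum>n\<in>F. (u n)\<^sup>2) \<le> (\<Sum>n\<in>{..<L} \<times> {..<M}. (u n)\<^sup>2)"
      using F by (intro sum_mono2) auto
    also have "\<dots> = (\<Sum>j<L. (norm (poly (peak L j) z))\<^sup>2) * (\<Sum>k<M. (norm (poly (peak M k) w))\<^sup>2)"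
      by (simp add: u_def power_mult_distrib sum_product sum.cartesian_product case_prod_beta)
    also have "\<dots> \<le> (256 * norm z ^ (2 * L)) * (256 * norm w ^ (2 * M))"
      using L M z w by (intro mult_mono peak_square_sum sum_nonneg) auto
    also have "\<dots> \<le> (256 * 1) * (256 * 1)"
      using z w by (intro mult_mono power_le_one) auto
    finally show "(\<Sum>n\<in>F. (u n)\<^sup>2) \<le> 256\<^sup>2" by simp
  qed (auto intro: sum_nonneg)
  also have "\<dots> = (\<Sum>(j, k)\<in>F. 2 ^ 18 * (norm (g (j, k)))\<^sup>2 * ((norm (poly (peak L j) z))\<^sup>2 * (norm (poly (peak M k) w))\<^sup>2))"
    unfolding sum_distrib_right by (intro sum.cong refl) (auto simp: u_def power_mult_distrib)
  finally show ?thesis .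
qed

lemma measurable_ennreal_continuous:
  fixes f :: "'a::topological_space \<Rightarrow> real"
  assumes "continuous_on UNIV f"
  shows "(\<lambda>x. ennreal (f x)) \<in> borel_measurable borel"
  using borel_measurable_continuous_onI[OF assms] by measurable

lemma measurable_ennreal_circle:
  assumes "continuous_on UNIV f"
  shows "(\<lambda>x. ennreal (f x)) \<in> borel_measurable circle_haar"
  using measurable_ennreal_continuous[OF assms] by (rule measurable_circle)

lemma continuous_on_poly_comp [continuous_intros]:
  fixes p :: "complex poly"
  shows "continuous_on S f \<Longrightarrow> continuous_on S (\<lambda>x. poly p (f x))"
  by (rule continuous_on_poly)

lemma measurable_poly_circle:
  "(\<lambda>z. ennreal ((norm (poly p (r * z)))\<^sup>2)) \<in> borel_measurable circle_haar"
  by (intro measurable_ennreal_circle continuous_intros)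

lemma peak_product_integral:
  assumes L: "even L" "L \<ge> 2" and M: "even M" "M \<ge> 2" and r: "0 \<le> r" "r \<le> 1"
  shows "(\<integral>\<^sup>+ w. \<integral>\<^sup>+ z. ennreal ((norm (poly (peak L j) (of_real r * z)))\<^sup>2 * (norm (poly (peak M k) (of_real r * w)))\<^sup>2)
     \<partial>circle_haar \<partial>circle_haar) \<le> ennreal (2 ^ 16 / (L * M))"
proof -
  have "(\<integral>\<^sup>+ w. \<integral>\<^sup>+ z. ennreal ((norm (poly (peak L j) (of_real r * z)))\<^sup>2 * (norm (poly (peak M k) (of_real r * w)))\<^sup>2)
     \<partial>circle_haar \<partial>circle_haar)
   = (\<integral>\<^sup>+ z. ennreal ((norm (poly (peak L j) (of_real r * z)))\<^sup>2) \<partial>circle_haar)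
   * (\<integral>\<^sup>+ w. ennreal ((norm (poly (peak M k) (of_real r * w)))\<^sup>2) \<partial>circle_haar)"
    by (simp add: ennreal_mult nn_integral_multc nn_integral_cmult measurable_poly_circle)
  also have "\<dots> \<le> ennreal (256 / L) * ennreal (256 / M)"
    using assms by (intro mult_mono peak_integral) auto
  also have "\<dots> = ennreal (2 ^ 16 / (L * M))"
    by (simp add: ennreal_mult[symmetric])
  finally show ?thesis by simp
qed

text \<open>The L^2 bound for one shape: the pointwise estimate contributes 2^18 and the integral of
  two squared kernels 2^16.\<close>

lemma shape_integral:
  assumes L: "even L" "L \<ge> 2" and M: "even M" "M \<ge> 2" and r: "0 \<le> r" "r \<le> 1"
    and F: "finite F" "F \<subseteq> {..<L} \<times> {..<M}"
    and d: "\<And>j k. (j, k) \<in> F \<Longrightarrow> norm (1 - node L j ^ d) \<ge> 1"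
  shows "(\<integral>\<^sup>+ w. \<integral>\<^sup>+ z. ennreal ((norm (\<Sum>(j, k)\<in>F. g (j, k) * poly (zfun d L j) (of_real r * z) * poly (wfun M k) (of_real r * w)))\<^sup>2)
       \<partial>circle_haar \<partial>circle_haar)
    \<le> ennreal (2 ^ 34 * (\<Sum>n\<in>F. (norm (g n))\<^sup>2 / (L * M)))"
proof -
  let ?u = "\<lambda>(j, k) z w. (norm (poly (peak L j) (of_real r * z)))\<^sup>2 * (norm (poly (peak M k) (of_real r * w)))\<^sup>2"
  let ?c = "\<lambda>n. ennreal (2 ^ 18 * (norm (g n))\<^sup>2)"
  have n: "norm (of_real r * z :: complex) \<le> 1" if "z \<in> space circle_haar" for z
    using that r by (simp add: space_circle norm_mult)
  have "(\<integral>\<^sup>+ w. \<integral>\<^sup>+ z. ennreal ((norm (\<Sum>(j, k)\<in>F. g (j, k) * poly (zfun d L j) (of_real r * z) * poly (wfun M k) (of_real r * w)))\<^sup>2)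
       \<partial>circle_haar \<partial>circle_haar)
     \<le> (\<integral>\<^sup>+ w. \<integral>\<^sup>+ z. (\<Sum>n\<in>F. ?c n * ennreal (?u n z w)) \<partial>circle_haar \<partial>circle_haar)"
  proof (intro nn_integral_mono)
    fix z w assume zw: "z \<in> space circle_haar" "w \<in> space circle_haar"
    have "ennreal ((norm (\<Sum>(j, k)\<in>F. g (j, k) * poly (zfun d L j) (of_real r * z) * poly (wfun M k) (of_real r * w)))\<^sup>2)
      \<le> ennreal (\<Sum>n\<in>F. (2 ^ 18 * (norm (g n))\<^sup>2) * ?u n z w)"
      using shape_pointwise[OF L M n[OF zw(1)] n[OF zw(2)] F d, where g = g]
      by (intro ennreal_leI) (simp add: case_prod_beta)
    also have "\<dots> = (\<Sum>n\<in>F. ?c n * ennreal (?u n z w))"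
      by (subst sum_ennreal[symmetric]) (auto simp: ennreal_mult case_prod_beta)
    finally show "ennreal ((norm (\<Sum>(j, k)\<in>F. g (j, k) * poly (zfun d L j) (of_real r * z) * poly (wfun M k) (of_real r * w)))\<^sup>2) \<le> \<dots>" .
  qed
  also have "\<dots> = (\<Sum>n\<in>F. ?c n * (\<integral>\<^sup>+ w. \<integral>\<^sup>+ z. ennreal (?u n z w) \<partial>circle_haar \<partial>circle_haar))"
  proof -
    have m: "(\<lambda>z. ennreal (?u n z w)) \<in> borel_measurable circle_haar" for n w
      by (cases n) (auto simp: ennreal_mult intro!: borel_measurable_times_ennreal measurable_poly_circle)
    have m': "(\<lambda>w. \<integral>\<^sup>+ z. ennreal (?u n z w) \<partial>circle_haar) \<in> borel_measurable circle_haar" for n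
      by (cases n) (simp add: ennreal_mult nn_integral_multc measurable_poly_circle borel_measurable_times_ennreal)
    show ?thesis
      by (simp add: nn_integral_sum nn_integral_cmult m m' borel_measurable_times_ennreal)
  qed
  also have "\<dots> \<le> (\<Sum>n\<in>F. ?c n * ennreal (2 ^ 16 / (L * M)))"
    using peak_product_integral[OF L M r] by (intro sum_mono mult_left_mono) (auto simp: case_prod_beta)
  also have "\<dots> = ennreal (\<Sum>n\<in>F. (2 ^ 18 * (norm (g n))\<^sup>2) * (2 ^ 16 / (L * M)))"
    by (subst sum_ennreal[symmetric]) (auto simp: ennreal_mult[symmetric])
  also have "(\<Sum>n\<in>F. (2 ^ 18 * (norm (g n))\<^sup>2) * (2 ^ 16 / (L * M))) = 2 ^ 34 * (\<Sum>n\<in>F. (norm (g n))\<^sup>2 / (L * M))"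
    by (simp add: sum_distrib_left)
  finally show ?thesis .
qed

text \<open>The L^1 norm of a single attached function. The constant is the 2^16 of the two squared
  kernels times the bound 2 for |1 - z^d|.\<close>

lemma shape_integral_torus:
  assumes L: "even L" "L \<ge> 2" and M: "even M" "M \<ge> 2" and r: "0 \<le> r" "r \<le> 1"
    and d: "norm (1 - node L j ^ d) \<ge> 1"
  shows "(\<integral>\<^sup>+ x. ennreal (norm (poly (zfun d L j) (of_real r * fst x) * poly (wfun M k) (of_real r * snd x))) \<partial>torus_haar)
    \<le> ennreal (2 ^ 17 / (L * M))"
proof -
  let ?u = "\<lambda>z w. (norm (poly (peak L j) (of_real r * z)))\<^sup>2 * (norm (poly (peak M k) (of_real r * w)))\<^sup>2"
  have n: "norm (of_real r * z :: complex) \<le> 1" if "z \<in> space circle_haar" for z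
    using that r by (simp add: space_circle norm_mult)
  have "(\<integral>\<^sup>+ x. ennreal (norm (poly (zfun d L j) (of_real r * fst x) * poly (wfun M k) (of_real r * snd x))) \<partial>torus_haar)
     = (\<integral>\<^sup>+ w. \<integral>\<^sup>+ z. ennreal (norm (poly (zfun d L j) (of_real r * z) * poly (wfun M k) (of_real r * w)))
          \<partial>circle_haar \<partial>circle_haar)"
    by (subst nn_integral_torus, intro measurable_ennreal_continuous continuous_intros) simp
  also have "\<dots> \<le> (\<integral>\<^sup>+ w. \<integral>\<^sup>+ z. 2 * ennreal (?u z w) \<partial>circle_haar \<partial>circle_haar)"
  proof (intro nn_integral_mono)
    fix z w assume zw: "z \<in> space circle_haar" "w \<in> space circle_haar"
    have "norm (poly (zfun d L j) (of_real r * z)) \<le> 2 * (norm (poly (peak L j) (of_real r * z)))\<^sup>2"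
      using norm_zfun_le[OF d n[OF zw(1)]] norm_one_minus_power_le[OF n[OF zw(1)], of d]
      by (meson mult_right_mono order.trans zero_le_power2)
    then have "norm (poly (zfun d L j) (of_real r * z)) * (norm (poly (peak M k) (of_real r * w)))\<^sup>2 \<le> 2 * ?u z w"
      using mult_right_mono zero_le_power2 by (metis mult.assoc)
    then have "ennreal (norm (poly (zfun d L j) (of_real r * z) * poly (wfun M k) (of_real r * w))) \<le> ennreal (2 * ?u z w)"
      by (intro ennreal_leI) (simp add: norm_mult wfun_def norm_power)
    also have "\<dots> = 2 * ennreal (?u z w)" by (simp add: ennreal_mult)
    finally show "ennreal (norm (poly (zfun d L j) (of_real r * z) * poly (wfun M k) (of_real r * w))) \<le> 2 * ennreal (?u z w)" .
  qed
  also have "\<dots> = 2 * (\<integral>\<^sup>+ w. \<integral>\<^sup>+ z. ennreal (?u z w) \<partial>circle_haar \<partial>circle_haar)"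
    by (simp add: ennreal_mult nn_integral_cmult nn_integral_multc measurable_poly_circle borel_measurable_times_ennreal)
  also have "\<dots> \<le> 2 * ennreal (2 ^ 16 / (L * M))"
    using peak_product_integral[OF L M r] by (intro mult_left_mono) auto
  also have "\<dots> = ennreal (2 * (2 ^ 16 / (L * M)))"
    by (subst ennreal_mult) auto
  finally show ?thesis by simp
qed

text \<open>For fixed w the part of the sum belonging to shape s is a polynomial in z with
  frequencies from 2 L to below 4 L + d. By assumption these bands do not overlap, so the integral
  over z splits, and the bounds for single shapes add up without loss in their number.\<close>

lemma shapes_integral_torus:
  fixes L M d :: "'s \<Rightarrow> nat" and g :: "'s \<times> nat \<times> nat \<Rightarrow> complex"
  assumes r: "0 \<le> r" "r \<le> 1" and F: "finite F"
    and sh: "\<And>s j k. (s, j, k) \<in> F \<Longrightarrow> even (L s) \<and> L s \<ge> 2 \<and> even (M s) \<and> M s \<ge> 2 \<and> j < L s \<and> k < M s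
         \<and> norm (1 - node (L s) j ^ d s) \<ge> 1"
    and disj: "\<And>s t. s \<in> fst ` F \<Longrightarrow> t \<in> fst ` F \<Longrightarrow> s \<noteq> t \<Longrightarrow> 4 * L s + d s \<le> 2 * L t \<or> 4 * L t + d t \<le> 2 * L s"
  shows "(\<integral>\<^sup>+ x. ennreal ((norm (\<Sum>(s, j, k)\<in>F. g (s, j, k) * poly (zfun (d s) (L s) j) (of_real r * fst x)
             * poly (wfun (M s) k) (of_real r * snd x)))\<^sup>2) \<partial>torus_haar)
    \<le> ennreal (2 ^ 34 * (\<Sum>(s, j, k)\<in>F. (norm (g (s, j, k)))\<^sup>2 / (L s * M s)))"
proof -
  define S where "S = fst ` F"
  define G where "G s = {jk. (s, jk) \<in> F}" for s
  have S: "finite S" using F by (simp add: S_def)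
  have F_eq: "F = Sigma S G" by (force simp: S_def G_def)
  have G: "finite (G s)" for s
    using F unfolding G_def by (rule_tac finite_subset[of _ "snd ` F"]) force+
  have Gs: "even (L s)" "L s \<ge> 2" "even (M s)" "M s \<ge> 2" "G s \<subseteq> {..<L s} \<times> {..<M s}"
     "\<And>j k. (j, k) \<in> G s \<Longrightarrow> norm (1 - node (L s) j ^ d s) \<ge> 1" if "s \<in> S" for s
    using that sh by (auto simp: S_def G_def)
  define P where "P w s = (\<Sum>(j, k)\<in>G s. smult (g (s, j, k) * poly (wfun (M s) k) w) (zfun (d s) (L s) j))" for w s
  have P: "poly (P w s) z = (\<Sum>(j, k)\<in>G s. g (s, j, k) * poly (zfun (d s) (L s) j) z * poly (wfun (M s) k) w)" for w s z
    by (simp add: P_def poly_sum case_prod_beta mult_ac)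
  have sum_eq: "(\<Sum>(s, j, k)\<in>F. g (s, j, k) * poly (zfun (d s) (L s) j) z * poly (wfun (M s) k) w) = (\<Sum>s\<in>S. poly (P w s) z)" for z w
    unfolding P F_eq using S G by (subst sum.Sigma) (auto simp: case_prod_beta)
  have cP: "2 * L s \<le> a \<and> a < 4 * L s + d s" if "s \<in> S" "coeff (P w s) a \<noteq> 0" for w s a
  proof -
    from that(2) obtain jk where "jk \<in> G s" "coeff (zfun (d s) (L s) (fst jk)) a \<noteq> 0"
      unfolding P_def coeff_sum by (auto elim!: sum.not_neutral_contains_not_neutral)
    with coeff_zfun Gs(2)[OF that(1)] show ?thesis by force
  qed
  have "(\<integral>\<^sup>+ x. ennreal ((norm (\<Sum>(s, j, k)\<in>F. g (s, j, k) * poly (zfun (d s) (L s) j) (of_real r * fst x)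
             * poly (wfun (M s) k) (of_real r * snd x)))\<^sup>2) \<partial>torus_haar)
     = (\<integral>\<^sup>+ w. \<integral>\<^sup>+ z. ennreal ((norm (\<Sum>s\<in>S. poly (P (of_real r * w) s) (of_real r * z)))\<^sup>2) \<partial>circle_haar \<partial>circle_haar)"
    unfolding sum_eq[symmetric] case_prod_beta
    by (subst nn_integral_torus, intro measurable_ennreal_continuous continuous_intros) simp
  also have "\<dots> = (\<integral>\<^sup>+ w. (\<Sum>s\<in>S. \<integral>\<^sup>+ z. ennreal ((norm (poly (P (of_real r * w) s) (of_real r * z)))\<^sup>2) \<partial>circle_haar) \<partial>circle_haar)"
  proof (intro nn_integral_cong circle_orthogonal S)
    fix w s t a assume "s \<in> S" "t \<in> S" "s \<noteq> t" "coeff (P (of_real r * w) s) a \<noteq> 0"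
    with cP[of s "of_real r * w" a] cP[of t "of_real r * w" a] disj[of s t]
    show "coeff (P (of_real r * w) t) a = 0" unfolding S_def by fastforce
  qed
  also have "\<dots> = (\<Sum>s\<in>S. \<integral>\<^sup>+ w. \<integral>\<^sup>+ z. ennreal ((norm (poly (P (of_real r * w) s) (of_real r * z)))\<^sup>2) \<partial>circle_haar \<partial>circle_haar)"
  proof (rule nn_integral_sum)
    interpret finite_measure circle_haar by (rule finite_circle)
    fix s
    have "(\<lambda>x. ennreal ((norm (poly (P (of_real r * snd x) s) (of_real r * fst x)))\<^sup>2)) \<in> borel_measurable torus_haar"
      unfolding P case_prod_beta by (intro measurable_torus measurable_ennreal_continuous continuous_intros)
    then have "(\<lambda>(w, z). ennreal ((norm (poly (P (of_real r * w) s) (of_real r * z)))\<^sup>2)) \<in> borel_measurable (circle_haar \<Otimes>\<^sub>M circle_haar)"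
      unfolding torus_haar_def by (subst measurable_pair_swap_iff) (simp add: case_prod_beta)
    then show "(\<lambda>w. \<integral>\<^sup>+ z. ennreal ((norm (poly (P (of_real r * w) s) (of_real r * z)))\<^sup>2) \<partial>circle_haar) \<in> borel_measurable circle_haar"
      by (rule borel_measurable_nn_integral)
  qed
  also have "\<dots> \<le> (\<Sum>s\<in>S. ennreal (2 ^ 34 * (\<Sum>n\<in>G s. (norm (g (s, n)))\<^sup>2 / (L s * M s))))"
  proof (rule sum_mono)
    fix s assume "s \<in> S"
    from shape_integral[OF Gs(1-4)[OF this] r G Gs(5,6)[OF this], where g = "\<lambda>n. g (s, n)"]
    show "(\<integral>\<^sup>+ w. \<integral>\<^sup>+ z. ennreal ((norm (poly (P (of_real r * w) s) (of_real r * z)))\<^sup>2) \<partial>circle_haar \<partial>circle_haar)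
       \<le> ennreal (2 ^ 34 * (\<Sum>n\<in>G s. (norm (g (s, n)))\<^sup>2 / (L s * M s)))"
      unfolding P by (simp add: case_prod_beta)
  qed
  also have "\<dots> = ennreal (\<Sum>s\<in>S. 2 ^ 34 * (\<Sum>n\<in>G s. (norm (g (s, n)))\<^sup>2 / (L s * M s)))"
    by (intro sum_ennreal mult_nonneg_nonneg sum_nonneg) auto
  also have "(\<Sum>s\<in>S. 2 ^ 34 * (\<Sum>n\<in>G s. (norm (g (s, n)))\<^sup>2 / (L s * M s)))
      = 2 ^ 34 * (\<Sum>(s, j, k)\<in>F. (norm (g (s, j, k)))\<^sup>2 / (L s * M s))"
    unfolding sum_distrib_left[symmetric] F_eq using S G by (subst sum.Sigma) (auto simp: case_prod_beta)
  finally show ?thesis .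
qed

section \<open>Interpolation between the exponents 1 and 2\<close>

lemma geometric_tail: "y < 1 \<Longrightarrow> x + x * y / (1 - y) = x / (1 - y)" for x y :: real
  by (simp add: field_simps)

lemma sum_split_filter:
  assumes "finite F"
  shows "sum h F = sum h {n\<in>F. P n} + sum h {n\<in>F. \<not> P n}"
proof -
  have "{n\<in>F. P n} \<union> {n\<in>F. \<not> P n} = F" by blast
  with sum.union_disjoint[of "{n\<in>F. P n}" "{n\<in>F. \<not> P n}" h] assms show ?thesis
    by auto
qed

text \<open>A geometric series read from its largest term. The induction removes the top height; if
  it is at most a, all lower heights are at most a / 2, and the induction hypothesis at a / 2
  supplies the factor \<open>2 powr - q\<close>.\<close>

lemma dyadic_sum_below:
  fixes q \<tau> a :: real
  assumes "q > 0" "\<tau> > 0" "a > 0"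
  shows "(\<Sum>k<m. if \<tau> * 2 ^ k \<le> a then (\<tau> * 2 ^ k) powr q else 0) \<le> a powr q / (1 - 2 powr - q)"
  using assms(3)
proof (induction m arbitrary: a)
  case 0
  have "2 powr - q < (1::real)" using assms(1) by (intro powr_less_one) auto
  then show ?case by simp
next
  case (Suc m)
  have q: "2 powr - q < (1::real)" using assms(1) by (intro powr_less_one) auto
  show ?case
  proof (cases "\<tau> * 2 ^ m \<le> a")
    case False
    then show ?thesis using Suc.IH[OF Suc.prems] by simp
  next
    case True
    have "(\<Sum>k<m. if \<tau> * 2 ^ k \<le> a then (\<tau> * 2 ^ k) powr q else 0)
        = (\<Sum>k<m. if \<tau> * 2 ^ k \<le> a / 2 then (\<tau> * 2 ^ k) powr q else 0)"
    proof (rule sum.cong[OF refl])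
      fix k assume "k \<in> {..<m}"
      then have "(2::real) ^ Suc k \<le> 2 ^ m" by (intro power_increasing) auto
      then have "\<tau> * 2 ^ Suc k \<le> \<tau> * 2 ^ m" using assms(2) by (intro mult_left_mono) auto
      with True have "\<tau> * 2 ^ k \<le> a / 2" by simp
      with Suc.prems show "(if \<tau> * 2 ^ k \<le> a then (\<tau> * 2 ^ k) powr q else 0)
         = (if \<tau> * 2 ^ k \<le> a / 2 then (\<tau> * 2 ^ k) powr q else 0)" by auto
    qed
    also have "\<dots> \<le> (a / 2) powr q / (1 - 2 powr - q)"
      using Suc.IH[of "a / 2"] Suc.prems by simp
    also have "(a / 2) powr q = a powr q * 2 powr - q"
      using Suc.prems by (simp add: powr_divide powr_minus field_simps)
    finally have "(\<Sum>k<m. if \<tau> * 2 ^ k \<le> a then (\<tau> * 2 ^ k) powr q else 0)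
       \<le> a powr q * 2 powr - q / (1 - 2 powr - q)" .
    moreover have "(\<tau> * 2 ^ m) powr q \<le> a powr q"
      using True assms by (intro powr_mono2) auto
    moreover have "a powr q + a powr q * 2 powr - q / (1 - 2 powr - q) = a powr q / (1 - 2 powr - q)"
      using q by (rule geometric_tail)
    ultimately show ?thesis using True by simp
  qed
qed

text \<open>The mirror image: now the smallest height is the dominant term and is removed, which is
  why the induction varies \<tau> as well.\<close>

lemma dyadic_sum_above:
  fixes q \<tau> a :: real
  assumes "q > 0" "\<tau> > 0" "a > 0"
  shows "(\<Sum>k<m. if a < \<tau> * 2 ^ k then (\<tau> * 2 ^ k) powr - q else 0) \<le> a powr - q / (1 - 2 powr - q)"
  using assms(2,3)
proof (induction m arbitrary: a \<tau>)
  case 0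
  have "2 powr - q < (1::real)" using assms(1) by (intro powr_less_one) auto
  then show ?case by simp
next
  case (Suc m)
  have q: "2 powr - q < (1::real)" using assms(1) by (intro powr_less_one) auto
  have split: "(\<Sum>k<Suc m. if a < \<tau> * 2 ^ k then (\<tau> * 2 ^ k) powr - q else 0)
     = (if a < \<tau> then \<tau> powr - q else 0) + (\<Sum>k<m. if a < (2 * \<tau>) * 2 ^ k then ((2 * \<tau>) * 2 ^ k) powr - q else 0)"
  proof -
    have "\<tau> * 2 ^ Suc k = (2 * \<tau>) * 2 ^ k" for k by simp
    then show ?thesis by (subst sum.lessThan_Suc_shift) (simp only: power_0 mult_1_right)
  qed
  show ?case
  proof (cases "a < \<tau>")
    case False
    then show ?thesis unfolding split using Suc.IH[of "2 * \<tau>" a] Suc.prems by simp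
  next
    case True
    \<comment> \<open>Since a < \<tau>, both conditions hold for every k, so the threshold a may be
      doubled; this produces the decay in the induction hypothesis.\<close>
    have "(\<Sum>k<m. if a < (2 * \<tau>) * 2 ^ k then ((2 * \<tau>) * 2 ^ k) powr - q else 0)
        = (\<Sum>k<m. if 2 * a < (2 * \<tau>) * 2 ^ k then ((2 * \<tau>) * 2 ^ k) powr - q else 0)"
    proof (rule sum.cong[OF refl])
      fix k
      have "\<tau> * 1 \<le> \<tau> * 2 ^ k" using Suc.prems by (intro mult_left_mono) auto
      with True have "a < \<tau> * 2 ^ k" by linarith
      with Suc.prems show "(if a < (2 * \<tau>) * 2 ^ k then ((2 * \<tau>) * 2 ^ k) powr - q else 0)
         = (if 2 * a < (2 * \<tau>) * 2 ^ k then ((2 * \<tau>) * 2 ^ k) powr - q else 0)" by (simp add: mult.assoc)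
    qed
    also have "\<dots> \<le> (2 * a) powr - q / (1 - 2 powr - q)"
      using Suc.IH[of "2 * \<tau>" "2 * a"] Suc.prems by simp
    also have "(2 * a) powr - q = a powr - q * 2 powr - q"
      using Suc.prems by (simp add: powr_mult)
    finally have "(\<Sum>k<m. if a < (2 * \<tau>) * 2 ^ k then ((2 * \<tau>) * 2 ^ k) powr - q else 0)
       \<le> a powr - q * 2 powr - q / (1 - 2 powr - q)" .
    moreover have "\<tau> powr - q \<le> a powr - q"
      using True Suc.prems assms(1) by (intro powr_mono2') auto
    moreover have "a powr - q + a powr - q * 2 powr - q / (1 - 2 powr - q) = a powr - q / (1 - 2 powr - q)"
      using q by (rule geometric_tail)
    ultimately show ?thesis unfolding split using True by simp
  qed
qed

lemma dyadic_level:
  fixes s \<tau> :: real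
  assumes "\<tau> > 0" "\<tau> \<le> s" "s < \<tau> * 2 ^ m"
  obtains k where "k < m" "\<tau> * 2 ^ k \<le> s" "s < 2 * (\<tau> * 2 ^ k)"
proof -
  define k where "k = (LEAST k. s < \<tau> * 2 ^ Suc k)"
  have "m > 0" using assms by (cases m) auto
  then have ex: "s < \<tau> * 2 ^ Suc (m - 1)" using assms(3) by simp
  have k1: "s < \<tau> * 2 ^ Suc k" unfolding k_def by (rule LeastI, rule ex)
  have "k \<le> m - 1" unfolding k_def by (rule Least_le, rule ex)
  then have "k < m" using \<open>m > 0\<close> by simp
  moreover have "\<tau> * 2 ^ k \<le> s"
  proof (cases k)
    case 0 then show ?thesis using assms by simp
  next
    case (Suc j)
    then have "\<not> s < \<tau> * 2 ^ Suc j" unfolding k_def by (intro not_less_Least) auto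
    then show ?thesis using Suc by simp
  qed
  ultimately show thesis using k1 by (intro that) auto
qed

text \<open>Cut the coefficients at height \<open>t k\<close>, where \<open>t k\<close> is comparable to the size of the sum at the
  given point; the large coefficients are then controlled in \<open>L\<^sup>1\<close> and the small ones in \<open>L\<^sup>2\<close>.
  The two extreme heights leave one of the two parts empty.\<close>

lemma dyadic_pointwise:
  fixes u :: "'i \<Rightarrow> complex" and g :: "'i \<Rightarrow> complex" and \<tau> p :: real
  assumes p: "1 < p" "p < 2" and F: "finite F" and \<tau>: "\<tau> > 0"
    and lo: "\<And>n. n \<in> F \<Longrightarrow> \<tau> \<le> norm (g n)" and hi: "\<And>n. n \<in> F \<Longrightarrow> norm (g n) < \<tau> * 2 ^ m"
  defines "t \<equiv> \<lambda>k. \<tau> * 2 ^ k"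
  shows "norm (\<Sum>n\<in>F. g n * u n) powr p
     \<le> (\<Sum>k<Suc m. 16 * (t k powr (p - 1) * norm (\<Sum>n\<in>{n\<in>F. t k \<le> norm (g n)}. g n * u n)
                  + t k powr (p - 2) * (norm (\<Sum>n\<in>{n\<in>F. norm (g n) < t k}. g n * u n))\<^sup>2))"
proof -
  define s where "s = norm (\<Sum>n\<in>F. g n * u n)"
  define G where "G k = norm (\<Sum>n\<in>{n\<in>F. t k \<le> norm (g n)}. g n * u n)" for k
  define H where "H k = norm (\<Sum>n\<in>{n\<in>F. norm (g n) < t k}. g n * u n)" for k
  define R where "R k = 16 * (t k powr (p - 1) * G k + t k powr (p - 2) * (H k)\<^sup>2)" for k
  have t: "t k > 0" for k using \<tau> by (simp add: t_def)
  have GH: "G k \<ge> 0" "H k \<ge> 0" for k by (auto simp: G_def H_def)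
  have s0: "s \<ge> 0" by (simp add: s_def)
  have sGH: "s \<le> G k + H k" for k
  proof -
    have "(\<Sum>n\<in>F. g n * u n) = (\<Sum>n\<in>{n\<in>F. t k \<le> norm (g n)}. g n * u n) + (\<Sum>n\<in>{n\<in>F. norm (g n) < t k}. g n * u n)"
      using sum_split_filter[OF F, of "\<lambda>n. g n * u n" "\<lambda>n. t k \<le> norm (g n)"] by (simp add: not_le)
    then show ?thesis unfolding s_def G_def H_def by (simp only: norm_triangle_ineq)
  qed
  have scale: "t k powr p * (y / t k) = t k powr (p - 1) * y"
     "t k powr p * (y / t k)\<^sup>2 = t k powr (p - 2) * y\<^sup>2" for k y
    using t[of k] by (simp_all add: powr_diff power_divide)
  have "\<exists>k<Suc m. s powr p \<le> R k"
  proof (cases "s = 0")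
    case True
    then show ?thesis using GH by (intro exI[of _ 0]) (simp add: R_def)
  next
    case False
    with s0 have s: "s > 0" by simp
    have sp: "s powr p = t k powr p * (s / t k) powr p" for k
      using s t[of k] by (simp add: powr_divide)
    \<comment> \<open>Below all heights s / t 0 is less than 1 and the power p may be lowered to 1;
      above all of them s / t m is at least 1 and p may be raised to 2. In between some height lies
      within a factor 2 of s.\<close>
    consider "s < \<tau>" | "s \<ge> \<tau> * 2 ^ m" | "\<tau> \<le> s" "s < \<tau> * 2 ^ m" by linarith
    then show ?thesis
    proof cases
      case 1
      have "{n\<in>F. t 0 \<le> norm (g n)} = F" using lo by (auto simp: t_def)
      then have G0: "G 0 = s" by (simp add: G_def s_def)
      have "(s / t 0) powr p \<le> (s / t 0) powr 1"
        using 1 s \<tau> p by (intro powr_mono') (auto simp: t_def)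
      then have "s powr p \<le> t 0 powr p * (s / t 0)"
        unfolding sp[of 0] using s t[of 0] by (intro mult_left_mono) auto
      also have "\<dots> = t 0 powr (p - 1) * G 0" unfolding scale G0 ..
      also have "\<dots> \<le> R 0" unfolding R_def using GH(1)[of 0] t[of 0] by (simp add: distrib_left add_increasing2)
      finally show ?thesis by auto
    next
      case 2
      have "{n\<in>F. norm (g n) < t m} = F" using hi by (auto simp: t_def)
      then have H0: "H m = s" by (simp add: H_def s_def)
      have "(s / t m) powr p \<le> (s / t m) powr 2"
        using 2 s t[of m] p by (intro powr_mono) (auto simp: t_def)
      then have "s powr p \<le> t m powr p * (s / t m)\<^sup>2"
        unfolding sp[of m] using s t[of m] by (intro mult_left_mono) auto
      also have "\<dots> = t m powr (p - 2) * (H m)\<^sup>2" unfolding scale H0 ..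
      also have "\<dots> \<le> R m" unfolding R_def using GH(1)[of m] t[of m] by (simp add: distrib_left add_increasing)
      finally show ?thesis by auto
    next
      case 3
      then obtain k where k: "k < m" "t k \<le> s" "s < 2 * t k"
        using \<tau> unfolding t_def by (rule_tac dyadic_level[of \<tau> s m]) auto
      have "s powr p \<le> (2 * t k) powr p" using k s p by (intro powr_mono2) auto
      also have "\<dots> = 2 powr p * t k powr p" using t[of k] by (simp add: powr_mult)
      also have "\<dots> \<le> 4 * t k powr p"
        using powr_mono[of p 2 2] p by (intro mult_right_mono) auto
      \<comment> \<open>One of the two parts carries at least half of s, and s is at least t k, so
        either G k / t k is at least 1 / 2 or the square of H k / t k is at least 1 / 4. This loss
        of 4 and the bound 4 for \<open>2 powr p\<close> make 16.\<close>
      also have "\<dots> \<le> 16 * (t k powr p * (G k / t k + (H k / t k)\<^sup>2))"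
      proof -
        have "1 / 4 \<le> G k / t k + (H k / t k)\<^sup>2"
        proof (cases "G k \<ge> s / 2")
          case True
          then have "1 / 2 \<le> G k / t k" using k t[of k] by (simp add: field_simps)
          moreover have "(H k / t k)\<^sup>2 \<ge> 0" by simp
          ultimately show ?thesis by linarith
        next
          case False
          then have "1 / 2 \<le> H k / t k" using k t[of k] sGH[of k] by (simp add: field_simps)
          then have "(1 / 2)\<^sup>2 \<le> (H k / t k)\<^sup>2" by (intro power_mono) auto
          then have "1 / 4 \<le> (H k / t k)\<^sup>2" by (simp add: power_one_over)
          moreover have "0 \<le> G k / t k" using GH t[of k] by simp
          ultimately show ?thesis by linarith
        qed
        then have "t k powr p * (1 / 4) \<le> t k powr p * (G k / t k + (H k / t k)\<^sup>2)"
          by (intro mult_left_mono) auto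
        then show ?thesis by linarith
      qed
      also have "\<dots> = R k" unfolding R_def distrib_left scale ..
      finally show ?thesis using k(1) by (intro exI[of _ k]) auto
    qed
  qed
  then obtain k where "k < Suc m" "s powr p \<le> R k" by blast
  moreover have "R k \<le> (\<Sum>k<Suc m. R k)"
    using \<open>k < Suc m\<close> GH by (intro member_le_sum) (auto simp: R_def)
  ultimately have "s powr p \<le> (\<Sum>k<Suc m. R k)" by linarith
  then show ?thesis by (simp only: R_def s_def G_def H_def)
qed

text \<open>The factor 16 is the loss of the pointwise estimate; the quotients sum the geometric
  series over the heights below and above a coefficient. For p strictly between 1 and 2 they grow
  without bound towards the endpoints.\<close>

definition interpolation_const :: "real \<Rightarrow> real" where
  "interpolation_const p = 16 * (1 / (1 - 2 powr - (p - 1)) + 1 / (1 - 2 powr - (2 - p)))"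

text \<open>The formula is also meaningful at the endpoints, where one of the two denominators is
  \<open>0\<close> and the quotient is therefore \<open>0\<close>.\<close>

lemma interpolation_const_ge_1:
  assumes "1 \<le> p" "p \<le> 2"
  shows "1 \<le> interpolation_const p"
proof -
  have ge: "1 / (1 - 2 powr - q) \<ge> 1" if "q > 0" for q :: real
    using that powr_less_one[of 2 "- q"] by simp
  consider "p = 1" | "p = 2" | "1 < p" "p < 2" using assms by linarith
  then show ?thesis
  proof cases
    case 1 then show ?thesis using ge[of 1] by (simp add: interpolation_const_def)
  next
    case 2 then show ?thesis using ge[of 1] by (simp add: interpolation_const_def)
  next
    case 3 then show ?thesis using ge[of "p - 1"] ge[of "2 - p"] by (simp add: interpolation_const_def)
  qed
qed

text \<open>The Marcinkiewicz theorem for the map sending g to the sum of \<open>g n * u n\<close>,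
  from the endpoints l^1 to L^1 and l^2 to L^2 with weights w. It is stated for finite sums with a
  constant independent of the index set, so that Fatou's lemma can pass to infinite series.\<close>

lemma strong_type_interpolation:
  fixes u :: "'i \<Rightarrow> 'x \<Rightarrow> complex" and w :: "'i \<Rightarrow> real" and C p :: real
  assumes p: "1 \<le> p" "p \<le> 2" and C: "C \<ge> 0" and w: "\<And>n. w n \<ge> 0"
    and meas[measurable]: "\<And>n. u n \<in> borel_measurable M"
    and L1: "\<And>n. (\<integral>\<^sup>+ x. ennreal (norm (u n x)) \<partial>M) \<le> ennreal (C * w n)"
    and L2: "\<And>F g. finite F \<Longrightarrow> (\<integral>\<^sup>+ x. ennreal ((norm (\<Sum>n\<in>F. g n * u n x))\<^sup>2) \<partial>M) \<le> ennreal (C * (\<Sum>n\<in>F. (norm (g n))\<^sup>2 * w n))"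
    and F: "finite F"
  shows "(\<integral>\<^sup>+ x. ennreal (norm (\<Sum>n\<in>F. g n * u n x) powr p) \<partial>M)
     \<le> ennreal (C * interpolation_const p * (\<Sum>n\<in>F. norm (g n) powr p * w n))"
proof -
  have L1': "(\<integral>\<^sup>+ x. ennreal (norm (\<Sum>n\<in>F. g n * u n x)) \<partial>M) \<le> ennreal (C * (\<Sum>n\<in>F. norm (g n) * w n))"
    if "finite F" for F and g :: "'i \<Rightarrow> complex"
  proof -
    have "(\<integral>\<^sup>+ x. ennreal (norm (\<Sum>n\<in>F. g n * u n x)) \<partial>M) \<le> (\<integral>\<^sup>+ x. (\<Sum>n\<in>F. ennreal (norm (g n)) * ennreal (norm (u n x))) \<partial>M)"
    proof (rule nn_integral_mono)
      fix x
      have "norm (\<Sum>n\<in>F. g n * u n x) \<le> (\<Sum>n\<in>F. norm (g n) * norm (u n x))"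
        by (rule sum_norm_le) (simp add: norm_mult)
      then have "ennreal (norm (\<Sum>n\<in>F. g n * u n x)) \<le> ennreal (\<Sum>n\<in>F. norm (g n) * norm (u n x))"
        by (rule ennreal_leI)
      also have "\<dots> = (\<Sum>n\<in>F. ennreal (norm (g n)) * ennreal (norm (u n x)))"
        by (subst sum_ennreal[symmetric]) (auto simp: ennreal_mult)
      finally show "ennreal (norm (\<Sum>n\<in>F. g n * u n x)) \<le> (\<Sum>n\<in>F. ennreal (norm (g n)) * ennreal (norm (u n x)))" .
    qed
    also have "\<dots> = (\<Sum>n\<in>F. ennreal (norm (g n)) * (\<integral>\<^sup>+ x. ennreal (norm (u n x)) \<partial>M))"
      by (simp add: nn_integral_sum nn_integral_cmult)
    also have "\<dots> \<le> (\<Sum>n\<in>F. ennreal (norm (g n)) * ennreal (C * w n))"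
      by (intro sum_mono mult_left_mono L1) auto
    also have "\<dots> = ennreal (\<Sum>n\<in>F. norm (g n) * (C * w n))"
      using C w by (subst sum_ennreal[symmetric]) (auto simp: ennreal_mult)
    also have "(\<Sum>n\<in>F. norm (g n) * (C * w n)) = C * (\<Sum>n\<in>F. norm (g n) * w n)"
      by (simp add: sum_distrib_left mult_ac)
    finally show ?thesis .
  qed
  have endpt: "ennreal (C * S) \<le> ennreal (C * interpolation_const p * S)" if "S \<ge> 0" for S
    using mult_right_mono[OF interpolation_const_ge_1[OF p], of "C * S"] that C
    by (intro ennreal_leI) (simp add: mult_ac)
  consider "p = 1" | "p = 2" | "1 < p" "p < 2" using p by linarith
  then show ?thesis
  proof cases
    case 1
    then show ?thesis using order.trans[OF L1'[OF F] endpt] w by (simp add: sum_nonneg)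
  next
    case 2
    then show ?thesis using order.trans[OF L2[OF F] endpt] w by (simp add: sum_nonneg)
  next
    case 3
    define c1 where "c1 = 1 / (1 - 2 powr - (p - 1))"
    define c2 where "c2 = 1 / (1 - 2 powr - (2 - p))"
    have c: "c1 \<ge> 0" "c2 \<ge> 0" using 3 powr_less_one[of 2 "-(p-1)"] powr_less_one[of 2 "-(2-p)"]
      by (auto simp: c1_def c2_def)
    define K where "K = 16 * C * (c1 + c2)"
    have K: "C * interpolation_const p = K" by (simp add: K_def interpolation_const_def c1_def c2_def)
    \<comment> \<open>Nonzero coefficients make the smallest modulus \<tau> positive, so finitely
      many doublings of it exceed the largest modulus.\<close>
    have main: "(\<integral>\<^sup>+ x. ennreal (norm (\<Sum>n\<in>F. g n * u n x) powr p) \<partial>M) \<le> ennreal (K * (\<Sum>n\<in>F. norm (g n) powr p * w n))"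
      if F: "finite F" "F \<noteq> {}" and g0: "\<And>n. n \<in> F \<Longrightarrow> g n \<noteq> 0" for F and g :: "'i \<Rightarrow> complex"
    proof -
      define \<tau> where "\<tau> = Min ((\<lambda>n. norm (g n)) ` F)"
      have "\<tau> \<in> (\<lambda>n. norm (g n)) ` F" unfolding \<tau>_def using F by (intro Min_in) auto
      then have \<tau>: "\<tau> > 0" using g0 by auto
      have lo: "\<tau> \<le> norm (g n)" if "n \<in> F" for n
        unfolding \<tau>_def using F that by (intro Min_le) auto
      obtain m where m: "Max ((\<lambda>n. norm (g n)) ` F) / \<tau> < 2 ^ m"
        using real_arch_pow[of 2] by auto
      have hi: "norm (g n) < \<tau> * 2 ^ m" if "n \<in> F" for n
      proof -
        have "norm (g n) \<le> Max ((\<lambda>n. norm (g n)) ` F)" using F that by (intro Max_ge) auto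
        also have "\<dots> < \<tau> * 2 ^ m" using m \<tau> by (simp add: field_simps)
        finally show ?thesis .
      qed
      define t where "t k = \<tau> * 2 ^ k" for k :: nat
      have t: "t k > 0" for k using \<tau> by (simp add: t_def)
      let ?G = "\<lambda>k. {n\<in>F. t k \<le> norm (g n)}" and ?H = "\<lambda>k. {n\<in>F. norm (g n) < t k}"
      define a where "a k = 16 * t k powr (p - 1)" for k
      define b where "b k = 16 * t k powr (p - 2)" for k
      have ab: "a k \<ge> 0" "b k \<ge> 0" for k by (auto simp: a_def b_def)
      have "(\<integral>\<^sup>+ x. ennreal (norm (\<Sum>n\<in>F. g n * u n x) powr p) \<partial>M)
        \<le> (\<integral>\<^sup>+ x. (\<Sum>k<Suc m. ennreal (a k) * ennreal (norm (\<Sum>n\<in>?G k. g n * u n x))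
              + ennreal (b k) * ennreal ((norm (\<Sum>n\<in>?H k. g n * u n x))\<^sup>2)) \<partial>M)"
      proof (rule nn_integral_mono)
        fix x
        have "ennreal (norm (\<Sum>n\<in>F. g n * u n x) powr p) \<le> ennreal (\<Sum>k<Suc m. a k * norm (\<Sum>n\<in>?G k. g n * u n x)
              + b k * (norm (\<Sum>n\<in>?H k. g n * u n x))\<^sup>2)"
          using dyadic_pointwise[OF 3 F(1) \<tau> lo hi, where u = "\<lambda>n. u n x"]
          by (intro ennreal_leI) (simp add: a_def b_def t_def algebra_simps)
        also have "\<dots> = (\<Sum>k<Suc m. ennreal (a k) * ennreal (norm (\<Sum>n\<in>?G k. g n * u n x))
              + ennreal (b k) * ennreal ((norm (\<Sum>n\<in>?H k. g n * u n x))\<^sup>2))"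
          using ab by (subst sum_ennreal[symmetric]) (auto simp: ennreal_mult ennreal_plus)
        finally show "ennreal (norm (\<Sum>n\<in>F. g n * u n x) powr p) \<le> \<dots>" .
      qed
      also have "\<dots> = (\<Sum>k<Suc m. ennreal (a k) * (\<integral>\<^sup>+ x. ennreal (norm (\<Sum>n\<in>?G k. g n * u n x)) \<partial>M)
              + ennreal (b k) * (\<integral>\<^sup>+ x. ennreal ((norm (\<Sum>n\<in>?H k. g n * u n x))\<^sup>2) \<partial>M))"
        by (subst nn_integral_sum, measurable) (intro sum.cong refl, subst nn_integral_add, measurable, simp add: nn_integral_cmult)
      also have "\<dots> \<le> (\<Sum>k<Suc m. ennreal (a k) * ennreal (C * (\<Sum>n\<in>?G k. norm (g n) * w n))
              + ennreal (b k) * ennreal (C * (\<Sum>n\<in>?H k. (norm (g n))\<^sup>2 * w n)))"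
        using F(1) by (intro sum_mono add_mono mult_left_mono L1' L2) auto
      also have "\<dots> = ennreal (\<Sum>k<Suc m. a k * (C * (\<Sum>n\<in>?G k. norm (g n) * w n)) + b k * (C * (\<Sum>n\<in>?H k. (norm (g n))\<^sup>2 * w n)))"
        using ab C w by (subst sum_ennreal[symmetric]) (auto simp: ennreal_mult ennreal_plus sum_nonneg)
      also have "\<dots> \<le> ennreal (K * (\<Sum>n\<in>F. norm (g n) powr p * w n))"
      proof (rule ennreal_leI)
        \<comment> \<open>After exchanging the sums, each coefficient collects the heights below its
          own modulus; the powers with exponent p - 1 have a sum comparable to the largest one
          because p > 1.\<close>
        have "(\<Sum>k<Suc m. a k * (C * (\<Sum>n\<in>?G k. norm (g n) * w n)))
          = 16 * C * (\<Sum>n\<in>F. norm (g n) * w n * (\<Sum>k<Suc m. if t k \<le> norm (g n) then t k powr (p - 1) else 0))"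
        proof -
          have "a k * (C * (\<Sum>n\<in>?G k. norm (g n) * w n))
             = (\<Sum>n\<in>F. 16 * C * (norm (g n) * w n * (if t k \<le> norm (g n) then t k powr (p - 1) else 0)))" for k
          proof -
            have "a k * (C * (\<Sum>n\<in>?G k. norm (g n) * w n)) = (\<Sum>n\<in>F. a k * C * (if t k \<le> norm (g n) then norm (g n) * w n else 0))"
              using F(1) by (simp add: sum.inter_filter sum_distrib_left mult.assoc)
            also have "\<dots> = (\<Sum>n\<in>F. 16 * C * (norm (g n) * w n * (if t k \<le> norm (g n) then t k powr (p - 1) else 0)))"
              by (intro sum.cong refl) (simp add: a_def)
            finally show ?thesis .
          qed
          then show ?thesis by (simp only: sum.swap[of _ F] sum_distrib_left)
        qed
        also have "\<dots> \<le> 16 * C * (\<Sum>n\<in>F. norm (g n) * w n * (norm (g n) powr (p - 1) * c1))"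
        proof (intro mult_left_mono sum_mono)
          fix n assume "n \<in> F"
          then show "(\<Sum>k<Suc m. if t k \<le> norm (g n) then t k powr (p - 1) else 0) \<le> norm (g n) powr (p - 1) * c1"
            unfolding t_def c1_def mult_1_right times_divide_eq_right using 3 \<tau> g0 by (intro dyadic_sum_below) auto
        qed (use C w in auto)
        also have "\<dots> = 16 * C * c1 * (\<Sum>n\<in>F. norm (g n) powr p * w n)"
        proof -
          have "norm (g n) * w n * (norm (g n) powr (p - 1) * c1) = c1 * (norm (g n) powr p * w n)" if "n \<in> F" for n
            using g0[OF that] by (simp add: powr_diff)
          then have "(\<Sum>n\<in>F. norm (g n) * w n * (norm (g n) powr (p - 1) * c1)) = (\<Sum>n\<in>F. c1 * (norm (g n) powr p * w n))"
            by (intro sum.cong refl) auto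
          then show ?thesis by (simp only: sum_distrib_left[symmetric] mult.assoc)
        qed
        finally have 1: "(\<Sum>k<Suc m. a k * (C * (\<Sum>n\<in>?G k. norm (g n) * w n))) \<le> 16 * C * c1 * (\<Sum>n\<in>F. norm (g n) powr p * w n)" .
        \<comment> \<open>Here each coefficient collects the heights above its modulus, where the
          powers with exponent p - 2 decay because p < 2.\<close>
        have "(\<Sum>k<Suc m. b k * (C * (\<Sum>n\<in>?H k. (norm (g n))\<^sup>2 * w n)))
          = 16 * C * (\<Sum>n\<in>F. (norm (g n))\<^sup>2 * w n * (\<Sum>k<Suc m. if norm (g n) < t k then t k powr - (2 - p) else 0))"
        proof -
          have "b k * (C * (\<Sum>n\<in>?H k. (norm (g n))\<^sup>2 * w n))
             = (\<Sum>n\<in>F. 16 * C * ((norm (g n))\<^sup>2 * w n * (if norm (g n) < t k then t k powr - (2 - p) else 0)))" for k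
          proof -
            have "b k * (C * (\<Sum>n\<in>?H k. (norm (g n))\<^sup>2 * w n)) = (\<Sum>n\<in>F. b k * C * (if norm (g n) < t k then (norm (g n))\<^sup>2 * w n else 0))"
              using F(1) by (simp add: sum.inter_filter sum_distrib_left mult.assoc)
            also have "\<dots> = (\<Sum>n\<in>F. 16 * C * ((norm (g n))\<^sup>2 * w n * (if norm (g n) < t k then t k powr - (2 - p) else 0)))"
              by (intro sum.cong refl) (simp add: b_def)
            finally show ?thesis .
          qed
          then show ?thesis by (simp only: sum.swap[of _ F] sum_distrib_left)
        qed
        also have "\<dots> \<le> 16 * C * (\<Sum>n\<in>F. (norm (g n))\<^sup>2 * w n * (norm (g n) powr - (2 - p) * c2))"
        proof (intro mult_left_mono sum_mono)
          fix n assume "n \<in> F"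
          then show "(\<Sum>k<Suc m. if norm (g n) < t k then t k powr - (2 - p) else 0) \<le> norm (g n) powr - (2 - p) * c2"
            unfolding t_def c2_def mult_1_right times_divide_eq_right using 3 \<tau> g0 by (intro dyadic_sum_above) auto
        qed (use C w in auto)
        also have "\<dots> = 16 * C * c2 * (\<Sum>n\<in>F. norm (g n) powr p * w n)"
        proof -
          have "(norm (g n))\<^sup>2 * w n * (norm (g n) powr - (2 - p) * c2) = c2 * (norm (g n) powr p * w n)" if "n \<in> F" for n
            using g0[OF that] by (simp add: powr_diff)
          then have "(\<Sum>n\<in>F. (norm (g n))\<^sup>2 * w n * (norm (g n) powr - (2 - p) * c2)) = (\<Sum>n\<in>F. c2 * (norm (g n) powr p * w n))"
            by (intro sum.cong refl) auto
          then show ?thesis by (simp only: sum_distrib_left[symmetric] mult.assoc)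
        qed
        finally have 2: "(\<Sum>k<Suc m. b k * (C * (\<Sum>n\<in>?H k. (norm (g n))\<^sup>2 * w n))) \<le> 16 * C * c2 * (\<Sum>n\<in>F. norm (g n) powr p * w n)" .
        have "K * (\<Sum>n\<in>F. norm (g n) powr p * w n) = 16 * C * c1 * (\<Sum>n\<in>F. norm (g n) powr p * w n) + 16 * C * c2 * (\<Sum>n\<in>F. norm (g n) powr p * w n)"
          by (simp add: K_def algebra_simps)
        then show "(\<Sum>k<Suc m. a k * (C * (\<Sum>n\<in>?G k. norm (g n) * w n)) + b k * (C * (\<Sum>n\<in>?H k. (norm (g n))\<^sup>2 * w n)))
          \<le> K * (\<Sum>n\<in>F. norm (g n) powr p * w n)"
          using add_mono[OF 1 2] by (simp only: sum.distrib)
      qed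
      finally show ?thesis .
    qed
    show ?thesis
    proof -
      define F' where "F' = {n\<in>F. g n \<noteq> 0}"
      have s1: "(\<Sum>n\<in>F. g n * u n x) = (\<Sum>n\<in>F'. g n * u n x)" for x
        unfolding F'_def using F by (intro sum.mono_neutral_right) auto
      have s2: "(\<Sum>n\<in>F. norm (g n) powr p * w n) = (\<Sum>n\<in>F'. norm (g n) powr p * w n)"
        unfolding F'_def using F by (intro sum.mono_neutral_right) auto
      show ?thesis
      proof (cases "F' = {}")
        case True
        then show ?thesis unfolding K s1 s2 by simp
      next
        case False
        show ?thesis unfolding K s1 s2 by (rule main) (use F False in \<open>auto simp: F'_def\<close>)
      qed
    qed
  qed
qed

section \<open>A criterion for simple interpolation\<close>

text \<open>A Neumann series. Row sums at most 1 / 2 make the map sending y to a - K y a contraction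
  of l^\<infinity>, and the iterates of 0 stay bounded by A + A / 2 + ... = 2 A.\<close>

lemma small_matrix_solvable:
  fixes K :: "nat \<Rightarrow> nat \<Rightarrow> complex" and a :: "nat \<Rightarrow> complex"
  assumes K: "\<And>k F. finite F \<Longrightarrow> (\<Sum>n\<in>F. norm (K k n)) \<le> 1 / 2" and a: "\<And>k. norm (a k) \<le> A"
  obtains h H where "\<And>k. norm (h k) \<le> H" "\<And>k. h k + (\<Sum>n. K k n * h n) = a k"
proof -
  have sK: "summable (\<lambda>n. norm (K k n))" for k
    by (rule summableI_nonneg_bounded[where x = "1/2"], simp, rule K, simp)
  have tK: "(\<Sum>n. norm (K k n)) \<le> 1 / 2" for k
    by (rule suminf_le_const[OF sK], rule K) simp
  have sum_bd: "summable (\<lambda>n. K k n * y n) \<and> norm (\<Sum>n. K k n * y n) \<le> 1 / 2 * Y" 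
    if y: "\<And>n. norm (y n) \<le> Y" for y Y k
  proof
    have le: "norm (K k n * y n) \<le> norm (K k n) * Y" for n
      unfolding norm_mult by (intro mult_left_mono y) auto
    have s: "summable (\<lambda>n. norm (K k n) * Y)" by (rule summable_mult2[OF sK])
    have sn: "summable (\<lambda>n. norm (K k n * y n))"
      by (rule summable_comparison_test'[OF s, of 0]) (use le in simp)
    then show "summable (\<lambda>n. K k n * y n)" by (rule summable_norm_cancel)
    have "Y \<ge> 0" using y[of 0] norm_ge_zero[of "y 0"] by linarith
    have "norm (\<Sum>n. K k n * y n) \<le> (\<Sum>n. norm (K k n * y n))" by (rule summable_norm[OF sn])
    also have "\<dots> \<le> (\<Sum>n. norm (K k n) * Y)" by (rule suminf_le[OF le sn s])
    also have "\<dots> = (\<Sum>n. norm (K k n)) * Y" using suminf_mult2[OF sK, where c = Y] by simp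
    also have "\<dots> \<le> 1 / 2 * Y" using tK \<open>Y \<ge> 0\<close> by (intro mult_right_mono)
    finally show "norm (\<Sum>n. K k n * y n) \<le> 1 / 2 * Y" .
  qed
  have A: "A \<ge> 0" using a[of 0] norm_ge_zero order.trans by blast
  define T where "T y k = a k - (\<Sum>n. K k n * y n)" for y :: "nat \<Rightarrow> complex" and k
  have contr: "norm (T x k - T y k) \<le> 1 / 2 * d"
    if "\<And>n. norm (x n) \<le> Y" "\<And>n. norm (y n) \<le> Y" "\<And>n. norm (x n - y n) \<le> d" for x y Y d k
  proof -
    have "T x k - T y k = (\<Sum>n. K k n * (y n - x n))"
      unfolding T_def right_diff_distrib
      by (subst suminf_diff[symmetric]) (use sum_bd[OF that(1)] sum_bd[OF that(2)] in auto)
    then show ?thesis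
      using sum_bd[of "\<lambda>n. y n - x n" d k] that(3) by (simp add: norm_minus_commute)
  qed
  define y where "y m = (T ^^ m) (\<lambda>_. 0)" for m
  have y_Suc: "y (Suc m) = T (y m)" for m by (simp add: y_def)
  have y_bd: "norm (y m k) \<le> 2 * A" for m k
  proof (induction m arbitrary: k)
    case 0
    then show ?case using A by (simp add: y_def)
  next
    case (Suc m)
    have "norm (T (y m) k) \<le> norm (a k) + norm (\<Sum>n. K k n * y m n)"
      unfolding T_def by (rule norm_triangle_ineq4)
    also have "\<dots> \<le> A + 1 / 2 * (2 * A)"
      using sum_bd[OF Suc.IH, where k = k] a[of k] by (intro add_mono) auto
    finally show ?case by (simp add: y_Suc)
  qed
  have y_diff: "norm (y (m + j) k - y m k) \<le> 2 * A / 2 ^ m" for m j k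
  proof (induction m arbitrary: k)
    case 0
    then show ?case using y_bd[of j k] by (simp add: y_def)
  next
    case (Suc m)
    show ?case using contr[OF y_bd y_bd Suc.IH, where k = k] by (simp add: y_Suc)
  qed
  have small: "x = 0" if "\<And>m. norm x \<le> 2 * A / 2 ^ m" for x :: complex
  proof -
    have "(\<lambda>m. 2 * A * (1 / 2) ^ m) \<longlonglongrightarrow> 2 * A * 0"
      by (intro tendsto_intros LIMSEQ_power_zero) auto
    then have "norm x \<le> 0"
      using that by (intro LIMSEQ_le_const[where X = "\<lambda>m. 2 * A * (1 / 2) ^ m"]) (auto simp: power_divide)
    then show ?thesis by simp
  qed
  have "convergent (\<lambda>m. y m k)" for k
  proof (rule Cauchy_convergent, rule metric_CauchyI)
    fix e :: real assume e: "e > 0"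
    have "(\<lambda>m. 2 * A * (1 / 2) ^ m) \<longlonglongrightarrow> 2 * A * 0"
      by (intro tendsto_intros LIMSEQ_power_zero) auto
    then have "\<forall>\<^sub>F m in sequentially. 2 * A * (1 / 2) ^ m < e / 2"
      using e by (intro order_tendstoD(2)) auto
    then obtain m0 where m0: "2 * A / 2 ^ m0 < e / 2"
      by (auto simp: eventually_sequentially power_divide)
    have "dist (y m k) (y m0 k) < e / 2" if "m \<ge> m0" for m
      using y_diff[of m0 "m - m0" k] m0 that by (simp add: dist_norm)
    then show "\<exists>M. \<forall>m\<ge>M. \<forall>n\<ge>M. dist (y m k) (y n k) < e"
      using dist_triangle_half_l by (metis dist_commute)
  qed
  then obtain h where h: "\<And>k. (\<lambda>m. y m k) \<longlonglongrightarrow> h k" unfolding convergent_def by metis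
  \<comment> \<open>The limit was taken coordinate by coordinate, but the rate is the same in all of
    them. This uniformity lets \<open>T\<close>, which involves all coordinates at once, pass to the
    limit.\<close>
  have h_diff: "norm (h k - y m k) \<le> 2 * A / 2 ^ m" for k m
  proof (rule LIMSEQ_le_const2)
    show "(\<lambda>j. norm (y (j + m) k - y m k)) \<longlonglongrightarrow> norm (h k - y m k)"
      by (intro tendsto_intros LIMSEQ_ignore_initial_segment h)
  qed (use y_diff[of m _ k] in \<open>auto simp: add.commute\<close>)
  have h_bd: "norm (h k) \<le> 2 * A" for k using h_diff[of k 0] by (simp add: y_def)
  have "T h k = h k" for k
  proof -
    have "norm (T h k - h k) \<le> 2 * A / 2 ^ m" for m
    proof -
      have "norm (T h k - h k) \<le> norm (T h k - T (y m) k) + norm (h k - y (Suc m) k)"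
        unfolding y_Suc using norm_triangle_ineq4[of "T h k - T (y m) k" "h k - T (y m) k"] by simp
      also have "\<dots> \<le> 1 / 2 * (2 * A / 2 ^ m) + 2 * A / 2 ^ Suc m"
        by (intro add_mono contr[OF h_bd y_bd h_diff] h_diff)
      finally show ?thesis by (simp add: field_simps)
    qed
    then show ?thesis using small[of "T h k - h k"] by simp
  qed
  then have "h k + (\<Sum>n. K k n * h n) = a k" for k
    unfolding T_def by (simp add: diff_eq_eq add.commute)
  with h_bd show thesis by (rule that)
qed

text \<open>Cauchy's inequality, applied in one variable at a time, bounds the partial derivatives
  of the terms by the terms on a slightly larger bidisc. The differentiated series therefore
  converge uniformly on a convex neighbourhood of the point, and the series may be differentiated
  term by term.\<close>

lemma holomorphic2_product_series:
  fixes A B :: "nat \<Rightarrow> complex poly" and c :: "nat \<Rightarrow> complex"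
  assumes conv: "\<And>R. 0 < R \<Longrightarrow> R < 1 \<Longrightarrow> \<exists>M. summable M \<and>
     (\<forall>n z w. norm z \<le> R \<longrightarrow> norm w \<le> R \<longrightarrow> norm (c n * poly (A n) z * poly (B n) w) \<le> M n)"
  shows "(\<lambda>x. \<Sum>n. c n * poly (A n) (fst x) * poly (B n) (snd x)) holomorphic2_on bidisc"
    and "x \<in> bidisc \<Longrightarrow> summable (\<lambda>n. c n * poly (A n) (fst x) * poly (B n) (snd x))"
proof -
  define f where "f n x = c n * poly (A n) (fst x) * poly (B n) (snd x)" for n and x :: "complex \<times> complex"
  have key: "summable (\<lambda>n. f n x) \<and> (\<exists>a b. ((\<lambda>x. \<Sum>n. f n x) has_derivative (\<lambda>h. a * fst h + b * snd h)) (at x))"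
    if x: "x \<in> bidisc" for x
  proof -
    have nx: "norm (fst x) < 1" "norm (snd x) < 1" using x by (auto simp: bidisc_def)
    then have "max (norm (fst x)) (norm (snd x)) < 1" by simp
    then obtain R where R: "max (norm (fst x)) (norm (snd x)) < R" "R < 1" using dense by blast
    then have R0: "R > 0" by (smt (verit) norm_ge_zero)
    obtain R' where R': "R < R'" "R' < 1" using R dense by blast
    obtain M where M: "summable M" "\<And>n z w. norm z \<le> R' \<Longrightarrow> norm w \<le> R' \<Longrightarrow> norm (c n * poly (A n) z * poly (B n) w) \<le> M n"
      using conv[of R'] R' R0 by auto
    define S where "S = ball (0::complex) R \<times> ball (0::complex) R"
    have S: "convex S" "open S" "x \<in> S"
      using R by (auto simp: S_def intro: convex_Times open_Times mem_Times_iff) (auto simp: mem_Times_iff)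
    define a where "a n x = c n * poly (pderiv (A n)) (fst x) * poly (B n) (snd x)" for n and x :: "complex \<times> complex"
    define b where "b n x = c n * poly (A n) (fst x) * poly (pderiv (B n)) (snd x)" for n and x :: "complex \<times> complex"
    \<comment> \<open>The constant e takes up the coefficient and the factor in the other variable,
      so one estimate serves both partial derivatives. The disc of radius R' - R about a point of
      modulus below R stays within modulus R'.\<close>
    have cauchy: "norm (poly (pderiv p) z * e) \<le> D / (R' - R)"
      if z: "norm z < R" and D: "\<And>z. norm z \<le> R' \<Longrightarrow> norm (poly p z * e) \<le> D" for p :: "complex poly" and z e D
    proof -
      have "norm ((deriv ^^ 1) (\<lambda>z. poly p z * e) z) \<le> fact 1 * D / (R' - R) ^ 1"
      proof (rule Cauchy_inequality)
        show "(\<lambda>z. poly p z * e) holomorphic_on ball z (R' - R)" by (intro holomorphic_intros)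
        show "continuous_on (cball z (R' - R)) (\<lambda>z. poly p z * e)" by (intro continuous_intros)
        show "0 < R' - R" using R' by simp
        fix y assume "norm (z - y) = R' - R"
        then have "norm y \<le> R'" using z norm_triangle_ineq4[of z "z - y"] by simp
        then show "norm (poly p y * e) \<le> D" by (rule D)
      qed
      moreover have "deriv (\<lambda>z. poly p z * e) z = poly (pderiv p) z * e"
        by (rule DERIV_imp_deriv) (auto intro!: derivative_eq_intros poly_DERIV)
      ultimately show ?thesis by simp
    qed
    have ab: "norm (a n y) \<le> M n / (R' - R)" "norm (b n y) \<le> M n / (R' - R)" if y: "y \<in> S" for n y
    proof -
      have ny: "norm (fst y) < R" "norm (snd y) < R" using y by (auto simp: S_def)
      have "norm (poly (pderiv (A n)) (fst y) * (c n * poly (B n) (snd y))) \<le> M n / (R' - R)"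
        using M(2)[of _ "snd y" n] ny R' by (intro cauchy) (auto simp: mult_ac)
      then show "norm (a n y) \<le> M n / (R' - R)" by (simp add: a_def mult_ac)
      have "norm (poly (pderiv (B n)) (snd y) * (c n * poly (A n) (fst y))) \<le> M n / (R' - R)"
        using M(2)[of "fst y" _ n] ny R' by (intro cauchy) (auto simp: mult_ac)
      then show "norm (b n y) \<le> M n / (R' - R)" by (simp add: b_def mult_ac)
    qed
    have sM: "summable (\<lambda>n. M n / (R' - R))" using M(1) by (rule summable_divide)
    have ua: "uniform_limit S (\<lambda>n x. \<Sum>i<n. a i x) (\<lambda>x. \<Sum>i. a i x) sequentially"
      and ub: "uniform_limit S (\<lambda>n x. \<Sum>i<n. b i x) (\<lambda>x. \<Sum>i. b i x) sequentially"
      by (rule Weierstrass_m_test[OF _ sM], use ab in blast)+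
    have sf: "summable (\<lambda>n. f n y)" if y: "y \<in> S" for y
      by (rule summable_comparison_test'[OF M(1), of 0])
         (use M(2)[of "fst y" "snd y"] y R' in \<open>auto simp: S_def f_def\<close>)
    have "\<exists>g. \<forall>y\<in>S. (\<lambda>n. f n y) sums g y \<and> (g has_derivative (\<lambda>h. (\<Sum>i. a i y) * fst h + (\<Sum>i. b i y) * snd h)) (at y within S)"
    proof (rule has_derivative_series[OF S(1)])
      show "(f n has_derivative (\<lambda>h. a n y * fst h + b n y * snd h)) (at y within S)" for n y
      proof -
        have dp: "((\<lambda>x. poly p (g x)) has_derivative (\<lambda>h. poly (pderiv p) (g y) * g' h)) (at y within S)"
          if "(g has_derivative g') (at y within S)" for p :: "complex poly" and g g'
          using has_derivative_compose[OF that, of "poly p" "(*) (poly (pderiv p) (g y))"] poly_DERIV[of p "g y"]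
          by (simp add: has_field_derivative_def)
        show ?thesis
          unfolding f_def a_def b_def
          by (rule derivative_eq_intros dp refl)+ (auto simp: algebra_simps)
      qed
      show "x \<in> S" by fact
      show "(\<lambda>n. f n x) sums (\<Sum>n. f n x)" using sf[OF S(3)] by (rule summable_sums)
      fix e :: real assume e: "e > 0"
      have "\<forall>\<^sub>F n in sequentially. (\<forall>y\<in>S. dist (\<Sum>i<n. a i y) (\<Sum>i. a i y) < e / 2) \<and> (\<forall>y\<in>S. dist (\<Sum>i<n. b i y) (\<Sum>i. b i y) < e / 2)"
        using uniform_limitD[OF ua, of "e / 2"] uniform_limitD[OF ub, of "e / 2"] e by (intro eventually_conj) auto
      then show "\<forall>\<^sub>F n in sequentially. \<forall>y\<in>S. \<forall>h. norm ((\<Sum>i<n. a i y * fst h + b i y * snd h) - ((\<Sum>i. a i y) * fst h + (\<Sum>i. b i y) * snd h)) \<le> e * norm h"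
      proof (eventually_elim, intro ballI allI)
        fix n y h assume n: "(\<forall>y\<in>S. dist (\<Sum>i<n. a i y) (\<Sum>i. a i y) < e / 2) \<and> (\<forall>y\<in>S. dist (\<Sum>i<n. b i y) (\<Sum>i. b i y) < e / 2)" and y: "y \<in> S"
        have "(\<Sum>i<n. a i y * fst h + b i y * snd h) - ((\<Sum>i. a i y) * fst h + (\<Sum>i. b i y) * snd h)
          = ((\<Sum>i<n. a i y) - (\<Sum>i. a i y)) * fst h + ((\<Sum>i<n. b i y) - (\<Sum>i. b i y)) * snd h"
          unfolding sum.distrib sum_distrib_right[symmetric] by (simp add: algebra_simps)
        also have "norm \<dots> \<le> norm ((\<Sum>i<n. a i y) - (\<Sum>i. a i y)) * norm (fst h) + norm ((\<Sum>i<n. b i y) - (\<Sum>i. b i y)) * norm (snd h)"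
          unfolding norm_mult[symmetric] by (rule norm_triangle_ineq)
        also have "\<dots> \<le> e / 2 * norm h + e / 2 * norm h"
          using n y e norm_fst_le[of "fst h" "snd h"] norm_snd_le[of "snd h" "fst h"]
          by (intro add_mono mult_mono) (auto simp: dist_norm less_imp_le)
        finally show "norm ((\<Sum>i<n. a i y * fst h + b i y * snd h) - ((\<Sum>i. a i y) * fst h + (\<Sum>i. b i y) * snd h)) \<le> e * norm h"
          by simp
      qed
    qed
    then obtain g where g: "\<And>y. y \<in> S \<Longrightarrow> (\<lambda>n. f n y) sums g y"
      "\<And>y. y \<in> S \<Longrightarrow> (g has_derivative (\<lambda>h. (\<Sum>i. a i y) * fst h + (\<Sum>i. b i y) * snd h)) (at y within S)" by blast
    have "(g has_derivative (\<lambda>h. (\<Sum>i. a i x) * fst h + (\<Sum>i. b i x) * snd h)) (at x)"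
      using g(2)[OF S(3)] at_within_open[OF S(3,2)] by simp
    then have "((\<lambda>x. \<Sum>n. f n x) has_derivative (\<lambda>h. (\<Sum>i. a i x) * fst h + (\<Sum>i. b i x) * snd h)) (at x)"
      by (rule has_derivative_transform_within_open[OF _ S(2,3)]) (use g(1) in \<open>auto simp: sums_iff\<close>)
    with sf[OF S(3)] show ?thesis by blast
  qed
  show "(\<lambda>x. \<Sum>n. c n * poly (A n) (fst x) * poly (B n) (snd x)) holomorphic2_on bidisc"
    unfolding holomorphic2_on_def f_def[symmetric] using key has_derivative_at_withinI by blast
  show "x \<in> bidisc \<Longrightarrow> summable (\<lambda>n. c n * poly (A n) (fst x) * poly (B n) (snd x))"
    unfolding f_def[symmetric] using key by blast
qed

definition wt :: "complex \<times> complex \<Rightarrow> real" where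
  "wt x = (1 - (norm (fst x))\<^sup>2) * (1 - (norm (snd x))\<^sup>2)"

lemma wt_bounds:
  assumes "x \<in> bidisc"
  shows "0 < wt x" "wt x \<le> 1"
proof -
  have "0 < 1 - (norm (fst x))\<^sup>2" "0 < 1 - (norm (snd x))\<^sup>2"
    using assms by (auto simp: bidisc_def power_less_one_iff abs_square_less_1)
  then show "0 < wt x" "wt x \<le> 1"
    by (auto simp: wt_def intro!: mult_le_one)
qed

lemma T_op_eq:
  assumes "range \<Lambda> \<subseteq> bidisc"
  shows "T_op p \<Lambda> f n = f (\<Lambda> n) * of_real (wt (\<Lambda> n) powr (1 / p))"
proof -
  have "\<Lambda> n \<in> bidisc" using assms by auto
  then have "0 \<le> 1 - (norm (fst (\<Lambda> n)))\<^sup>2" "0 \<le> 1 - (norm (snd (\<Lambda> n)))\<^sup>2"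
    by (auto simp: bidisc_def power_le_one less_imp_le)
  then show ?thesis by (simp add: T_op_def wt_def powr_mult)
qed

text \<open>For each r the partial sums are bounded in L^p on the torus by interpolation, with a
  bound \<open>Q\<close> independent of their length and of r. They converge pointwise, because the
  dilated torus lies inside the bidisc, and Fatou's lemma passes the bound to the limit.\<close>

lemma Hardy_of_series:
  fixes A B :: "nat \<Rightarrow> complex poly" and c :: "nat \<Rightarrow> complex"
  assumes p: "1 \<le> p" "p \<le> 2" and C: "C \<ge> 0" and w: "\<And>n. w n \<ge> 0"
    and conv: "\<And>R. 0 < R \<Longrightarrow> R < 1 \<Longrightarrow> \<exists>M. summable M \<and>
       (\<forall>n z w. norm z \<le> R \<longrightarrow> norm w \<le> R \<longrightarrow> norm (c n * poly (A n) z * poly (B n) w) \<le> M n)"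
    and L1: "\<And>r n. 0 < r \<Longrightarrow> r < 1 \<Longrightarrow>
       (\<integral>\<^sup>+ x. ennreal (norm (poly (A n) (of_real r * fst x) * poly (B n) (of_real r * snd x))) \<partial>torus_haar) \<le> ennreal (C * w n)"
    and L2: "\<And>r F g. 0 < r \<Longrightarrow> r < 1 \<Longrightarrow> finite F \<Longrightarrow>
       (\<integral>\<^sup>+ x. ennreal ((norm (\<Sum>n\<in>F. g n * (poly (A n) (of_real r * fst x) * poly (B n) (of_real r * snd x))))\<^sup>2) \<partial>torus_haar)
         \<le> ennreal (C * (\<Sum>n\<in>F. (norm (g n))\<^sup>2 * w n))"
    and sum: "summable (\<lambda>n. norm (c n) powr p * w n)"
  shows "(\<lambda>x. \<Sum>n. c n * poly (A n) (fst x) * poly (B n) (snd x)) \<in> Hardy p"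
proof -
  define f where "f x = (\<Sum>n. c n * poly (A n) (fst x) * poly (B n) (snd x))" for x
  define Q where "Q = C * interpolation_const p * (\<Sum>n. norm (c n) powr p * w n)"
  have bd: "(\<integral>\<^sup>+ z. ennreal (norm (f (r *\<^sub>R z)) powr p) \<partial>torus_haar) \<le> ennreal Q" if r: "0 < r" "r < 1" for r
  proof -
    define u where "u n x = poly (A n) (of_real r * fst x) * poly (B n) (of_real r * snd x)" for n and x :: "complex \<times> complex"
    define S where "S m x = (\<Sum>n<m. c n * u n x)" for m x
    have mu: "u n \<in> borel_measurable torus_haar" for n
      unfolding u_def by (intro measurable_torus borel_measurable_continuous_onI continuous_intros)
    then have mS: "(\<lambda>x. ennreal (norm (S m x) powr p)) \<in> borel_measurable torus_haar" for m
      unfolding S_def by measurable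
    have S: "(\<integral>\<^sup>+ x. ennreal (norm (S m x) powr p) \<partial>torus_haar) \<le> ennreal Q" for m
    proof -
      have "(\<integral>\<^sup>+ x. ennreal (norm (S m x) powr p) \<partial>torus_haar)
         \<le> ennreal (C * interpolation_const p * (\<Sum>n<m. norm (c n) powr p * w n))"
        unfolding S_def
        by (rule strong_type_interpolation[OF p C w mu])
           (use L1[OF r] L2[OF r] in \<open>auto simp: u_def\<close>)
      also have "\<dots> \<le> ennreal Q"
        unfolding Q_def using interpolation_const_ge_1[OF p] C w
        by (intro ennreal_leI mult_left_mono sum_le_suminf sum mult_nonneg_nonneg) auto
      finally show ?thesis .
    qed
    have lim: "(\<lambda>m. ennreal (norm (S m x) powr p)) \<longlonglongrightarrow> ennreal (norm (f (r *\<^sub>R x)) powr p)" if x: "x \<in> space torus_haar" for x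
    proof -
      have "r *\<^sub>R x \<in> bidisc"
        using x r by (auto simp: space_torus bidisc_def mem_Times_iff)
      from holomorphic2_product_series(2)[OF conv this]
      have "(\<lambda>n. c n * u n x) sums f (r *\<^sub>R x)"
        by (simp add: u_def f_def scaleR_conv_of_real mult.assoc summable_sums)
      then have "(\<lambda>m. S m x) \<longlonglongrightarrow> f (r *\<^sub>R x)" by (simp add: S_def sums_def)
      then show ?thesis using p by (intro tendsto_intros tendsto_ennrealI tendsto_powr') auto
    qed
    have "(\<integral>\<^sup>+ x. ennreal (norm (f (r *\<^sub>R x)) powr p) \<partial>torus_haar)
       = (\<integral>\<^sup>+ x. liminf (\<lambda>m. ennreal (norm (S m x) powr p)) \<partial>torus_haar)"
      by (intro nn_integral_cong) (metis lim lim_imp_Liminf trivial_limit_sequentially)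
    also have "\<dots> \<le> liminf (\<lambda>m. \<integral>\<^sup>+ x. ennreal (norm (S m x) powr p) \<partial>torus_haar)"
      by (rule nn_integral_liminf[OF mS])
    also have "\<dots> \<le> limsup (\<lambda>m. \<integral>\<^sup>+ x. ennreal (norm (S m x) powr p) \<partial>torus_haar)"
      by (rule Liminf_le_Limsup) simp
    also have "\<dots> \<le> ennreal Q"
      by (rule Limsup_bounded) (simp add: S)
    finally show ?thesis .
  qed
  have "(SUP r\<in>{0<..<1}. \<integral>\<^sup>+ z. ennreal (norm (f (r *\<^sub>R z)) powr p) \<partial>torus_haar) \<le> ennreal Q"
    using bd by (intro SUP_least) auto
  then have "(SUP r\<in>{0<..<1}. \<integral>\<^sup>+ z. ennreal (norm (f (r *\<^sub>R z)) powr p) \<partial>torus_haar) < \<infinity>"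
    by (rule le_less_trans) simp
  moreover have "f holomorphic2_on bidisc"
    unfolding f_def by (rule holomorphic2_product_series(1)[OF conv])
  ultimately have "f \<in> Hardy p" by (simp add: Hardy_def)
  then show ?thesis unfolding f_def .
qed

lemma powr_add_le_4:
  fixes x y :: real
  assumes "0 \<le> x" "0 \<le> y" "0 \<le> p" "p \<le> 2"
  shows "(x + y) powr p \<le> 4 * (x powr p + y powr p)"
proof -
  have "(x + y) powr p \<le> (2 * max x y) powr p" using assms by (intro powr_mono2) auto
  also have "\<dots> = 2 powr p * max x y powr p" using assms by (simp add: powr_mult)
  also have "\<dots> \<le> 4 * max x y powr p" using powr_mono[of p 2 2] assms by (intro mult_right_mono) auto
  also have "\<dots> \<le> 4 * (x powr p + y powr p)" by (auto simp: max_def)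
  finally show ?thesis .
qed

text \<open>For f the sum of \<open>h n / v n * E n\<close>, where \<open>v n\<close> is the p-th
  root of the weight, the equation \<open>T_op p \<Lambda> f = a\<close> becomes (1 + K) h = a. It
  is solved in l^\<infinity>, where only row sums matter, and h is shown to lie in l^p afterwards.
  Dividing by the full weight in the off-diagonal hypothesis makes it independent of p: weights are
  at most 1, so they are at most their p-th roots.\<close>

proposition simply_interpolating_criterion:
  fixes A B :: "nat \<Rightarrow> complex poly" and \<Lambda> :: "nat \<Rightarrow> complex \<times> complex" and \<beta> :: "nat \<Rightarrow> real"
  defines "E \<equiv> \<lambda>n x. poly (A n) (fst x) * poly (B n) (snd x)"
  assumes \<Lambda>: "range \<Lambda> \<subseteq> bidisc"
    and diag: "\<And>n. E n (\<Lambda> n) = 1"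
    and off: "\<And>k F. finite F \<Longrightarrow> k \<notin> F \<Longrightarrow> (\<Sum>n\<in>F. norm (E n (\<Lambda> k)) / wt (\<Lambda> n)) \<le> \<beta> k"
    and \<beta>: "\<And>k. \<beta> k \<le> 1 / 2"
    and sum\<beta>: "\<And>F. finite F \<Longrightarrow> (\<Sum>n\<in>F. wt (\<Lambda> n) * \<beta> n) \<le> D"
    and inner: "\<And>R. 0 < R \<Longrightarrow> R < 1 \<Longrightarrow> \<exists>M. summable M \<and>
       (\<forall>n z w. norm z \<le> R \<longrightarrow> norm w \<le> R \<longrightarrow> norm (E n (z, w)) \<le> wt (\<Lambda> n) * M n)"
    and C: "C \<ge> 0"
    and L1: "\<And>r n. 0 < r \<Longrightarrow> r < 1 \<Longrightarrow>
       (\<integral>\<^sup>+ x. ennreal (norm (E n (r *\<^sub>R x))) \<partial>torus_haar) \<le> ennreal (C * wt (\<Lambda> n))"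
    and L2: "\<And>r F g. 0 < r \<Longrightarrow> r < 1 \<Longrightarrow> finite F \<Longrightarrow>
       (\<integral>\<^sup>+ x. ennreal ((norm (\<Sum>n\<in>F. g n * E n (r *\<^sub>R x)))\<^sup>2) \<partial>torus_haar)
         \<le> ennreal (C * (\<Sum>n\<in>F. (norm (g n))\<^sup>2 * wt (\<Lambda> n)))"
    and p: "1 \<le> p" "p \<le> 2"
  shows "simply_interpolating p \<Lambda>"
proof -
  define w where "w n = wt (\<Lambda> n)" for n
  have w: "0 < w n" "w n \<le> 1" for n using wt_bounds[of "\<Lambda> n"] \<Lambda> by (auto simp: w_def)
  define v where "v n = w n powr (1 / p)" for n
  have v: "0 < v n" "v n \<le> 1" "w n \<le> v n" "v n powr p = w n" for n
  proof -
    show "0 < v n" "v n \<le> 1" using w[of n] p by (auto simp: v_def powr_le1)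
    show "w n \<le> v n" using powr_mono'[of "1 / p" 1 "w n"] w[of n] p by (simp add: v_def)
    show "v n powr p = w n" using w[of n] p by (simp add: v_def powr_powr)
  qed
  have \<beta>0: "0 \<le> \<beta> k" for k using off[of "{}" k] by simp
  have "a \<in> T_op p \<Lambda> ` Hardy p" if a: "a \<in> ell p" for a
  proof -
    have sa: "summable (\<lambda>n. norm (a n) powr p)" using a by (simp add: ell_def)
    have "norm (a k) \<le> 1 + (\<Sum>n. norm (a n) powr p)" for k
    proof -
      have "norm (a k) \<le> 1 + norm (a k) powr p"
      proof (cases "norm (a k) \<le> 1")
        case True then show ?thesis using powr_ge_zero[of "norm (a k)" p] by linarith
      next
        case False
        then have "norm (a k) powr 1 \<le> norm (a k) powr p" using p by (intro powr_mono) auto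
        then show ?thesis using False by simp
      qed
      also have "norm (a k) powr p \<le> (\<Sum>n. norm (a n) powr p)"
        using sum_le_suminf[OF sa, of "{k}"] by simp
      finally show ?thesis by simp
    qed
    note a_bd = this
    define K where "K k n = (if n = k then 0 else E n (\<Lambda> k) * of_real (v k / v n))" for k n
    have K: "(\<Sum>n\<in>F. norm (K k n)) \<le> v k * \<beta> k" if F: "finite F" for k F
    proof -
      have "(\<Sum>n\<in>F. norm (K k n)) = (\<Sum>n\<in>F - {k}. norm (K k n))"
        using F by (intro sum.mono_neutral_right) (auto simp: K_def)
      also have "\<dots> \<le> (\<Sum>n\<in>F - {k}. v k * (norm (E n (\<Lambda> k)) / w n))"
      proof (rule sum_mono)
        fix n assume "n \<in> F - {k}"
        then have "norm (K k n) = v k * (norm (E n (\<Lambda> k)) / v n)"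
          using v(1)[of k] v(1)[of n] by (simp add: K_def norm_mult norm_divide)
        also have "\<dots> \<le> v k * (norm (E n (\<Lambda> k)) / w n)"
          using v(1)[of k] v(3)[of n] w(1)[of n] v(1)[of n] by (intro mult_left_mono divide_left_mono) auto
        finally show "norm (K k n) \<le> v k * (norm (E n (\<Lambda> k)) / w n)" .
      qed
      also have "\<dots> = v k * (\<Sum>n\<in>F - {k}. norm (E n (\<Lambda> k)) / w n)" by (simp add: sum_distrib_left)
      also have "\<dots> \<le> v k * \<beta> k"
        using off[of "F - {k}" k] F v(1)[of k] by (intro mult_left_mono) (auto simp: w_def)
      finally show ?thesis .
    qed
    have v\<beta>: "v k * \<beta> k \<le> 1 / 2" for k
      using mult_mono[OF v(2)[of k] \<beta>[of k]] v(1)[of k] \<beta>0[of k] by simp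
    obtain h H where h: "\<And>k. norm (h k) \<le> H" "\<And>k. h k + (\<Sum>n. K k n * h n) = a k"
      using small_matrix_solvable[of K a, OF order.trans[OF K v\<beta>] a_bd] by metis
    have H: "H \<ge> 0" using h(1)[of 0] norm_ge_zero order.trans by blast
    have sK: "summable (\<lambda>n. norm (K k n))" for k
      by (rule summableI_nonneg_bounded[where x = "v k * \<beta> k"], simp, rule K, simp)
    have sKh: "summable (\<lambda>n. norm (K k n * h n))" and Kh: "norm (\<Sum>n. K k n * h n) \<le> v k * \<beta> k * H" for k
    proof -
      have le: "norm (K k n * h n) \<le> norm (K k n) * H" for n
        unfolding norm_mult by (intro mult_left_mono h) auto
      have s: "summable (\<lambda>n. norm (K k n) * H)" by (rule summable_mult2[OF sK])
      show sn: "summable (\<lambda>n. norm (K k n * h n))"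
        by (rule summable_comparison_test'[OF s, of 0]) (use le in simp)
      have "norm (\<Sum>n. K k n * h n) \<le> (\<Sum>n. norm (K k n * h n))" by (rule summable_norm[OF sn])
      also have "\<dots> \<le> (\<Sum>n. norm (K k n) * H)" by (rule suminf_le[OF le sn s])
      also have "\<dots> = (\<Sum>n. norm (K k n)) * H" using suminf_mult2[OF sK, where c = H] by simp
      also have "\<dots> \<le> v k * \<beta> k * H"
        by (intro mult_right_mono H suminf_le_const[OF sK] K) simp
      finally show "norm (\<Sum>n. K k n * h n) \<le> v k * \<beta> k * H" .
    qed
    have sw\<beta>: "summable (\<lambda>k. w k * \<beta> k)"
    proof (rule summableI_nonneg_bounded[where x = D])
      show "0 \<le> w k * \<beta> k" for k using w(1)[of k] \<beta>0[of k] by simp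
      show "(\<Sum>i<n. w i * \<beta> i) \<le> D" for n using sum\<beta>[of "{..<n}"] by (simp add: w_def)
    qed
    \<comment> \<open>Passage from l^\<infinity> to l^p. The correction to a k is at most v k *
      \<beta> k * H, and its p-th power is at most H^p * w k * \<beta> k, since the p-th power of v
      is w and \<beta> is at most 1. In the application the weights alone have a divergent sum, so
      the decay of \<beta> is essential here.\<close>
    have sh: "summable (\<lambda>k. norm (h k) powr p)"
    proof (rule summable_comparison_test'[where N = 0])
      show "summable (\<lambda>k. 4 * (norm (a k) powr p + H powr p * (w k * \<beta> k)))"
        by (intro summable_mult summable_add sa sw\<beta>)
      fix k :: nat
      have "h k = a k - (\<Sum>n. K k n * h n)" using h(2)[of k] by (simp add: algebra_simps)
      then have "norm (h k) \<le> norm (a k) + v k * \<beta> k * H"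
        using norm_triangle_ineq4[of "a k" "\<Sum>n. K k n * h n"] Kh[of k] by simp
      then have "norm (h k) powr p \<le> (norm (a k) + v k * \<beta> k * H) powr p"
        using p by (intro powr_mono2) auto
      also have "\<dots> \<le> 4 * (norm (a k) powr p + (v k * \<beta> k * H) powr p)"
        using p v(1)[of k] \<beta>0[of k] H by (intro powr_add_le_4) auto
      also have "(v k * \<beta> k * H) powr p = H powr p * (w k * \<beta> k powr p)"
        using v[of k] \<beta>0[of k] H by (simp add: powr_mult)
      also have "\<dots> \<le> H powr p * (w k * \<beta> k)"
        using powr_mono'[of 1 p "\<beta> k"] p \<beta>0[of k] \<beta>[of k] w(1)[of k] by (intro mult_left_mono) auto
      finally show "norm (norm (h k) powr p) \<le> 4 * (norm (a k) powr p + H powr p * (w k * \<beta> k))" by simp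
    qed
    define c where "c n = h n / of_real (v n)" for n
    have conv: "\<exists>M. summable M \<and> (\<forall>n z w. norm z \<le> R \<longrightarrow> norm w \<le> R \<longrightarrow> norm (c n * poly (A n) z * poly (B n) w) \<le> M n)"
      if R: "0 < R" "R < 1" for R
    proof -
      obtain M where M: "summable M" "\<And>n z x. norm z \<le> R \<Longrightarrow> norm x \<le> R \<Longrightarrow> norm (E n (z, x)) \<le> w n * M n"
        using inner[OF R] by (auto simp: w_def)
      have "norm (c n * poly (A n) z * poly (B n) x) \<le> H * M n" if "norm z \<le> R" "norm x \<le> R" for n z x
      proof -
        have "norm (c n) \<le> H / v n" using h(1)[of n] v(1)[of n] by (simp add: c_def norm_divide divide_right_mono)
        also have "\<dots> \<le> H / w n" using v(3)[of n] v(1)[of n] w(1)[of n] H by (intro divide_left_mono) auto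
        finally have "norm (c n) * norm (E n (z, x)) \<le> H / w n * (w n * M n)"
          using M(2)[OF that] H w(1)[of n] by (intro mult_mono) auto
        then show ?thesis using w(1)[of n] by (simp add: E_def norm_mult mult.assoc)
      qed
      then show ?thesis using summable_mult[OF M(1), of H] by blast
    qed
    define f where "f x = (\<Sum>n. c n * poly (A n) (fst x) * poly (B n) (snd x))" for x
    have "f \<in> Hardy p"
      unfolding f_def
    proof (rule Hardy_of_series[OF p C _ conv, of w])
      show "summable (\<lambda>n. norm (c n) powr p * w n)"
      proof -
        have "norm (c n) powr p * w n = norm (h n) powr p" for n
          using v(1)[of n] v(4)[of n] w(1)[of n] by (simp add: c_def norm_divide powr_divide)
        then show ?thesis using sh by simp
      qed
    qed (use w L1 L2 in \<open>auto simp: E_def w_def scaleR_conv_of_real less_imp_le\<close>)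
    moreover have "T_op p \<Lambda> f = a"
    proof
      fix k
      have "\<Lambda> k \<in> bidisc" using \<Lambda> by auto
      from summable_sums[OF holomorphic2_product_series(2)[OF conv this]]
      have "(\<lambda>n. c n * E n (\<Lambda> k)) sums f (\<Lambda> k)" by (simp add: E_def f_def mult.assoc)
      then have 1: "(\<lambda>n. c n * E n (\<Lambda> k) * of_real (v k)) sums (f (\<Lambda> k) * of_real (v k))" by (rule sums_mult2)
      have "(\<lambda>n. K k n * h n) sums (\<Sum>n. K k n * h n)"
        using summable_norm_cancel[OF sKh] by (rule summable_sums)
      moreover have "(\<lambda>n. if n = k then h n else 0) sums h k" by (rule sums_single)
      ultimately have "(\<lambda>n. K k n * h n + (if n = k then h n else 0)) sums ((\<Sum>n. K k n * h n) + h k)"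
        by (rule sums_add)
      also have "(\<lambda>n. K k n * h n + (if n = k then h n else 0)) = (\<lambda>n. c n * E n (\<Lambda> k) * of_real (v k))"
        using v(1) diag by (auto simp: fun_eq_iff K_def c_def field_simps less_imp_neq[symmetric])
      finally have "f (\<Lambda> k) * of_real (v k) = a k"
        using 1 h(2)[of k] by (simp add: sums_unique2 add.commute)
      then show "T_op p \<Lambda> f k = a k"
        by (simp add: T_op_eq[OF \<Lambda>] v_def w_def)
    qed
    ultimately show ?thesis by blast
  qed
  then show ?thesis by (auto simp: simply_interpolating_def)
qed

section \<open>The blocks of points\<close>

lemma norm_one_minus_cis_le: "norm (1 - cis t) \<le> \<bar>t\<bar>"
proof -
  have "(norm (1 - cis t))\<^sup>2 = (1 - cos t)\<^sup>2 + (sin t)\<^sup>2"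
    by (simp add: cmod_def)
  also have "\<dots> = 2 - 2 * cos t"
    using sin_cos_squared_add[of t] by (simp add: power2_eq_square algebra_simps)
  also have "\<dots> = (2 * sin (t / 2))\<^sup>2"
    using cos_double_sin[of "t / 2"] by (simp add: power_mult_distrib)
  also have "\<dots> \<le> t\<^sup>2"
    using abs_sin_x_le_abs_x[of "t / 2"] by (subst abs_le_square_iff[symmetric]) simp
  finally show ?thesis
    using abs_le_square_iff[of "norm (1 - cis t)" t] by simp
qed

lemma rad_power_le_exp:
  assumes "P \<ge> 2"
  shows "rad P ^ (2 * L) \<le> exp (- (2 * real L / real P))"
proof -
  have "rad P \<le> exp (- (1 / real P))"
    using exp_ge_add_one_self[of "- (1 / real P)"] by (simp add: rad_def)
  then have "rad P ^ (2 * L) \<le> exp (- (1 / real P)) ^ (2 * L)"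
    using rad_pos[OF assms] by (intro power_mono) auto
  also have "\<dots> = exp (- (2 * real L / real P))"
    by (simp add: exp_of_nat_mult[symmetric])
  finally show ?thesis .
qed

lemma norm_node: "L \<ge> 2 \<Longrightarrow> norm (node L j) = rad L"
  using rad_pos[of L] by (simp add: node_def norm_mult)

text \<open>The d-th power of the node has argument pi j / (2 q), which lies between pi / 2 and 3 pi
  / 2, so its real part is not positive. The node itself has that argument divided by d, hence at
  most 5 / d, and its distance 1 / L to the circle is at most 1 / d.\<close>

lemma node_sector:
  assumes "L = 4 * d * q" "d > 0" "q > 0" "q \<le> j" "j < 3 * q"
  shows "norm (1 - node L j ^ d) \<ge> 1" "norm (1 - node L j) \<le> 6 / d"
proof -
  have L2: "L \<ge> 2" using assms by (cases q; cases d) auto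
  have r: "0 < rad L" "rad L < 1" using rad_pos[OF L2] rad_less_1[OF L2] by auto
  define t where "t = pi * (real j / (2 * q))"
  have arg: "2 * pi * j / L * d = t" using assms by (simp add: t_def field_simps)
  have "node L j ^ d = of_real (rad L ^ d) * cis t"
  proof -
    have "cis (2 * pi * j / L) ^ d = cis t"
      unfolding Complex.DeMoivre arg[symmetric] by (simp only: mult.commute)
    then show ?thesis by (simp only: node_def power_mult_distrib of_real_power)
  qed
  then have re: "Re (node L j ^ d) = rad L ^ d * cos t" by simp
  have "1 / 2 \<le> real j / (2 * q)" "real j / (2 * q) < 3 / 2" using assms by (auto simp: field_simps)
  then have "pi * (1 / 2) \<le> t" "t \<le> pi * (3 / 2)" unfolding t_def by (intro mult_left_mono; simp)+
  then have "cos (t - pi) \<ge> 0" by (intro cos_ge_zero) auto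
  then have "cos t \<le> 0" by (simp add: cos_diff)
  then have "Re (node L j ^ d) \<le> 0" unfolding re using r by (intro mult_nonneg_nonpos) auto
  then have "1 \<le> Re (1 - node L j ^ d)" by simp
  also have "\<dots> \<le> norm (1 - node L j ^ d)" by (rule complex_Re_le_cmod)
  finally show "norm (1 - node L j ^ d) \<ge> 1" .
  have "norm (1 - node L j) \<le> norm (complex_of_real (1 - rad L)) + norm (rad L * (1 - cis (2 * pi * j / L)))"
    using norm_triangle_ineq[of "complex_of_real (1 - rad L)" "rad L * (1 - cis (2 * pi * j / L))"]
    by (simp add: node_def algebra_simps)
  also have "\<dots> \<le> 1 / L + 1 * \<bar>2 * pi * j / L\<bar>"
    unfolding norm_mult norm_of_real
    by (intro add_mono mult_mono norm_one_minus_cis_le) (use r in \<open>auto simp: rad_def\<close>)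
  also have "\<dots> = 1 / L + t / d"
    using arg assms(2) by (simp add: field_simps)
  also have "\<dots> \<le> 1 / d + 5 / d"
  proof (rule add_mono)
    have "d \<le> L" using assms by simp
    then show "1 / real L \<le> 1 / d" using assms by (intro divide_left_mono) auto
    have "pi \<le> 3.2" using pi_approx(2) by simp
    then have "t \<le> 5" using \<open>t \<le> pi * (3 / 2)\<close> by simp
    then show "t / d \<le> 5 / d" by (intro divide_right_mono) auto
  qed
  also have "\<dots> = 6 / d" by simp
  finally show "norm (1 - node L j) \<le> 6 / d" .
qed

text \<open>A point is indexed by \<open>((N, i), j, k)\<close>: block \<open>N\<close>, shape \<open>i\<close>, grid indices \<open>j\<close> and \<open>k\<close>. The range
  \<open>q \<le> j < 3 q\<close> is the quarter turn to three quarter turn of \<open>z ^ d\<close>, so that \<open>1 - z ^ d\<close> has modulus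
  at least \<open>1\<close> there. \<open>W N\<close> is the number of nodes of each full grid of block \<open>N\<close>, and its reciprocal
  is comparable to the weight of each point.\<close>

locale blocks =
  fixes d B :: "nat \<Rightarrow> nat" and W :: "nat \<Rightarrow> nat"
  defines "W \<equiv> \<lambda>N. B N ^ (d N + 1)"
  assumes d_pos: "d N > 0" and B_pos: "B N > 0" and dvd: "4 * d N dvd B N"
    and grow: "N < N' \<Longrightarrow> 2 ^ 21 * 4 ^ N' * (W N)\<^sup>2 * d N \<le> d N'"
    and small: "(real (W N))\<^sup>2 * 2 ^ 17 * exp (- (2 * real (B N) / d N)) \<le> 1 / (8 * 2 ^ N)"
begin

definition Lz :: "nat \<times> nat \<Rightarrow> nat" where "Lz s = B (fst s) ^ (snd s + 1)"
definition Lw :: "nat \<times> nat \<Rightarrow> nat" where "Lw s = B (fst s) ^ (d (fst s) - snd s)"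
definition q :: "nat \<times> nat \<Rightarrow> nat" where "q s = Lz s div (4 * d (fst s))"
definition I :: "((nat \<times> nat) \<times> nat \<times> nat) set" where
  "I = {(s, j, k). snd s < d (fst s) \<and> q s \<le> j \<and> j < 3 * q s \<and> k < Lw s}"
definition pt :: "(nat \<times> nat) \<times> nat \<times> nat \<Rightarrow> complex \<times> complex" where
  "pt n = (case n of (s, j, k) \<Rightarrow> (node (Lz s) j, node (Lw s) k))"
definition Az :: "(nat \<times> nat) \<times> nat \<times> nat \<Rightarrow> complex poly" where
  "Az n = (case n of (s, j, k) \<Rightarrow> zfun (d (fst s)) (Lz s) j)"
definition Bw :: "(nat \<times> nat) \<times> nat \<times> nat \<Rightarrow> complex poly" where
  "Bw n = (case n of (s, j, k) \<Rightarrow> wfun (Lw s) k)"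
definition En :: "(nat \<times> nat) \<times> nat \<times> nat \<Rightarrow> complex \<times> complex \<Rightarrow> complex" where
  "En n x = poly (Az n) (fst x) * poly (Bw n) (snd x)"
definition blk :: "(nat \<times> nat) \<times> nat \<times> nat \<Rightarrow> nat" where "blk n = fst (fst n)"

lemma B_ge: "B N \<ge> 4 * d N" "B N \<ge> 4" "even (B N)"
proof -
  show "B N \<ge> 4 * d N" using dvd B_pos by (rule dvd_imp_le)
  then show "B N \<ge> 4" using d_pos[of N] by linarith
  have "2 dvd 4 * d N" by simp
  then show "even (B N)" using dvd dvd_trans by blast
qed

lemma B_power_ge: "m > 0 \<Longrightarrow> B N \<le> B N ^ m"
  using B_ge(2)[of N] self_le_power[of "B N" m] by simp

lemma L_facts:
  assumes "snd s < d (fst s)"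
  shows "B (fst s) \<le> Lz s" "even (Lz s)" "Lz s \<ge> 2" "B (fst s) \<le> Lw s" "even (Lw s)" "Lw s \<ge> 2"
    "Lz s * Lw s = W (fst s)" "Lz s = 4 * d (fst s) * q s" "q s > 0" "Lz s \<le> W (fst s)" "Lw s \<le> W (fst s)"
proof -
  show 1: "B (fst s) \<le> Lz s" "B (fst s) \<le> Lw s"
    unfolding Lz_def Lw_def using assms by (auto intro!: B_power_ge)
  then show 2: "Lz s \<ge> 2" "Lw s \<ge> 2" using B_ge(2)[of "fst s"] by linarith+
  show "even (Lz s)" "even (Lw s)" using B_ge(3)[of "fst s"] assms by (auto simp: Lz_def Lw_def)
  show 3: "Lz s * Lw s = W (fst s)"
    unfolding Lz_def Lw_def W_def power_add[symmetric] using assms by simp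
  have "4 * d (fst s) dvd Lz s" unfolding Lz_def using dvd[of "fst s"] by (simp add: dvd_mult2)
  then show 4: "Lz s = 4 * d (fst s) * q s" unfolding q_def by simp
  then show "q s > 0" using 2 by (cases "q s") auto
  show "Lz s \<le> W (fst s)" "Lw s \<le> W (fst s)" using 2 by (auto simp: 3[symmetric])
qed

lemma W_pos: "W N > 0" using B_pos by (simp add: W_def)

lemma I_D:
  assumes "(s, j, k) \<in> I"
  shows "snd s < d (fst s)" "j < Lz s" "k < Lw s" "norm (1 - node (Lz s) j ^ d (fst s)) \<ge> 1"
    "norm (1 - node (Lz s) j) \<le> 6 / d (fst s)"
proof -
  show s: "snd s < d (fst s)" and "k < Lw s" using assms by (auto simp: I_def)
  have j: "q s \<le> j" "j < 3 * q s" using assms by (auto simp: I_def)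
  have "3 * q s \<le> 4 * d (fst s) * q s" using d_pos[of "fst s"] by simp
  then show "j < Lz s" using j L_facts(8)[OF s] by linarith
  show "norm (1 - node (Lz s) j ^ d (fst s)) \<ge> 1" "norm (1 - node (Lz s) j) \<le> 6 / d (fst s)"
    using node_sector[OF L_facts(8)[OF s] d_pos L_facts(9)[OF s] j] by auto
qed

lemma pt_bidisc: "n \<in> I \<Longrightarrow> pt n \<in> bidisc"
  by (cases n) (auto simp: pt_def bidisc_def norm_node L_facts(3,6) rad_less_1 dest!: I_D(1))

lemma wt_pt:
  assumes "n \<in> I"
  shows "1 / W (blk n) \<le> wt (pt n)" "wt (pt n) \<le> 4 / W (blk n)"
proof -
  obtain s j k where n: "n = (s, j, k)" by (cases n)
  note s = I_D(1)[OF assms[unfolded n]]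
  \<comment> \<open>Exactly, 1 - (rad L)^2 = 2 / L - 1 / L^2.\<close>
  have one: "1 / L \<le> 1 - (rad L)\<^sup>2" "1 - (rad L)\<^sup>2 \<le> 2 / L" if "L \<ge> 2" for L
    using that by (auto simp: rad_def power2_eq_square field_simps)
  have eq: "wt (pt n) = (1 - (rad (Lz s))\<^sup>2) * (1 - (rad (Lw s))\<^sup>2)"
    using L_facts[OF s] by (simp add: n wt_def pt_def norm_node)
  have W: "real (W (blk n)) = real (Lz s) * real (Lw s)"
    unfolding n blk_def using L_facts(7)[OF s] by (metis fst_conv of_nat_mult)
  have "1 / real (Lz s) * (1 / real (Lw s)) \<le> wt (pt n)"
    unfolding eq using L_facts[OF s] one by (intro mult_mono order.trans[OF _ one(1)]) auto
  then show "1 / W (blk n) \<le> wt (pt n)" unfolding W by simp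
  have "wt (pt n) \<le> 2 / real (Lz s) * (2 / real (Lw s))"
    unfolding eq using L_facts(3,6)[OF s]
    by (intro mult_mono one) (auto intro: order.trans[OF _ one(1)] simp del: diff_ge_0_iff_ge)
  then show "wt (pt n) \<le> 4 / W (blk n)" unfolding W by simp
qed

definition T :: "nat \<Rightarrow> ((nat \<times> nat) \<times> nat \<times> nat) set" where "T N = {n \<in> I. blk n = N}"

lemma T_eq: "T N = (\<Union>i<d N. (\<lambda>jk. ((N, i), jk)) ` ({q (N, i)..<3 * q (N, i)} \<times> {..<Lw (N, i)}))"
  by (auto simp: T_def I_def blk_def)

text \<open>A full grid has W points. The sector keeps 2 q of the 4 d q values of j, a fraction 1 /
  (2 d), and d shapes together make up exactly half of W.\<close>

lemma card_T: "finite (T N)" "2 * card (T N) = W N"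
proof -
  show "finite (T N)" unfolding T_eq by auto
  have "card (T N) = (\<Sum>i<d N. card ((\<lambda>jk. ((N, i), jk)) ` ({q (N, i)..<3 * q (N, i)} \<times> {..<Lw (N, i)})))"
    unfolding T_eq by (rule card_UN_disjoint) auto
  also have "\<dots> = (\<Sum>i<d N. 2 * q (N, i) * Lw (N, i))"
    by (intro sum.cong refl) (subst card_image, auto simp: inj_on_def card_cartesian_product)
  finally have c: "card (T N) = (\<Sum>i<d N. 2 * q (N, i) * Lw (N, i))" .
  have "2 * d N * card (T N) = (\<Sum>i<d N. W N)"
    unfolding c sum_distrib_left
  proof (intro sum.cong refl)
    fix i assume "i \<in> {..<d N}"
    then have i: "snd (N, i) < d (fst (N, i))" by simp
    show "2 * d N * (2 * q (N, i) * Lw (N, i)) = W N"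
      using L_facts(7,8)[OF i] by (simp add: mult_ac)
  qed
  also have "\<dots> = d N * W N" by simp
  finally have "d N * (2 * card (T N)) = d N * W N" by (simp add: mult_ac)
  then show "2 * card (T N) = W N" using d_pos[of N] by simp
qed

text \<open>There are W / 2 points, each of weight between 1 / W and 4 / W. The lower bound makes
  the total weight diverge; the upper bound controls the corrections in the interpolation
  problem.\<close>

lemma block_mass: "(\<Sum>n\<in>T N. wt (pt n)) \<ge> 1 / 2" "(\<Sum>n\<in>T N. wt (pt n)) \<le> 2"
proof -
  have c: "2 * real (card (T N)) = real (W N)" using card_T(2)[of N] by (metis of_nat_mult of_nat_numeral)
  have W: "real (W N) > 0" using W_pos by simp
  have "(\<Sum>n\<in>T N. 1 / real (W N)) \<le> (\<Sum>n\<in>T N. wt (pt n))"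
    by (rule sum_mono) (use wt_pt(1) in \<open>auto simp: T_def\<close>)
  moreover have "(\<Sum>n\<in>T N. 1 / real (W N)) = 1 / 2" using c W by (simp add: field_simps)
  ultimately show "(\<Sum>n\<in>T N. wt (pt n)) \<ge> 1 / 2" by simp
  have "(\<Sum>n\<in>T N. wt (pt n)) \<le> (\<Sum>n\<in>T N. 4 / real (W N))"
    by (rule sum_mono) (use wt_pt(2) in \<open>auto simp: T_def\<close>)
  moreover have "(\<Sum>n\<in>T N. 4 / real (W N)) = 2" using c W by (simp add: field_simps)
  ultimately show "(\<Sum>n\<in>T N. wt (pt n)) \<le> 2" by simp
qed

lemma sum_over_blocks:
  fixes f :: "(nat \<times> nat) \<times> nat \<times> nat \<Rightarrow> real"
  assumes F: "finite F" "F \<subseteq> I" and f: "\<And>N. (\<Sum>n\<in>F \<inter> T N. f n) \<le> e N" and e: "\<And>m. (\<Sum>N<m. e N) \<le> X"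
  shows "(\<Sum>n\<in>F. f n) \<le> X"
proof -
  define m where "m = Suc (Max (blk ` F))"
  have "blk n < m" if "n \<in> F" for n
    unfolding m_def using F(1) that by (simp add: le_imp_less_Suc)
  then have "(\<Sum>n\<in>F. f n) = (\<Sum>N<m. \<Sum>n\<in>{n \<in> F. blk n = N}. f n)"
    using F(1) by (intro sum.group[symmetric]) auto
  also have "\<dots> = (\<Sum>N<m. \<Sum>n\<in>F \<inter> T N. f n)"
    by (intro sum.cong refl) (use F(2) in \<open>auto simp: T_def\<close>)
  also have "\<dots> \<le> (\<Sum>N<m. e N)" by (intro sum_mono f)
  finally show ?thesis using e[of m] by linarith
qed

lemma sum_block_le:
  fixes f :: "(nat \<times> nat) \<times> nat \<times> nat \<Rightarrow> real"
  assumes "\<And>n. n \<in> F \<Longrightarrow> blk n = N \<Longrightarrow> f n \<le> c / W N" and "c \<ge> 0"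
  shows "(\<Sum>n\<in>F \<inter> T N. f n) \<le> c"
proof -
  have "(\<Sum>n\<in>F \<inter> T N. f n) \<le> (\<Sum>n\<in>F \<inter> T N. c / W N)"
    by (intro sum_mono assms) (auto simp: T_def)
  also have "\<dots> = real (card (F \<inter> T N)) * (c / W N)" by simp
  also have "\<dots> \<le> real (W N) * (c / W N)"
  proof (rule mult_right_mono)
    have "card (F \<inter> T N) \<le> card (T N)" by (rule card_mono) (use card_T in auto)
    also have "\<dots> \<le> W N" using card_T(2)[of N] by linarith
    finally show "real (card (F \<inter> T N)) \<le> real (W N)" by simp
  qed (use assms(2) in auto)
  finally show ?thesis using W_pos[of N] by simp
qed

text \<open>Both sources of smallness are kept: the factor 1 - z^d for points of later blocks, and
  the high powers for points that lie deep inside relative to the frequencies.\<close>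

lemma En_bound:
  assumes n: "(s, j, k) \<in> I" and x: "norm (fst x) \<le> 1" "norm (snd x) \<le> 1"
  shows "norm (En (s, j, k) x) \<le> 2 ^ 16 * norm (1 - fst x ^ d (fst s)) * (norm (fst x) ^ (2 * Lz s) * norm (snd x) ^ (2 * Lw s))"
proof -
  note s = I_D(1)[OF n] 
  have 1: "norm (poly (Az (s, j, k)) (fst x)) \<le> norm (1 - fst x ^ d (fst s)) * (256 * norm (fst x) ^ (2 * Lz s))"
    unfolding Az_def prod.case
    by (rule order.trans[OF norm_zfun_le[OF I_D(4)[OF n] x(1)]], rule mult_left_mono,
        rule norm_peak_square_le) (use L_facts[OF s] I_D[OF n] x in auto)
  have 2: "norm (poly (Bw (s, j, k)) (snd x)) \<le> 256 * norm (snd x) ^ (2 * Lw s)"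
    unfolding Bw_def prod.case wfun_def poly_power norm_power
    by (rule norm_peak_square_le) (use L_facts[OF s] I_D[OF n] x in auto)
  have "norm (En (s, j, k) x) \<le> (norm (1 - fst x ^ d (fst s)) * (256 * norm (fst x) ^ (2 * Lz s))) * (256 * norm (snd x) ^ (2 * Lw s))"
    unfolding En_def norm_mult by (intro mult_mono 1 2) auto
  then show ?thesis by (simp add: mult_ac)
qed

lemma En_bound_2_17:
  assumes n: "(s, j, k) \<in> I" and x: "norm (fst x) \<le> 1" "norm (snd x) \<le> 1"
  shows "norm (En (s, j, k) x) \<le> 2 ^ 17 * (norm (fst x) ^ (2 * Lz s) * norm (snd x) ^ (2 * Lw s))"
proof -
  have "2 ^ 16 * norm (1 - fst x ^ d (fst s)) * (norm (fst x) ^ (2 * Lz s) * norm (snd x) ^ (2 * Lw s))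
     \<le> 2 ^ 16 * 2 * (norm (fst x) ^ (2 * Lz s) * norm (snd x) ^ (2 * Lw s))"
    using norm_one_minus_power_le[OF x(1), of "d (fst s)"] by (intro mult_right_mono mult_left_mono) auto
  with En_bound[OF assms] show ?thesis by simp
qed

lemma En_diag:
  assumes "n \<in> I"
  shows "En n (pt n) = 1"
proof -
  obtain s j k where n: "n = (s, j, k)" by (cases n)
  note I = I_D[OF assms[unfolded n]]
  have "1 - node (Lz s) j ^ d (fst s) \<noteq> 0" using I(4) by auto
  then show ?thesis
    using I L_facts[OF I(1)] by (simp add: n En_def pt_def Az_def Bw_def zfun_def wfun_def peak_node poly_monom)
qed

lemma W_le_d: "N < N' \<Longrightarrow> W N \<le> d N'"
proof -
  assume "N < N'"
  have "W N * 1 \<le> W N * (2 ^ 21 * 4 ^ N' * W N * d N)"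
    using W_pos[of N] d_pos[of N] by (intro mult_left_mono) auto
  also have "\<dots> = 2 ^ 21 * 4 ^ N' * (W N)\<^sup>2 * d N" by (simp add: power2_eq_square mult_ac)
  also have "\<dots> \<le> d N'" by (rule grow[OF \<open>N < N'\<close>])
  finally show ?thesis by simp
qed

text \<open>At distance 1 / P from the circle, a kernel of lowest frequency L contributes at most
  exp (- 2 L / P) up to constants, so it suffices that L / P is at least B / d in one variable. The
  other variable only contributes a bounded factor. Within one shape the value is exactly 0.\<close>

lemma En_off:
  assumes n: "n \<in> I" and k: "k \<in> I" and nk: "n \<noteq> k" and le: "blk k \<le> blk n"
  shows "norm (En n (pt k)) \<le> 2 ^ 17 * exp (- (2 * real (B (blk n)) / d (blk n)))"
proof -
  obtain s a b where ns: "n = (s, a, b)" by (cases n)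
  obtain t a' b' where kt: "k = (t, a', b')" by (cases k)
  note In = I_D[OF n[unfolded ns]] and Ik = I_D[OF k[unfolded kt]]
  note Ls = L_facts[OF In(1)] and Lt = L_facts[OF Ik(1)]
  define X where "X = exp (- (2 * real (B (blk n)) / d (blk n)))"
  have blk: "blk n = fst s" "blk k = fst t" by (auto simp: ns kt blk_def)
  have bd: "norm (En n (pt k)) \<le> 2 ^ 17 * (rad (Lz t) ^ (2 * Lz s) * rad (Lw t) ^ (2 * Lw s))"
    using En_bound_2_17[OF n[unfolded ns], of "pt k"] Lt rad_less_1[of "Lz t"] rad_less_1[of "Lw t"]
    by (simp add: ns kt pt_def norm_node less_imp_le)
  have r: "0 \<le> rad (Lz t) ^ (2 * Lz s)" "rad (Lz t) ^ (2 * Lz s) \<le> 1" "0 \<le> rad (Lw t) ^ (2 * Lw s)" "rad (Lw t) ^ (2 * Lw s) \<le> 1"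
    using rad_pos[OF Lt(3)] rad_less_1[OF Lt(3)] rad_pos[OF Lt(6)] rad_less_1[OF Lt(6)] by (auto intro: power_le_one)
  have exp_le: "rad P ^ (2 * L) \<le> X" if "P \<ge> 2" "B (blk n) * P \<le> L * d (blk n)" for P L
  proof -
    have "real (B (blk n)) * P \<le> real L * d (blk n)"
      using that(2) by (metis of_nat_le_iff of_nat_mult)
    then have "real (B (blk n)) / d (blk n) \<le> L / P"
      using that(1) d_pos[of "blk n"] by (simp add: field_simps)
    then have "- (2 * real L / P) \<le> - (2 * real (B (blk n)) / d (blk n))" by simp
    then have "exp (- (2 * real L / P)) \<le> X" unfolding X_def by simp
    with rad_power_le_exp[OF that(1), of L] show ?thesis by linarith
  qed
  have prod: "rad (Lz t) ^ (2 * Lz s) * rad (Lw t) ^ (2 * Lw s) \<le> X" 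
    if "B (blk n) * Lz t \<le> Lz s * d (blk n) \<or> B (blk n) * Lw t \<le> Lw s * d (blk n)"
    using that
  proof
    assume "B (blk n) * Lz t \<le> Lz s * d (blk n)"
    from exp_le[OF Lt(3) this] show ?thesis using r by (meson mult_left_le order.trans)
  next
    assume "B (blk n) * Lw t \<le> Lw s * d (blk n)"
    from exp_le[OF Lt(6) this] show ?thesis using r by (meson mult_left_le_one_le order.trans)
  qed
  show ?thesis
  proof (cases "s = t")
    case True
    then have "a \<noteq> a' \<or> b \<noteq> b'" using nk ns kt by auto
    then have "En n (pt k) = 0"
      using In Ik Ls True by (auto simp: ns kt En_def pt_def Az_def Bw_def zfun_def wfun_def peak_node)
    then show ?thesis by simp
  next
    case False
    \<comment> \<open>In the same block the frequency ratio is at least B, in z if the shape of n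
      has the larger index and in w otherwise. For an earlier block the point has scale at most W,
      which is at most the d of the block of n, while the frequency is at least B. This case is why
      the exponent contains B / d instead of B.\<close>
    have "B (blk n) * Lz t \<le> Lz s * d (blk n) \<or> B (blk n) * Lw t \<le> Lw s * d (blk n)"
    proof (cases "fst s = fst t")
      case True
      then consider "snd t < snd s" | "snd s < snd t" using False by (metis linorder_neqE_nat prod_eqI)
      then show ?thesis
      proof cases
        case 1
        have "B (fst s) * Lz t = B (fst s) ^ (Suc (snd t + 1))" by (simp add: Lz_def True)
        also have "\<dots> \<le> Lz s" unfolding Lz_def using 1 B_pos[of "fst s"] by (intro power_increasing) auto
        also have "\<dots> \<le> Lz s * d (fst s)" using d_pos[of "fst s"] by simp
        finally show ?thesis by (simp add: blk)
      next
        case 2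
        have "B (fst s) * Lw t = B (fst s) ^ (Suc (d (fst s) - snd t))" by (simp add: Lw_def True)
        also have "\<dots> \<le> Lw s" unfolding Lw_def using 2 Ik(1) True B_pos[of "fst s"] by (intro power_increasing) auto
        also have "\<dots> \<le> Lw s * d (fst s)" using d_pos[of "fst s"] by simp
        finally show ?thesis by (simp add: blk)
      qed
    next
      case False
      then have "fst t < fst s" using le blk by simp
      then have "Lz t \<le> d (fst s)" using Lt(10) W_le_d by (meson order.trans)
      then have "B (fst s) * Lz t \<le> Lz s * d (fst s)" using Ls(1) by (intro mult_mono) auto
      then show ?thesis by (simp add: blk)
    qed
    from prod[OF this] have "2 ^ 17 * (rad (Lz t) ^ (2 * Lz s) * rad (Lw t) ^ (2 * Lw s)) \<le> 2 ^ 17 * X"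
      by (rule mult_left_mono) simp
    with bd show ?thesis unfolding X_def by (rule order.trans)
  qed
qed

text \<open>The high powers give nothing at points closer to the torus. Instead |1 - z^d| is at most
  d |1 - z|, and the sector of the later block has |1 - z| at most 6 divided by the later d.\<close>

lemma En_later:
  assumes n: "n \<in> I" and k: "k \<in> I" and lt: "blk n < blk k"
  shows "norm (En n (pt k)) \<le> 2 ^ 16 * (6 * d (blk n) / d (blk k))"
proof -
  obtain s a b where ns: "n = (s, a, b)" by (cases n)
  obtain t a' b' where kt: "k = (t, a', b')" by (cases k)
  note Ik = I_D[OF k[unfolded kt]]
  have pk: "norm (fst (pt k)) \<le> 1" "norm (snd (pt k)) \<le> 1"
    using pt_bidisc[OF k] by (auto simp: bidisc_def)
  have "norm (1 - fst (pt k) ^ d (fst s)) \<le> d (fst s) * norm (1 - fst (pt k))"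
    using norm_power_diff[of 1 "fst (pt k)" "d (fst s)"] pk by simp
  also have "\<dots> \<le> d (fst s) * (6 / d (fst t))"
    using Ik(5) by (intro mult_left_mono) (auto simp: kt pt_def)
  finally have 1: "norm (1 - fst (pt k) ^ d (fst s)) \<le> 6 * d (blk n) / d (blk k)"
    by (simp add: ns kt blk_def mult_ac)
  have "norm (fst (pt k)) ^ (2 * Lz s) * norm (snd (pt k)) ^ (2 * Lw s) \<le> 1"
    using pk by (intro mult_le_one power_le_one) auto
  then have "2 ^ 16 * norm (1 - fst (pt k) ^ d (fst s)) * (norm (fst (pt k)) ^ (2 * Lz s) * norm (snd (pt k)) ^ (2 * Lw s))
     \<le> 2 ^ 16 * (6 * d (blk n) / d (blk k)) * 1"
    using 1 by (intro mult_mono) auto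
  with En_bound[OF n[unfolded ns] pk] show ?thesis by (simp add: ns)
qed

end

text \<open>Telescoping: 1 / (8 * 2^N) is the difference of 1 / (4 * 2^N) and 1 / (4 * 2^(N +
  1)).\<close>

lemma sum_half_powers: "(\<Sum>N<m. if N < M then 0 else 1 / (8 * 2 ^ N) :: real) = (if m \<le> M then 0 else 1 / (4 * 2 ^ M) - 1 / (4 * 2 ^ m))"
proof (induction m)
  case (Suc m)
  have eq: "(\<Sum>N<Suc m. if N < M then 0 else 1 / (8 * 2 ^ N) :: real)
     = (if m \<le> M then 0 else 1 / (4 * 2 ^ M) - 1 / (4 * 2 ^ m)) + (if m < M then 0 else 1 / (8 * 2 ^ m))"
    using Suc.IH by simp
  consider "m < M" | "m = M" | "m > M" by linarith
  then show ?case unfolding eq by cases (simp_all add: field_simps)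
qed simp

context blocks
begin

section \<open>The enumerated sequence and the hypotheses of the criterion\<close>

lemma I_countable: "countable I" by (rule countableI_type)

lemma T_nonempty: "T N \<noteq> {}"
  using card_T(2)[of N] W_pos[of N] by auto

lemma I_infinite: "infinite I"
proof
  assume "finite I"
  then have "finite (blk ` I)" by simp
  moreover have "blk ` I = UNIV"
  proof (intro equalityI subset_UNIV subsetI)
    fix N
    obtain n where "n \<in> T N" using T_nonempty by blast
    then show "N \<in> blk ` I" by (auto simp: T_def)
  qed
  ultimately show False by simp
qed

definition enum :: "nat \<Rightarrow> (nat \<times> nat) \<times> nat \<times> nat" where "enum = from_nat_into I"

lemma enum_bij: "bij_betw enum UNIV I"
  unfolding enum_def by (rule bij_betw_from_nat_into[OF I_countable I_infinite])

lemma enum_in: "enum n \<in> I" and enum_inj: "inj enum" and enum_img: "enum ` S \<subseteq> I"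
  using enum_bij by (auto simp: bij_betw_def)

lemma sum_enum:
  fixes f :: "(nat \<times> nat) \<times> nat \<times> nat \<Rightarrow> 'b::comm_monoid_add"
  shows "(\<Sum>n\<in>F. f (enum n)) = (\<Sum>m\<in>enum ` F. f m)"
  by (subst sum.reindex) (use enum_inj in \<open>auto intro: inj_on_subset\<close>)

definition seq :: "nat \<Rightarrow> complex \<times> complex" where "seq n = pt (enum n)"

lemma seq_bidisc: "range seq \<subseteq> bidisc"
  unfolding seq_def using pt_bidisc[OF enum_in] by blast

lemma wt_seq_pos: "0 < wt (seq n)"
  unfolding seq_def using wt_bounds(1)[OF pt_bidisc[OF enum_in]] .

lemma wt_inverse: "n \<in> I \<Longrightarrow> 1 / wt (pt n) \<le> W (blk n)"
  using wt_pt(1)[of n] W_pos[of "blk n"] wt_bounds(1)[OF pt_bidisc[of n]] by (simp add: field_simps)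

text \<open>A block has at most W points, and dividing by a weight costs another W, so the values
  must beat W^2; this is the square in the conditions on d and B. With M the block of k, the M
  blocks before it contribute 1 / (4 * 4^M) each, at most 1 / (4 * 2^M) together, and the remaining
  ones at most the geometric tail 1 / (4 * 2^M). The decay in M is what makes the weighted sum of
  these bounds finite.\<close>

lemma off_diagonal:
  assumes F: "finite F" "F \<subseteq> I" and k: "k \<in> I" "k \<notin> F"
  shows "(\<Sum>n\<in>F. norm (En n (pt k)) / wt (pt n)) \<le> 1 / (2 * 2 ^ blk k)"
proof -
  define M where "M = blk k"
  define e :: "nat \<Rightarrow> real" where "e N = (if N < M then 1 / (4 * 4 ^ M) else 1 / (8 * 2 ^ N))" for N
  show ?thesis
  proof (rule sum_over_blocks[OF F, where e = e])
    fix N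
    show "(\<Sum>n\<in>F \<inter> T N. norm (En n (pt k)) / wt (pt n)) \<le> e N"
    proof (rule sum_block_le)
      show "e N \<ge> 0" by (simp add: e_def)
      fix n assume n: "n \<in> F" "blk n = N"
      then have nI: "n \<in> I" "n \<noteq> k" using F(2) k by auto
      define w where "w = real (W N)"
      have w: "w > 0" using W_pos by (simp add: w_def)
      have "norm (En n (pt k)) / wt (pt n) = norm (En n (pt k)) * (1 / wt (pt n))" by simp
      also have "\<dots> \<le> norm (En n (pt k)) * w"
        using wt_inverse[OF nI(1)] n by (intro mult_left_mono) (auto simp: w_def)
      also have "\<dots> \<le> e N / w"
      proof (cases "N < M")
        case True
        have "real (2 ^ 21 * 4 ^ M * (W N)\<^sup>2 * d N) \<le> real (d M)"
          using grow[OF True] by (simp only: of_nat_le_iff)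
        then have g: "2 ^ 21 * 4 ^ M * w\<^sup>2 * d N \<le> real (d M)" by (simp add: w_def)
        have "norm (En n (pt k)) * w \<le> 2 ^ 16 * (6 * d N / d M) * w"
          using En_later[OF nI(1) k(1)] n True w by (intro mult_right_mono) (auto simp: M_def)
        \<comment> \<open>Clearing denominators leaves the factor 2^16 * 6 * 4, and 24 \<le> 2^5
          accounts for the 2^21 in the growth condition.\<close>
        also have "\<dots> \<le> 1 / (4 * 4 ^ M) / w"
        proof -
          have "0 \<le> 4 ^ M * w\<^sup>2 * d N" by simp
          then have "2 ^ 16 * 24 * (4 ^ M * w\<^sup>2 * d N) \<le> 2 ^ 21 * (4 ^ M * w\<^sup>2 * d N)"
            by (intro mult_right_mono) auto
          then have "2 ^ 16 * 24 * (4 ^ M * w\<^sup>2 * d N) \<le> d M" using g by (simp add: mult_ac)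
          then show ?thesis using w d_pos[of M] by (simp add: field_simps power2_eq_square)
        qed
        finally show ?thesis using True by (simp add: e_def)
      next
        case False
        have "norm (En n (pt k)) * w \<le> 2 ^ 17 * exp (- (2 * real (B N) / d N)) * w"
          using En_off[OF nI(1) k(1) nI(2)] n False w by (intro mult_right_mono) (auto simp: M_def)
        also have "\<dots> \<le> 1 / (8 * 2 ^ N) / w"
        proof -
          have "(2 ^ 17 * exp (- (2 * real (B N) / d N)) * w) * w \<le> 1 / (8 * 2 ^ N)"
            using small[of N] by (simp add: w_def power2_eq_square mult_ac)
          then show ?thesis using w by (simp only: pos_le_divide_eq)
        qed
        finally show ?thesis using False by (simp add: e_def)
      qed
      finally show "norm (En n (pt k)) / wt (pt n) \<le> e N / W N" by (simp add: w_def)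
    qed
  next
    fix m
    have "(\<Sum>N<m. e N) = (\<Sum>N<m. if N < M then 1 / (4 * 4 ^ M) else 0) + (\<Sum>N<m. if N < M then 0 else 1 / (8 * 2 ^ N))"
      unfolding sum.distrib[symmetric] e_def by (intro sum.cong) auto
    also have "\<dots> \<le> 1 / (4 * 2 ^ M) + 1 / (4 * 2 ^ M)"
    proof (rule add_mono)
      have "(\<Sum>N<m. if N < M then 1 / (4 * 4 ^ M) else 0 :: real) = (\<Sum>N\<in>{..<m} \<inter> {..<M}. 1 / (4 * 4 ^ M))"
        by (subst sum.inter_restrict) auto
      also have "\<dots> = real (card ({..<m} \<inter> {..<M})) * (1 / (4 * 4 ^ M))" by simp
      also have "\<dots> \<le> 2 ^ M * (1 / (4 * 4 ^ M))"
      proof (rule mult_right_mono)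
        have "card ({..<m} \<inter> {..<M}) \<le> card {..<M}" by (rule card_mono) auto
        also have "\<dots> < 2 ^ M" using less_exp[of M] by simp
        finally show "real (card ({..<m} \<inter> {..<M})) \<le> 2 ^ M"
          by (metis less_imp_le of_nat_le_iff of_nat_numeral of_nat_power)
      qed simp
      also have "\<dots> = 1 / (4 * 2 ^ M)"
        using power_mult_distrib[of "2::real" 2 M] by (simp add: field_simps)
      finally show "(\<Sum>N<m. if N < M then 1 / (4 * 4 ^ M) else 0 :: real) \<le> 1 / (4 * 2 ^ M)" .
      show "(\<Sum>N<m. if N < M then 0 else 1 / (8 * 2 ^ N) :: real) \<le> 1 / (4 * 2 ^ M)"
        unfolding sum_half_powers by simp
    qed
    also have "\<dots> = 1 / (2 * 2 ^ blk k)" by (simp add: M_def)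
    finally show "(\<Sum>N<m. e N) \<le> 1 / (2 * 2 ^ blk k)" .
  qed
qed

text \<open>The blocks have mass at most 2, so their contributions are dominated by a geometric
  series although the total weight is infinite.\<close>

lemma weighted_sum:
  assumes F: "finite F" "F \<subseteq> I"
  shows "(\<Sum>n\<in>F. wt (pt n) * (1 / (2 * 2 ^ blk n))) \<le> 2"
proof (rule sum_over_blocks[OF F])
  fix N
  have "(\<Sum>n\<in>F \<inter> T N. wt (pt n) * (1 / (2 * 2 ^ blk n))) = (\<Sum>n\<in>F \<inter> T N. wt (pt n)) * (1 / (2 * 2 ^ N))"
    unfolding sum_distrib_right by (intro sum.cong) (auto simp: T_def)
  also have "\<dots> \<le> (\<Sum>n\<in>T N. wt (pt n)) * (1 / (2 * 2 ^ N))"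
    using card_T wt_bounds(1)[OF pt_bidisc]
    by (intro mult_right_mono sum_mono2) (auto simp: T_def less_imp_le)
  also have "\<dots> \<le> 2 * (1 / (2 * 2 ^ N))"
    using block_mass(2)[of N] by (intro mult_right_mono) auto
  finally show "(\<Sum>n\<in>F \<inter> T N. wt (pt n) * (1 / (2 * 2 ^ blk n))) \<le> (1 / 2) ^ N" by (simp add: power_one_over)
  fix m
  have "(\<Sum>N<m. (1 / 2) ^ N) \<le> (\<Sum>N. (1 / 2 :: real) ^ N)"
    by (rule sum_le_suminf) (auto intro: summable_geometric)
  then show "(\<Sum>N<m. (1 / 2 :: real) ^ N) \<le> 2" by (simp add: suminf_geometric)
qed

text \<open>A crude form of d tending to infinity: every compact part of the bidisc eventually lies
  within modulus 1 - 1 / d.\<close>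

lemma d_ge: "N \<le> d N"
proof (cases N)
  case (Suc N')
  have "N * 1 \<le> 4 ^ N * (2 ^ 21 * (W N')\<^sup>2 * d N')"
    using less_exp[of N] power_mono[of 2 "4::nat" N] W_pos[of N'] d_pos[of N']
    by (intro mult_le_mono) (auto intro: less_imp_le less_le_trans)
  also have "\<dots> \<le> d N" using grow[of N' N] Suc by (simp add: mult_ac)
  finally show ?thesis by simp
qed simp

text \<open>Once d exceeds 1 / (1 - R), R is at most exp (- 1 / d), so R^(2 B) is below the
  exponential that was chosen to beat W^2. One factor W pays for the division by the weight and the
  other for the number of points in a block.\<close>

lemma interior:
  assumes R: "0 < R" "R < 1"
  shows "\<exists>M. summable M \<and> (\<forall>n z w. norm z \<le> R \<longrightarrow> norm w \<le> R \<longrightarrow> norm (En (enum n) (z, w)) \<le> wt (seq n) * M n)"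
proof -
  define e where "e N = 2 ^ 17 * R ^ (2 * B N) * (real (W N))\<^sup>2" for N
  have e0: "e N \<ge> 0" for N using R by (simp add: e_def)
  have "summable e"
  proof (rule summable_comparison_test_ev)
    show "summable (\<lambda>N. (1 / 8) * (1 / 2) ^ N :: real)" by (intro summable_mult summable_geometric) auto
    obtain N0 :: nat where N0: "1 / (1 - R) < N0" using reals_Archimedean2 by blast
    have "norm (e N) \<le> (1 / 8) * (1 / 2) ^ N" if N: "N \<ge> N0" for N
    proof -
      have "1 / (1 - R) < d N" using N0 N d_ge[of N] by (meson less_le_trans of_nat_le_iff)
      then have "R \<le> 1 + - (1 / d N)" using R d_pos[of N] by (simp add: field_simps)
      also have "\<dots> \<le> exp (- (1 / d N))" by (rule exp_ge_add_one_self)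
      finally have "R ^ (2 * B N) \<le> exp (- (1 / d N)) ^ (2 * B N)" using R by (intro power_mono) auto
      also have "\<dots> = exp (- (2 * real (B N) / d N))" by (simp add: exp_of_nat_mult[symmetric])
      finally have "e N \<le> 2 ^ 17 * exp (- (2 * real (B N) / d N)) * (real (W N))\<^sup>2"
        unfolding e_def by (intro mult_right_mono mult_left_mono) auto
      also have "\<dots> \<le> 1 / (8 * 2 ^ N)" using small[of N] by (simp add: mult_ac)
      finally show ?thesis using e0[of N] by (simp add: power_one_over)
    qed
    then show "\<forall>\<^sub>F N in sequentially. norm (e N) \<le> (1 / 8) * (1 / 2) ^ N"
      by (auto simp: eventually_sequentially)
  qed
  define M where "M n = 2 ^ 17 * R ^ (2 * B (blk n)) * real (W (blk n))" for n
  have M0: "M n \<ge> 0" for n using R by (simp add: M_def)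
  have sum: "(\<Sum>n\<in>F. M n) \<le> suminf e" if F: "finite F" "F \<subseteq> I" for F
  proof (rule sum_over_blocks[OF F])
    show "(\<Sum>n\<in>F \<inter> T N. M n) \<le> e N" for N
      using e0 W_pos by (intro sum_block_le) (auto simp: M_def e_def power2_eq_square)
    show "(\<Sum>N<m. e N) \<le> suminf e" for m
      by (rule sum_le_suminf[OF \<open>summable e\<close>]) (auto simp: e0)
  qed
  have "summable (\<lambda>n. M (enum n))"
  proof (rule summableI_nonneg_bounded)
    show "(\<Sum>i<n. M (enum i)) \<le> suminf e" for n
      unfolding sum_enum by (rule sum) (use enum_in in auto)
  qed (rule M0)
  moreover have "norm (En (enum n) (z, w)) \<le> wt (seq n) * M (enum n)" if zw: "norm z \<le> R" "norm w \<le> R" for n z w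
  proof -
    obtain s j k where n: "enum n = (s, j, k)" by (cases "enum n")
    note I = enum_in[of n, unfolded n]
    have "norm (En (enum n) (z, w)) \<le> 2 ^ 17 * (norm z ^ (2 * Lz s) * norm w ^ (2 * Lw s))"
      using En_bound_2_17[OF I, of "(z, w)"] zw R by (simp add: n)
    also have "\<dots> \<le> 2 ^ 17 * (R ^ (2 * B (fst s)) * 1)"
    proof (intro mult_left_mono mult_mono)
      have "norm z ^ (2 * Lz s) \<le> R ^ (2 * Lz s)" using zw by (intro power_mono) auto
      also have "\<dots> \<le> R ^ (2 * B (fst s))" using R L_facts(1)[OF I_D(1)[OF I]] by (intro power_decreasing) auto
      finally show "norm z ^ (2 * Lz s) \<le> R ^ (2 * B (fst s))" .
      show "norm w ^ (2 * Lw s) \<le> 1" using zw R by (intro power_le_one) auto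
    qed (use R in auto)
    also have "\<dots> \<le> (wt (seq n) * W (fst s)) * (2 ^ 17 * (R ^ (2 * B (fst s)) * 1))"
    proof -
      have "1 \<le> wt (seq n) * W (fst s)"
        using wt_pt(1)[OF enum_in[of n]] W_pos[of "fst s"] by (simp add: seq_def n blk_def field_simps)
      then show ?thesis using R mult_right_mono[of 1 "wt (seq n) * W (fst s)" "2 ^ 17 * (R ^ (2 * B (fst s)) * 1)"] by simp
    qed
    also have "\<dots> = wt (seq n) * M (enum n)" by (simp add: M_def n blk_def mult_ac)
    finally show ?thesis .
  qed
  ultimately show ?thesis by (intro exI[of _ "\<lambda>n. M (enum n)"]) blast
qed

lemma wt_ge: "(s, j, k) \<in> I \<Longrightarrow> 1 / (real (Lz s) * real (Lw s)) \<le> wt (pt (s, j, k))"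
  using wt_pt(1)[of "(s, j, k)"] L_facts(7)[OF I_D(1), of s j k] by (simp add: blk_def flip: of_nat_mult)

text \<open>The estimate gives 2^17; it is relaxed to the constant of the L^2 bound because the
  criterion uses one constant for both.\<close>

lemma L1_bound:
  assumes r: "0 < r" "r < 1" and n: "n \<in> I"
  shows "(\<integral>\<^sup>+ x. ennreal (norm (En n (r *\<^sub>R x))) \<partial>torus_haar) \<le> ennreal (2 ^ 34 * wt (pt n))"
proof -
  obtain s j k where ns: "n = (s, j, k)" by (cases n)
  note I = I_D[OF n[unfolded ns]]
  have "(\<integral>\<^sup>+ x. ennreal (norm (En n (r *\<^sub>R x))) \<partial>torus_haar) \<le> ennreal (2 ^ 17 / (Lz s * Lw s))"
    using shape_integral_torus[of "Lz s" "Lw s" r j "d (fst s)" k] L_facts(2,3,5,6)[OF I(1)] I(4) r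
    by (simp add: ns En_def Az_def Bw_def scaleR_conv_of_real)
  also have "\<dots> \<le> ennreal (2 ^ 34 * wt (pt n))"
  proof (rule ennreal_leI)
    have "2 ^ 17 / real (Lz s * Lw s) = 2 ^ 17 * (1 / (real (Lz s) * real (Lw s)))" by simp
    also have "\<dots> \<le> 2 ^ 34 * wt (pt n)"
      using wt_ge[OF n[unfolded ns]] unfolding ns by (intro mult_mono) auto
    finally show "2 ^ 17 / real (Lz s * Lw s) \<le> 2 ^ 34 * wt (pt n)" .
  qed
  finally show ?thesis .
qed

text \<open>In lexicographic order of block and shape, each z-frequency is at least 4 times any
  earlier one. With d at most a quarter of the frequency, 4 L + d stays below 8 L, which is at most
  twice the later frequency.\<close>

lemma frequencies_disjoint:
  assumes s: "snd s < d (fst s)" and t: "snd t < d (fst t)" and st: "s \<noteq> t"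
  shows "4 * Lz s + d (fst s) \<le> 2 * Lz t \<or> 4 * Lz t + d (fst t) \<le> 2 * Lz s"
proof -
  have *: "4 * Lz s + d (fst s) \<le> 2 * Lz t"
    if s: "snd s < d (fst s)" and t: "snd t < d (fst t)" and lt: "fst s < fst t \<or> fst s = fst t \<and> snd s < snd t" for s t
  proof -
    have ds: "4 * d (fst s) \<le> Lz s" using B_ge(1)[of "fst s"] L_facts(1)[OF s] by linarith
    have "4 * Lz s \<le> Lz t"
    proof (cases "fst s < fst t")
      case True
      have "4 * Lz s \<le> 4 * d (fst t)" using L_facts(10)[OF s] W_le_d[OF True] by linarith
      also have "\<dots> \<le> Lz t" using B_ge(1)[of "fst t"] L_facts(1)[OF t] by linarith
      finally show ?thesis .
    next
      case False
      with lt have eq: "fst s = fst t" "snd s < snd t" by auto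
      have "4 * Lz s \<le> B (fst s) * Lz s" using B_ge(2)[of "fst s"] by simp
      also have "\<dots> = B (fst s) ^ Suc (snd s + 1)" by (simp add: Lz_def)
      also have "\<dots> \<le> Lz t" unfolding Lz_def eq(1) using eq(2) B_pos[of "fst t"] by (intro power_increasing) auto
      finally show ?thesis .
    qed
    with ds show ?thesis by linarith
  qed
  have "fst s < fst t \<or> fst s = fst t \<and> snd s < snd t \<or> fst t < fst s \<or> fst t = fst s \<and> snd t < snd s"
    using st by (metis linorder_neqE_nat prod_eqI)
  with *[OF s t] *[OF t s] show ?thesis by blast
qed

lemma L2_bound:
  assumes r: "0 < r" "r < 1" and F: "finite F" "F \<subseteq> I"
  shows "(\<integral>\<^sup>+ x. ennreal ((norm (\<Sum>n\<in>F. g n * En n (r *\<^sub>R x)))\<^sup>2) \<partial>torus_haar)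
    \<le> ennreal (2 ^ 34 * (\<Sum>n\<in>F. (norm (g n))\<^sup>2 * wt (pt n)))"
proof -
  have "(\<integral>\<^sup>+ x. ennreal ((norm (\<Sum>n\<in>F. g n * En n (r *\<^sub>R x)))\<^sup>2) \<partial>torus_haar)
    = (\<integral>\<^sup>+ x. ennreal ((norm (\<Sum>(s, j, k)\<in>F. g (s, j, k) * poly (zfun (d (fst s)) (Lz s) j) (of_real r * fst x)
             * poly (wfun (Lw s) k) (of_real r * snd x)))\<^sup>2) \<partial>torus_haar)"
    by (simp add: En_def Az_def Bw_def scaleR_conv_of_real case_prod_beta mult.assoc)
  also have "\<dots> \<le> ennreal (2 ^ 34 * (\<Sum>(s, j, k)\<in>F. (norm (g (s, j, k)))\<^sup>2 / (Lz s * Lw s)))"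
  proof (rule shapes_integral_torus)
    show "0 \<le> r" "r \<le> 1" "finite F" using r F by auto
    fix s j k assume "(s, j, k) \<in> F"
    then have I: "(s, j, k) \<in> I" using F by auto
    show "even (Lz s) \<and> 2 \<le> Lz s \<and> even (Lw s) \<and> 2 \<le> Lw s \<and> j < Lz s \<and> k < Lw s \<and> 1 \<le> norm (1 - node (Lz s) j ^ d (fst s))"
      using I_D[OF I] L_facts[OF I_D(1)[OF I]] by blast
  next
    fix s t assume "s \<in> fst ` F" "t \<in> fst ` F" "s \<noteq> t"
    then show "4 * Lz s + d (fst s) \<le> 2 * Lz t \<or> 4 * Lz t + d (fst t) \<le> 2 * Lz s"
      using F(2) I_D(1) by (intro frequencies_disjoint) fastforce+
  qed
  also have "\<dots> \<le> ennreal (2 ^ 34 * (\<Sum>n\<in>F. (norm (g n))\<^sup>2 * wt (pt n)))"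
  proof (intro ennreal_leI mult_left_mono sum_mono)
    fix n assume nF: "n \<in> F"
    obtain s j k where n: "n = (s, j, k)" by (cases n)
    have "(norm (g n))\<^sup>2 * (1 / (real (Lz s) * real (Lw s))) \<le> (norm (g n))\<^sup>2 * wt (pt n)"
      using wt_ge[of s j k] nF n F(2) by (intro mult_left_mono) auto
    then show "(case n of (s, j, k) \<Rightarrow> (norm (g (s, j, k)))\<^sup>2 / real (Lz s * Lw s)) \<le> (norm (g n))\<^sup>2 * wt (pt n)"
      by (simp add: n)
  qed simp
  finally show ?thesis .
qed

lemma seq_simply_interpolating:
  assumes "1 \<le> p" "p \<le> 2"
  shows "simply_interpolating p seq"
proof (rule simply_interpolating_criterion[where A = "\<lambda>n. Az (enum n)" and B = "\<lambda>n. Bw (enum n)"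
      and \<beta> = "\<lambda>n. 1 / (2 * 2 ^ blk (enum n))" and D = 2 and C = "2 ^ 34", unfolded En_def[symmetric]])
  show "range seq \<subseteq> bidisc" by (rule seq_bidisc)
  show "En (enum n) (seq n) = 1" for n by (simp add: seq_def En_diag enum_in)
  show "(\<Sum>n\<in>F. norm (En (enum n) (seq k)) / wt (seq n)) \<le> 1 / (2 * 2 ^ blk (enum k))" if "finite F" "k \<notin> F" for k F
  proof -
    have "enum k \<notin> enum ` F" using that enum_inj by (auto dest: injD)
    then show ?thesis
      unfolding seq_def sum_enum[of "\<lambda>n. norm (En n (pt (enum k))) / wt (pt n)"]
      using that enum_in by (intro off_diagonal) auto
  qed
  show "1 / (2 * 2 ^ blk (enum k)) \<le> (1 / 2 :: real)" for k by (simp add: field_simps)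
  show "(\<Sum>n\<in>F. wt (seq n) * (1 / (2 * 2 ^ blk (enum n)))) \<le> 2" if "finite F" for F
    unfolding seq_def sum_enum[of "\<lambda>n. wt (pt n) * (1 / (2 * 2 ^ blk n))"]
    using that enum_in by (intro weighted_sum) auto
  show "\<exists>M. summable M \<and> (\<forall>n z w. norm z \<le> R \<longrightarrow> norm w \<le> R \<longrightarrow> norm (En (enum n) (z, w)) \<le> wt (seq n) * M n)"
    if "0 < R" "R < 1" for R by (rule interior[OF that])
  show "(\<integral>\<^sup>+ x. ennreal (norm (En (enum n) (r *\<^sub>R x))) \<partial>torus_haar) \<le> ennreal (2 ^ 34 * wt (seq n))"
    if "0 < r" "r < 1" for r n unfolding seq_def by (rule L1_bound[OF that enum_in])
  show "(\<integral>\<^sup>+ x. ennreal ((norm (\<Sum>n\<in>F. g n * En (enum n) (r *\<^sub>R x)))\<^sup>2) \<partial>torus_haar)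
      \<le> ennreal (2 ^ 34 * (\<Sum>n\<in>F. (norm (g n))\<^sup>2 * wt (seq n)))"
    if "0 < r" "r < 1" "finite F" for r F g
  proof -
    \<comment> \<open>The criterion indexes coefficients by natural numbers, the estimate by points;
      g is transported along the enumeration.\<close>
    define g' where "g' m = g (inv enum m)" for m
    have g: "g n = g' (enum n)" for n using enum_inj by (simp add: g'_def)
    show ?thesis
      unfolding seq_def g sum_enum[of "\<lambda>n. g' n * En n _"] sum_enum[of "\<lambda>n. (norm (g' n))\<^sup>2 * wt (pt n)"]
      using that enum_in by (intro L2_bound) auto
  qed
qed (use assms in auto)

lemma seq_weights_not_summable: "\<not> summable (\<lambda>n. wt (seq n))"
proof
  assume s: "summable (\<lambda>n. wt (seq n))"
  have le: "(\<Sum>n\<in>G. wt (pt n)) \<le> (\<Sum>n. wt (seq n))" if "finite G" "G \<subseteq> I" for G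
  proof -
    define F where "F = enum -` G"
    have G: "enum ` F = G" using that(2) enum_bij by (auto simp: F_def bij_betw_def)
    have F: "finite F" unfolding F_def using that(1) enum_inj by (rule finite_vimageI)
    have "(\<Sum>n\<in>G. wt (pt n)) = (\<Sum>n\<in>F. wt (seq n))"
      unfolding seq_def sum_enum[of "\<lambda>n. wt (pt n)"] G ..
    also have "\<dots> \<le> (\<Sum>n. wt (seq n))"
      by (rule sum_le_suminf[OF s F]) (use wt_seq_pos in \<open>auto intro: less_imp_le\<close>)
    finally show ?thesis .
  qed
  obtain m :: nat where m: "2 * (\<Sum>n. wt (seq n)) < m" using reals_Archimedean2 by blast
  have "real m / 2 = (\<Sum>N<m. 1 / 2)" by simp
  also have "\<dots> \<le> (\<Sum>N<m. \<Sum>n\<in>T N. wt (pt n))" by (intro sum_mono block_mass(1))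
  also have "\<dots> = (\<Sum>n\<in>(\<Union>N<m. T N). wt (pt n))"
    by (rule sum.UNION_disjoint[symmetric]) (auto simp: card_T, auto simp: T_def)
  also have "\<dots> \<le> (\<Sum>n. wt (seq n))" by (rule le) (auto simp: card_T, auto simp: T_def)
  finally show False using m by simp
qed

lemma seq_not_carleson:
  assumes r: "1 \<le> r"
  shows "\<not> carleson_sequence r seq"
proof
  assume c: "carleson_sequence r seq"
  have "(\<lambda>_. 1) \<in> Hardy r"
  proof -
    have "(\<lambda>_. 1) holomorphic2_on bidisc"
      unfolding holomorphic2_on_def by (intro ballI exI[of _ 0]) simp
    moreover have "(\<integral>\<^sup>+ z. 1 \<partial>torus_haar) = (1::ennreal)"
      using emeasure_circle by (subst nn_integral_torus) auto
    ultimately show ?thesis by (simp add: Hardy_def)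
  qed
  with c have "summable (\<lambda>n. norm (T_op r seq (\<lambda>_. 1) n) powr r)"
    unfolding carleson_sequence_def ell_def by blast
  moreover have "norm (T_op r seq (\<lambda>_. 1) n) powr r = wt (seq n)" for n
  proof -
    show ?thesis using r wt_seq_pos[of n] by (simp add: T_op_eq[OF seq_bidisc] powr_powr)
  qed
  ultimately show False using seq_weights_not_summable by simp
qed

end

section \<open>Existence of the parameters\<close>

lemma block_base_exists:
  fixes d :: nat and c :: real
  assumes "d > 0" "c > 0"
  obtains b where "b > 0" "4 * d dvd b" "(real (b ^ (d + 1)))\<^sup>2 * 2 ^ 17 * exp (- (2 * real b / d)) \<le> c"
proof -
  \<comment> \<open>For fixed d the quantity is a monomial of fixed degree m in b times an
    exponential. The choice b = 4 d k settles divisibility and turns the exponent into - 8 k, which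
    is later weakened to - k to match the limit of x^m / exp x.\<close>
  define m where "m = 2 * (d + 1)"
  have "((\<lambda>x::real. (4 * real d) ^ m * 2 ^ 17 * (x ^ m / exp x)) \<longlongrightarrow> (4 * real d) ^ m * 2 ^ 17 * 0) at_top"
    by (intro tendsto_intros tendsto_power_div_exp_0)
  then have "\<forall>\<^sub>F x::real in at_top. (4 * real d) ^ m * 2 ^ 17 * (x ^ m / exp x) < c"
    using assms(2) by (intro order_tendstoD(2)) auto
  then obtain x0 :: real where x0: "\<And>x. x \<ge> x0 \<Longrightarrow> (4 * real d) ^ m * 2 ^ 17 * (x ^ m / exp x) < c"
    by (auto simp: eventually_at_top_linorder)
  define k :: nat where "k = nat \<lceil>max x0 1\<rceil>"
  have k: "x0 \<le> k" "k > 0" unfolding k_def by linarith+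
  have "(real ((4 * d * k) ^ (d + 1)))\<^sup>2 * 2 ^ 17 * exp (- (2 * real (4 * d * k) / d))
     = (4 * real d) ^ m * 2 ^ 17 * (real k ^ m * exp (- (8 * real k)))"
  proof -
    have "(real ((4 * d * k) ^ (d + 1)))\<^sup>2 = (4 * real d) ^ m * real k ^ m"
      by (simp only: of_nat_power of_nat_mult of_nat_numeral power_mult_distrib power_mult[symmetric] m_def mult.commute[of "d + 1"])
    moreover have "2 * real (4 * d * k) / d = 8 * real k" using assms(1) by simp
    ultimately show ?thesis by (simp only: mult_ac)
  qed
  also have "\<dots> \<le> (4 * real d) ^ m * 2 ^ 17 * (real k ^ m * exp (- real k))"
    by (intro mult_left_mono) auto
  also have "\<dots> = (4 * real d) ^ m * 2 ^ 17 * (real k ^ m / exp (real k))"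
    by (simp add: exp_minus field_simps)
  also have "\<dots> < c" using x0[OF k(1)] by simp
  finally show thesis using assms(1) k(2) by (intro that[of "4 * d * k"]) auto
qed

text \<open>The order d N, B N, d (N + 1) makes the conditions compatible: B N depends only on N and
  d N, and W N is known before d (N + 1) is fixed.\<close>

lemma blocks_exist: "\<exists>d B. blocks d B"
proof -
  define P where "P N d b \<longleftrightarrow> b > 0 \<and> 4 * d dvd b \<and> (real (b ^ (d + 1)))\<^sup>2 * 2 ^ 17 * exp (- (2 * real b / d)) \<le> 1 / (8 * 2 ^ N)"
    for N d b :: nat
  have ex_P: "\<exists>b. P N d b" if "d > 0" for N d
    using block_base_exists[OF that, of "1 / (8 * 2 ^ N)"] unfolding P_def by (metis divide_pos_pos mult_pos_pos zero_less_numeral zero_less_one zero_less_power)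
  define b where "b N d = (SOME b. P N d b)" for N d
  have b: "P N d (b N d)" if "d > 0" for N d
    unfolding b_def using ex_P[OF that] by (rule someI_ex)
  \<comment> \<open>The base is a choice function of the stage and of d, so the recursion runs over
    d alone. Its step makes the growth condition an equality for consecutive blocks.\<close>
  define d where "d = rec_nat 1 (\<lambda>N d. 2 ^ 21 * 4 ^ Suc N * (b N d ^ (d + 1))\<^sup>2 * d)"
  define B where "B N = b N (d N)" for N
  have d_Suc: "d (Suc N) = 2 ^ 21 * 4 ^ Suc N * (B N ^ (d N + 1))\<^sup>2 * d N" for N
    by (simp add: d_def B_def)
  have d: "d N > 0" for N
  proof (induction N)
    case (Suc N)
    then show ?case using b[of "d N" N] by (simp add: d_Suc B_def P_def)
  qed (simp add: d_def)
  have P: "P N (d N) (B N)" for N unfolding B_def by (rule b[OF d])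
  have W: "B N ^ (d N + 1) > 0" for N using P[of N] by (simp add: P_def)
  have d_mono: "d N \<le> d N'" if "N \<le> N'" for N N'
    using that
  proof (rule lift_Suc_mono_le[rotated])
    fix N
    have "1 * d N \<le> (2 ^ 21 * 4 ^ Suc N * (B N ^ (d N + 1))\<^sup>2) * d N"
      using W[of N] by (intro mult_le_mono1) simp
    then show "d N \<le> d (Suc N)" by (simp add: d_Suc)
  qed
  have W_d: "B N ^ (d N + 1) \<le> d (Suc N)" for N
  proof -
    have "B N ^ (d N + 1) * 1 \<le> B N ^ (d N + 1) * (2 ^ 21 * 4 ^ Suc N * B N ^ (d N + 1) * d N)"
      using W[of N] d[of N] by (intro mult_left_mono) auto
    then show ?thesis by (simp add: d_Suc power2_eq_square mult_ac)
  qed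
  have "blocks d B"
  proof
    show "0 < d N" "0 < B N" "4 * d N dvd B N"
      "(real (B N ^ (d N + 1)))\<^sup>2 * 2 ^ 17 * exp (- (2 * real (B N) / real (d N))) \<le> 1 / (8 * 2 ^ N)" for N
      using d P[of N] by (auto simp: P_def)
    show "2 ^ 21 * 4 ^ N' * (B N ^ (d N + 1))\<^sup>2 * d N \<le> d N'" if "N < N'" for N N'
    proof -
      obtain M where M: "N' = Suc M" using \<open>N < N'\<close> by (metis Suc_pred' gr_implies_not0 neq0_conv)
      have "N \<le> M" using \<open>N < N'\<close> M by simp
      \<comment> \<open>Monotonicity of W reduces the growth condition to consecutive blocks,
        through the chain W N \<le> d (N + 1) \<le> d M \<le> B M \<le> W M.\<close>
      have "B N ^ (d N + 1) \<le> B M ^ (d M + 1)"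
      proof (cases "N = M")
        case False
        then have "Suc N \<le> M" using \<open>N \<le> M\<close> by simp
        then have "B N ^ (d N + 1) \<le> d M" using W_d[of N] d_mono by (meson order.trans)
        also have "\<dots> \<le> B M" using P[of M] dvd_imp_le[of "4 * d M" "B M"] by (auto simp: P_def)
        also have "\<dots> \<le> B M ^ (d M + 1)" using P[of M] self_le_power[of "B M" "d M + 1"] by (simp add: P_def)
        finally show ?thesis .
      qed simp
      then have "2 ^ 21 * 4 ^ N' * (B N ^ (d N + 1))\<^sup>2 * d N \<le> 2 ^ 21 * 4 ^ N' * (B M ^ (d M + 1))\<^sup>2 * d M"
        using d_mono[OF \<open>N \<le> M\<close>] by (intro mult_le_mono power_mono) auto
      then show ?thesis using d_Suc[of M] M by simp
    qed
  qed
  then show ?thesis by blast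
qed

theorem theorem1p1:
  "\<exists>\<Lambda>\<^sub>0 :: nat \<Rightarrow> complex \<times> complex. range \<Lambda>\<^sub>0 \<subseteq> bidisc \<and>
     (\<forall>p::real. 1 \<le> p \<and> p \<le> 2 \<longrightarrow> simply_interpolating p \<Lambda>\<^sub>0) \<and>
     (\<forall>r::real. 1 \<le> r \<longrightarrow> \<not> carleson_sequence r \<Lambda>\<^sub>0)"
proof -
  obtain d B where "blocks d B" using blocks_exist by blast
  then interpret blocks d B "\<lambda>N. B N ^ (d N + 1)" by simp_all
  show ?thesis
    using seq_bidisc seq_simply_interpolating seq_not_carleson by (intro exI[of _ seq]) blast
qed

end
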